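(* Let $\mathbf f\in S(\mathcal H_{\mathbf d}^{\mathbb R})$, i.e. $\mathbf f=(f_1,\dots,f_n)$ is a system of real homogeneous polynomials in $n+1$ variables, $\deg f_i=d_i\ge 1$, with $\|\mathbf f\|=1$. If the algorithm RootCount (described in the context) stops on input $\mathbf f$, then the integer $r$ that it returns is the number of zeros of $\mathbf f$ on the sphere, i.e. $r=\#\{\zeta\in S^n:\mathbf f(\zeta)=0\}$.
   Context: Notation. $S^n$ is the unit sphere of $\mathbb R^{n+1}$, and $\rho(\mathbf x,\mathbf y)$ is the angular distance on $S^n$. For $\mathbf d=(d_1,\dots,d_n)$, $\mathcal H_{\mathbf d}^{\mathbb R}$ is the space of systems $\mathbf f=(f_1,\dots,f_n)$ with $f_i$ real homogeneous of degree $d_i$ in $n+1$ variables, with norm $\|\mathbf f\|^2=\sum_i\|f_i\|^2$, where for $f=\sum_{|\mathbf a|=d}f_{\mathbf a}\mathbf x^{\mathbf a}$ one sets $\|f\|^2=\sum_{\mathbf a}f_{\mathbf a}^2/\binom{d}{\mathbf a}$, $\binom{d}{\mathbf a}=\frac{d!}{a_0!\cdots a_n!}$. $S(\mathcal H_{\mathbf d}^{\mathbb R})$ is its unit sphere. For $\mathbf f\in S(\mathcal H_{\mathbf d}^{\mathbb R})$ and $\mathbf x\in S^n$, $\mu(\mathbf f,\mathbf x)=\left\|\left(\mathrm{diag}(d_1^{-1/2},\dots,d_n^{-1/2})\,D\mathbf f(\mathbf x)_{|\mathbf x^\perp}\right)^{-1}\right\|$ (operator norm; $+\infty$ if not invertible).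 Let $\alpha_0=\frac{13-3\sqrt{17}}{4}$, $r_0(\alpha)=\frac{1+\alpha-\sqrt{1-6\alpha+\alpha^2}}{4\alpha}$, and let $\alpha_*$ be the smallest positive root of $\alpha_*=\alpha_0(1-\alpha_*r_0(\alpha_* ))^2$ (numerically $\alpha_*>0.116$). Define $A(\mathbf f)=\{\mathbf x\in S^n:\ (\max d_i)^{3/2}\mu(\mathbf f,\mathbf x)^2\|\mathbf f(\mathbf x)\|<\alpha_*\}$ (points with $\mu(\mathbf f,\mathbf x)=\infty$ are not in $A(\mathbf f)$), and for $\mathbf x\in A(\mathbf f)$, $B_{\mathbf x}=\{\mathbf y\in S^n:\rho(\mathbf x,\mathbf y)\le r_{\mathbf x}\}$ with $r_{\mathbf x}=r_0(\alpha_* )\mu(\mathbf f,\mathbf x)\|\mathbf f(\mathbf x)\|$. For $\eta=2^{-t}$, the mesh is $C(\eta)=\{\mathbf x/\|\mathbf x\|:\ \mathbf x\in\mathbb R^{n+1},\ x_i\eta^{-1}\in\mathbb Z \text{ for all } i,\ \|\mathbf x\|_\infty=1\}$. The graph $\mathcal G_\eta$ has vertex set $\mathcal V_\eta=C(\eta)\cap A(\mathbf f)$ and an edge between $\mathbf x,\mathbf y\in\mathcal V_\eta$ whenever $B_{\mathbf x}\cap B_{\mathbf y}\neq\emptyset$. Algorithm RootCount. Input $\mathbf f\in S(\mathcal H_{\mathbf d}^{\mathbb R})$. Set $\eta\leftarrow 2^{-\lceil\log_2\sqrt{2n}\rceil}$. Repeat: $\eta\leftarrow\eta/2$; let $\mathcal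 U_1,\dots,\mathcal U_r$ be the connected components of $\mathcal G_\eta$; until both of the following hold: (i) for all $1\le i<j\le r$, every vertex $\mathbf x$ of $\mathcal U_i$ and every vertex $\mathbf y$ of $\mathcal U_j$ satisfy $\rho(\mathbf x,\mathbf y)>2\eta\sqrt n$; (ii) every $\mathbf x\in C(\eta)\setminus A(\mathbf f)$ satisfies $\|\mathbf f(\mathbf x)\|>\eta\sqrt{n\max d_i}/2$. Then return $r$. (All computations are exact.) *)

theory Defs
  imports
    "HOL-Analysis.Analysis"
    "HOL-Library.Poly_Mapping"
    "HOL-Library.While_Combinator"
begin

text \<open>
  Polynomials in the variables indexed by a finite type \<open>'m\<close> are finitely supported maps from
  exponent vectors to real coefficients. The index types \<open>'m\<close> and \<open>'n\<close> stand for the \<open>n + 1\<close>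
  variables and the \<open>n\<close> equations, so \<open>n = CARD('n)\<close>; the relation
  \<open>CARD('m) = CARD('n) + 1\<close> is a hypothesis wherever it is needed.
\<close>

type_synonym 'm rpoly = "('m \<Rightarrow>\<^sub>0 nat) \<Rightarrow>\<^sub>0 real"

definition homogeneous_of_degree :: "nat \<Rightarrow> 'm::finite rpoly \<Rightarrow> bool" where
  "homogeneous_of_degree d p \<longleftrightarrow>
     (\<forall>a\<in>Poly_Mapping.keys p. (\<Sum>i\<in>UNIV. Poly_Mapping.lookup a i) = d)"

definition eval_poly :: "'m::finite rpoly \<Rightarrow> real^'m \<Rightarrow> real" where
  "eval_poly p x =
     (\<Sum>a\<in>Poly_Mapping.keys p.
        Poly_Mapping.lookup p a * (\<Prod>i\<in>UNIV. (x $ i) ^ Poly_Mapping.lookup a i))"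

definition eval_sys :: "('n::finite \<Rightarrow> 'm::finite rpoly) \<Rightarrow> real^'m \<Rightarrow> real^'n" where
  "eval_sys f x = (\<chi> i. eval_poly (f i) x)"

definition multinomial_coeff :: "nat \<Rightarrow> ('m::finite \<Rightarrow>\<^sub>0 nat) \<Rightarrow> real" where
  "multinomial_coeff d a = fact d / (\<Prod>i\<in>UNIV. fact (Poly_Mapping.lookup a i))"

definition poly_norm :: "nat \<Rightarrow> 'm::finite rpoly \<Rightarrow> real" where
  "poly_norm d p =
     sqrt (\<Sum>a\<in>Poly_Mapping.keys p. (Poly_Mapping.lookup p a)\<^sup>2 / multinomial_coeff d a)"

definition sys_norm :: "('n::finite \<Rightarrow> nat) \<Rightarrow> ('n \<Rightarrow> 'm::finite rpoly) \<Rightarrow> real" where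
  "sys_norm d f = sqrt (\<Sum>i\<in>UNIV. (poly_norm (d i) (f i))\<^sup>2)"

definition Hd :: "('n::finite \<Rightarrow> nat) \<Rightarrow> ('n \<Rightarrow> 'm::finite rpoly) set" where
  "Hd d = {f. \<forall>i. homogeneous_of_degree (d i) (f i)}"

definition sphere_Hd :: "('n::finite \<Rightarrow> nat) \<Rightarrow> ('n \<Rightarrow> 'm::finite rpoly) set" where
  "sphere_Hd d = {f \<in> Hd d. sys_norm d f = 1}"

definition max_deg :: "('n::finite \<Rightarrow> nat) \<Rightarrow> real" where
  "max_deg d = real (Max (range d))"

definition ang_dist :: "real^'m \<Rightarrow> real^'m \<Rightarrow> real" where
  "ang_dist x y = arccos (x \<bullet> y)"

definition orth_compl :: "real^'m \<Rightarrow> (real^'m) set" where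
  "orth_compl x = {v. x \<bullet> v = 0}"

definition scaled_deriv ::
    "('n::finite \<Rightarrow> nat) \<Rightarrow> ('n \<Rightarrow> 'm::finite rpoly) \<Rightarrow> real^'m \<Rightarrow> real^'m \<Rightarrow> real^'n" where
  "scaled_deriv d f x v =
     (\<chi> i. (frechet_derivative (eval_sys f) (at x) v) $ i / sqrt (real (d i)))"

text \<open>
  The inverse of the restriction to \<open>orth_compl x\<close> is a map from all of \<open>real^'n\<close> into
  \<open>orth_compl x\<close>, so its operator norm is the \<open>onorm\<close> of the corresponding \<open>inv_into\<close>.
\<close>

definition mu ::
    "('n::finite \<Rightarrow> nat) \<Rightarrow> ('n \<Rightarrow> 'm::finite rpoly) \<Rightarrow> real^'m \<Rightarrow> ereal" where
  "mu d f x =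
     (if bij_betw (scaled_deriv d f x) (orth_compl x) UNIV
      then ereal (onorm (inv_into (orth_compl x) (scaled_deriv d f x)))
      else \<infinity>)"

definition alpha_0 :: real where
  "alpha_0 = (13 - 3 * sqrt 17) / 4"

definition r_0 :: "real \<Rightarrow> real" where
  "r_0 a = (1 + a - sqrt (1 - 6 * a + a\<^sup>2)) / (4 * a)"

text \<open>
  The condition \<open>1 - 6 * a + a\<^sup>2 \<ge> 0\<close> restricts to the domain of \<open>r_0\<close>, because the library's
  \<open>sqrt\<close> is also defined (as an odd function) on negative arguments. The least element exists and
  is approximately 0.1168.
\<close>

definition alpha_star :: real where
  "alpha_star =
     (LEAST a. 0 < a \<and> 0 \<le> 1 - 6 * a + a\<^sup>2 \<and> a = alpha_0 * (1 - a * r_0 a)\<^sup>2)"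

text \<open>
  The explicit condition \<open>mu d f x \<noteq> \<infinity>\<close> in \<open>A_set\<close> matters for degenerate zeros, since
  \<open>\<infinity> * 0 = 0\<close> in type \<open>ereal\<close>.
\<close>

definition A_set ::
    "('n::finite \<Rightarrow> nat) \<Rightarrow> ('n \<Rightarrow> 'm::finite rpoly) \<Rightarrow> (real^'m) set" where
  "A_set d f =
     {x \<in> sphere 0 1. mu d f x \<noteq> \<infinity> \<and>
        ereal (max_deg d powr (3 / 2)) * (mu d f x)\<^sup>2 * ereal (norm (eval_sys f x))
          < ereal alpha_star}"

definition radius ::
    "('n::finite \<Rightarrow> nat) \<Rightarrow> ('n \<Rightarrow> 'm::finite rpoly) \<Rightarrow> real^'m \<Rightarrow> real" where
  "radius d f x = r_0 alpha_star * real_of_ereal (mu d f x) * norm (eval_sys f x)"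

definition B_set ::
    "('n::finite \<Rightarrow> nat) \<Rightarrow> ('n \<Rightarrow> 'm::finite rpoly) \<Rightarrow> real^'m \<Rightarrow> (real^'m) set" where
  "B_set d f x = {y \<in> sphere 0 1. ang_dist x y \<le> radius d f x}"

definition mesh :: "real \<Rightarrow> (real^'m::finite) set" where
  "mesh \<eta> = {x /\<^sub>R norm x |x. (\<forall>i. x $ i * inverse \<eta> \<in> \<int>) \<and> infnorm x = 1}"

definition vertices ::
    "('n::finite \<Rightarrow> nat) \<Rightarrow> ('n \<Rightarrow> 'm::finite rpoly) \<Rightarrow> real \<Rightarrow> (real^'m) set" where
  "vertices d f \<eta> = mesh \<eta> \<inter> A_set d f"

definition edges ::
    "('n::finite \<Rightarrow> nat) \<Rightarrow> ('n \<Rightarrow> 'm::finite rpoly) \<Rightarrow> real \<Rightarrow> ((real^'m) \<times> (real^'m)) set" where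
  "edges d f \<eta> =
     {(x, y). x \<in> vertices d f \<eta> \<and> y \<in> vertices d f \<eta> \<and> B_set d f x \<inter> B_set d f y \<noteq> {}}"

text \<open>Connected components are given by their vertex sets; \<open>edges\<close> is a symmetric relation.\<close>

definition components_G ::
    "('n::finite \<Rightarrow> nat) \<Rightarrow> ('n \<Rightarrow> 'm::finite rpoly) \<Rightarrow> real \<Rightarrow> (real^'m) set set" where
  "components_G d f \<eta> =
     vertices d f \<eta> // ((edges d f \<eta>)\<^sup>* \<inter> vertices d f \<eta> \<times> vertices d f \<eta>)"

definition stop_cond ::
    "('n::finite \<Rightarrow> nat) \<Rightarrow> ('n \<Rightarrow> 'm::finite rpoly) \<Rightarrow> real \<Rightarrow> bool" where
  "stop_cond d f \<eta> \<longleftrightarrow>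
     (\<forall>U\<in>components_G d f \<eta>. \<forall>W\<in>components_G d f \<eta>. U \<noteq> W \<longrightarrow>
        (\<forall>x\<in>U. \<forall>y\<in>W. ang_dist x y > 2 * \<eta> * sqrt (real CARD('n)))) \<and>
     (\<forall>x\<in>mesh \<eta> - A_set d f.
        norm (eval_sys f x) > \<eta> * sqrt (real CARD('n) * max_deg d) / 2)"

definition eta_init :: "'n::finite itself \<Rightarrow> real" where
  "eta_init _ = 2 powi (- \<lceil>log 2 (sqrt (2 * real CARD('n)))\<rceil>)"

text \<open>
  A repeat-until loop executes its body before the first test, so the while loop starts from half
  of the initial mesh size. The result is \<open>None\<close> iff the loop does not terminate.
\<close>

definition RootCount ::
    "('n::finite \<Rightarrow> nat) \<Rightarrow> ('n \<Rightarrow> 'm::finite rpoly) \<Rightarrow> nat option" where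
  "RootCount d f =
     map_option (\<lambda>\<eta>. card (components_G d f \<eta>))
       (while_option (\<lambda>\<eta>. \<not> stop_cond d f \<eta>) (\<lambda>\<eta>. \<eta> / 2) (eta_init TYPE('n) / 2))"

end

theory Submission
  imports Defs
begin

text \<open>
  All estimates come from one inequality: for a form \<open>p\<close> of degree \<open>d\<close> and Weyl norm 1,
  \<open>(\<Sum>i. c i * p (y i))\<^sup>2 \<le> (\<Sum>i j. c i * c j * (y i \<bullet> y j) ^ d)\<close>. It bounds values, derivatives and
  Taylor remainders on tangent spaces, so that the Newton map of a point \<open>x \<in> A_set d f\<close> is a
  contraction of the tangent space at \<open>x\<close>: the ball \<open>B_set d f x\<close> contains exactly one zero
  \<open>zeta x\<close>, points with meeting balls share their zero, and any other zero is more than ten times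
  farther from \<open>x\<close> than \<open>zeta x\<close> may be. Vertices are thus adjacent if and only if they have the
  same zero, and the components correspond to the zeros of the form \<open>zeta x\<close>.

  It remains to see that every zero \<open>z\<close> is attached to a vertex. The grid point \<open>a\<close> next to \<open>z\<close> is a
  vertex, since \<open>f\<close> is small there and (ii) holds. If \<open>zeta\<close> of it were not \<open>z\<close>, no mesh
  neighbour of \<open>a\<close> could be a vertex: by (i) the two would share a zero different from \<open>z\<close>, and
  both would be much closer to it than to \<open>z\<close>, hence too close to each other. But (ii) produces
  such a neighbour. For many equations it is about \<open>sqrt n / 4\<close> grid steps away, where \<open>f\<close> is
  small by the Lipschitz bound at \<open>zeta x\<close>. For \<open>2 \<le> n \<le> 25\<close> it is a vertex of the cell of \<open>z\<close>, as a
  suitable weighted mean of \<open>(norm (f y))\<^sup>2\<close> over these vertices is small. For \<open>n = 1\<close> a binary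
  form with two zeros between two mesh points cannot be large at both of them.
\<close>

section \<open>The Weyl norm\<close>

text \<open>Membership of \<open>x\<close> in \<open>A_set d f\<close> yields some zero in the ball
  of \<open>x\<close>, but does not say which one. The threshold in (ii) is the product of the
  Lipschitz constant \<open>sqrt D\<close> and \<open>\<eta> * sqrt n / 2\<close>, the largest
  distance of a zero, scaled to the cube surface, from its rounded grid point. So \<open>a\<close>
  becomes a vertex with no margin left, and nothing at \<open>a\<close> alone ties it to
  \<open>z\<close>: the contradiction has to come from a second vertex. If \<open>zeta x\<close>
  were not \<open>z\<close>, both vertices would be within eight percent of their distance to
  \<open>z\<close> from their common zero, yet an axis step of length \<open>\<bar>s\<bar>\<close>
  keeps them, up to a common scaling, \<open>7 / 10 * \<bar>s\<bar>\<close> apart. As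
  \<open>z\<close> is at most \<open>sqrt n / 2\<close> grid steps away, unit steps are long enough
  for \<open>n \<le> 25\<close>. Longer steps, \<open>sqrt n / 4\<close> rounded up, stay below
  \<open>45 / 100 * sqrt n\<close> once \<open>n \<ge> 25\<close>, hence the common border of the
  two cases. For \<open>n = 1\<close> averaging over neighbours breaks down: the only neighbour in
  the cell is at least half a step from \<open>z\<close> and possibly a full one.\<close>

definition exponents :: "nat \<Rightarrow> ('m::finite \<Rightarrow>\<^sub>0 nat) set" where
  "exponents d = {a. (\<Sum>i\<in>UNIV. Poly_Mapping.lookup a i) = d}"

lemma finite_exponents: "finite (exponents d :: ('m::finite \<Rightarrow>\<^sub>0 nat) set)"
proof -
  have "Poly_Mapping.lookup ` (exponents d :: ('m \<Rightarrow>\<^sub>0 nat) set) \<subseteq> PiE UNIV (\<lambda>_. {..d})"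
  proof clarify
    fix a :: "'m \<Rightarrow>\<^sub>0 nat" assume a: "a \<in> exponents d"
    have "Poly_Mapping.lookup a i \<le> d" for i
      using a member_le_sum[of i UNIV "Poly_Mapping.lookup a"] by (simp add: exponents_def)
    then show "Poly_Mapping.lookup a \<in> PiE UNIV (\<lambda>_. {..d})" by auto
  qed
  moreover have "finite (PiE (UNIV :: 'm set) (\<lambda>_. {..d}))"
    by (intro finite_PiE) auto
  ultimately have "finite (Poly_Mapping.lookup ` (exponents d :: ('m \<Rightarrow>\<^sub>0 nat) set))"
    by (rule finite_subset)
  then show ?thesis
    by (rule finite_imageD) (simp add: inj_on_def)
qed

lemma multinomial_coeff_pos: "multinomial_coeff d a > 0"
  unfolding multinomial_coeff_def by (intro divide_pos_pos prod_pos) auto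

lemma exponents_Suc_image:
  fixes i :: "'m::finite"
  shows "(\<lambda>a. a + Poly_Mapping.single i 1) ` exponents d
    = {b \<in> exponents (Suc d). Poly_Mapping.lookup b i > 0}" (is "?l = ?r")
proof
  show "?l \<subseteq> ?r"
  proof clarify
    fix a :: "'m \<Rightarrow>\<^sub>0 nat" assume a: "a \<in> exponents d"
    have "(\<Sum>j\<in>UNIV. Poly_Mapping.lookup (a + Poly_Mapping.single i 1) j)
        = (\<Sum>j\<in>UNIV. Poly_Mapping.lookup a j + (if j = i then 1 else 0))"
      by (intro sum.cong) (simp_all add: lookup_add lookup_single when_def)
    then show "a + Poly_Mapping.single i 1 \<in> exponents (Suc d)
        \<and> 0 < Poly_Mapping.lookup (a + Poly_Mapping.single i 1) i"
      using a by (simp add: exponents_def sum.distrib lookup_add)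
  qed
  show "?r \<subseteq> ?l"
  proof
    fix b assume b: "b \<in> ?r"
    define a where "a = b - Poly_Mapping.single i 1"
    have la: "Poly_Mapping.lookup b j = Poly_Mapping.lookup a j + (if j = i then 1 else 0)" for j
      using b by (cases "j = i") (simp_all add: a_def lookup_minus lookup_single when_def)
    have ba: "b = a + Poly_Mapping.single i 1"
      by (rule poly_mapping_eqI) (simp add: la lookup_add lookup_single when_def)
    moreover have "a \<in> exponents d"
      using b by (simp add: exponents_def la sum.distrib)
    ultimately show "b \<in> ?l" by blast
  qed
qed

theorem multinomial_theorem:
  fixes z :: "'m::finite \<Rightarrow> real"
  shows "(\<Sum>i\<in>UNIV. z i) ^ d
    = (\<Sum>a\<in>exponents d. multinomial_coeff d a * (\<Prod>i\<in>UNIV. z i ^ Poly_Mapping.lookup a i))"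
proof (induction d)
  case 0
  have "exponents 0 = {0 :: 'm \<Rightarrow>\<^sub>0 nat}"
    by (auto simp: exponents_def intro: poly_mapping_eqI)
  then show ?case by (simp add: multinomial_coeff_def)
next
  case (Suc d)
  define m where "m = (\<lambda>a. \<Prod>i\<in>UNIV. z i ^ Poly_Mapping.lookup a i)"
  \<comment> \<open>The share \<open>lookup b i / Suc d\<close> of the term of \<open>b\<close>. For
    fixed \<open>b\<close> the shares add up to the whole term, which is the Pascal recursion for
    multinomial coefficients.\<close>
  define g where "g = (\<lambda>i b. multinomial_coeff (Suc d) b * (Poly_Mapping.lookup b i / Suc d) * m b)"
  have step: "z i * (multinomial_coeff d a * m a) = g i (a + Poly_Mapping.single i 1)" for i a
  proof -
    let ?b = "a + Poly_Mapping.single i 1"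
    have "m ?b = (\<Prod>j\<in>UNIV. z j ^ Poly_Mapping.lookup a j * (if j = i then z i else 1))"
      unfolding m_def by (intro prod.cong) (auto simp: lookup_add lookup_single)
    then have "m ?b = z i * m a"
      by (simp add: m_def prod.distrib)
    moreover have "(\<Prod>j\<in>UNIV. fact (Poly_Mapping.lookup ?b j) :: real)
        = (\<Prod>j\<in>UNIV. fact (Poly_Mapping.lookup a j) * (if j = i then real (Suc (Poly_Mapping.lookup a i)) else 1))"
      by (intro prod.cong) (auto simp: lookup_add lookup_single)
    then have "(\<Prod>j\<in>UNIV. fact (Poly_Mapping.lookup ?b j) :: real)
        = (\<Prod>j\<in>UNIV. fact (Poly_Mapping.lookup a j)) * real (Suc (Poly_Mapping.lookup a i))"
      by (simp add: prod.distrib del: of_nat_Suc)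
    moreover have "Poly_Mapping.lookup ?b i = Suc (Poly_Mapping.lookup a i)"
      by (simp add: lookup_add)
    moreover have "s * fact d / (P * k) * (k / s) = fact d / P"
      if "k \<noteq> 0" "s \<noteq> 0" for P k s :: real
      using that by simp
    ultimately show ?thesis
      by (simp add: g_def multinomial_coeff_def del: of_nat_Suc)
  qed
  have "(\<Sum>i\<in>UNIV. z i) ^ Suc d = (\<Sum>i\<in>UNIV. z i) * (\<Sum>a\<in>exponents d. multinomial_coeff d a * m a)"
    by (simp add: Suc.IH m_def)
  also have "\<dots> = (\<Sum>i\<in>UNIV. \<Sum>a\<in>exponents d. g i (a + Poly_Mapping.single i 1))"
    by (simp only: sum_product step)
  also have "\<dots> = (\<Sum>i\<in>UNIV. \<Sum>b\<in>exponents (Suc d). g i b)"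
  proof (rule sum.cong[OF refl])
    fix i :: 'm
    have "(\<Sum>a\<in>exponents d. g i (a + Poly_Mapping.single i 1))
        = sum (g i) ((\<lambda>a. a + Poly_Mapping.single i 1) ` exponents d)"
      by (subst sum.reindex) (auto simp: inj_on_def)
    also have "\<dots> = sum (g i) (exponents (Suc d))"
      unfolding exponents_Suc_image
      by (rule sum.mono_neutral_left) (auto simp: finite_exponents g_def)
    finally show "(\<Sum>a\<in>exponents d. g i (a + Poly_Mapping.single i 1)) = sum (g i) (exponents (Suc d))" .
  qed
  also have "\<dots> = (\<Sum>b\<in>exponents (Suc d). \<Sum>i\<in>UNIV. g i b)"
    by (rule sum.swap)
  also have "\<dots> = (\<Sum>b\<in>exponents (Suc d). multinomial_coeff (Suc d) b * m b)"
  proof (rule sum.cong[OF refl])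
    fix b :: "'m \<Rightarrow>\<^sub>0 nat" assume "b \<in> exponents (Suc d)"
    then have "(\<Sum>i\<in>UNIV. real (Poly_Mapping.lookup b i)) = Suc d"
      by (simp add: exponents_def flip: of_nat_sum)
    then have "(\<Sum>i\<in>UNIV. real (Poly_Mapping.lookup b i) / Suc d) = 1"
      by (simp only: sum_divide_distrib[symmetric]) simp
    moreover have "(\<Sum>i\<in>UNIV. g i b)
        = multinomial_coeff (Suc d) b * m b * (\<Sum>i\<in>UNIV. real (Poly_Mapping.lookup b i) / Suc d)"
      unfolding sum_distrib_left g_def by (simp only: mult_ac)
    ultimately show "(\<Sum>i\<in>UNIV. g i b) = multinomial_coeff (Suc d) b * m b"
      by (simp only: mult_1_right)
  qed
  finally show ?case by (simp add: m_def)
qed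

text \<open>
  The Weyl norm makes evaluation at \<open>y\<close> the inner product with the polynomial
  \<open>x \<mapsto> (x \<bullet> y) ^ d\<close>. This is Cauchy-Schwarz against a combination of such polynomials, and it is
  the only property of the norm that the proof uses.
\<close>

theorem kernel_inequality:
  fixes p :: "'m::finite rpoly" and y :: "'i \<Rightarrow> real^'m"
  assumes p: "homogeneous_of_degree d p" and I: "finite I"
  shows "(\<Sum>i\<in>I. c i * eval_poly p (y i))\<^sup>2
    \<le> (poly_norm d p)\<^sup>2 * (\<Sum>i\<in>I. \<Sum>j\<in>I. c i * c j * (y i \<bullet> y j) ^ d)"
proof -
  define m where "m = (\<lambda>a (x::real^'m). \<Prod>i\<in>UNIV. (x $ i) ^ Poly_Mapping.lookup a i)"
  define w where "w = (\<lambda>a :: 'm \<Rightarrow>\<^sub>0 nat. multinomial_coeff d a)"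
  \<comment> \<open>By the multinomial theorem, \<open>w a * q a\<close> is the coefficient of the
    monomial \<open>a\<close> in \<open>\<Sum>i\<in>I. c i * (x \<bullet> y i) ^ d\<close>.\<close>
  define q where "q = (\<lambda>a. \<Sum>i\<in>I. c i * m a (y i))"
  let ?K = "Poly_Mapping.keys p" and ?p = "Poly_Mapping.lookup p"
  have w: "w a > 0" for a by (simp add: w_def multinomial_coeff_pos)
  have K: "?K \<subseteq> exponents d"
    using p by (auto simp: homogeneous_of_degree_def exponents_def)
  have "(\<Sum>i\<in>I. c i * eval_poly p (y i)) = (\<Sum>a\<in>?K. ?p a * q a)"
    unfolding eval_poly_def q_def m_def sum_distrib_left
    by (subst sum.swap) (simp add: mult_ac)
  also have "\<dots> = (\<Sum>a\<in>?K. (?p a / sqrt (w a)) * (sqrt (w a) * q a))"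
  proof (intro sum.cong refl)
    fix a
    show "?p a * q a = (?p a / sqrt (w a)) * (sqrt (w a) * q a)"
      using w[of a] by simp
  qed
  finally have "(\<Sum>i\<in>I. c i * eval_poly p (y i))\<^sup>2
      \<le> (\<Sum>a\<in>?K. (?p a / sqrt (w a))\<^sup>2) * (\<Sum>a\<in>?K. (sqrt (w a) * q a)\<^sup>2)"
    by (simp only: Cauchy_Schwarz_ineq_sum)
  also have "(\<Sum>a\<in>?K. (?p a / sqrt (w a))\<^sup>2) = (poly_norm d p)\<^sup>2"
    using w by (simp add: poly_norm_def w_def power_divide less_imp_le sum_nonneg)
  also have "(\<Sum>a\<in>?K. (sqrt (w a) * q a)\<^sup>2) \<le> (\<Sum>a\<in>exponents d. w a * (q a)\<^sup>2)"
    using w K by (simp add: power_mult_distrib less_imp_le)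
      (intro sum_mono2, auto simp: finite_exponents less_imp_le[OF w])
  also have "(\<Sum>a\<in>exponents d. w a * (q a)\<^sup>2)
      = (\<Sum>a\<in>exponents d. \<Sum>i\<in>I. \<Sum>j\<in>I. w a * (c i * m a (y i) * (c j * m a (y j))))"
    unfolding q_def power2_eq_square sum_product by (simp only: sum_distrib_left)
  also have "\<dots> = (\<Sum>i\<in>I. \<Sum>j\<in>I. \<Sum>a\<in>exponents d. w a * (c i * m a (y i) * (c j * m a (y j))))"
    by (simp only: sum.swap[of _ I "exponents d"])
  also have "\<dots> = (\<Sum>i\<in>I. \<Sum>j\<in>I. c i * c j * (y i \<bullet> y j) ^ d)"
  proof (intro sum.cong refl)
    fix i j
    have "(y i \<bullet> y j) ^ d = (\<Sum>a\<in>exponents d. w a * (m a (y i) * m a (y j)))"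
      by (simp add: inner_vec_def multinomial_theorem w_def m_def power_mult_distrib prod.distrib)
    then show "(\<Sum>a\<in>exponents d. w a * (c i * m a (y i) * (c j * m a (y j))))
        = c i * c j * (y i \<bullet> y j) ^ d"
      by (simp add: sum_distrib_left mult_ac)
  qed
  finally show ?thesis
    by (simp add: mult_left_mono)
qed

section \<open>Differentiability, and value and Taylor bounds from the kernel inequality\<close>

lemma eval_poly_scaleR:
  assumes "homogeneous_of_degree d p"
  shows "eval_poly p (c *\<^sub>R x) = c ^ d * eval_poly p x"
proof -
  have "(\<Prod>i\<in>UNIV. ((c *\<^sub>R x) $ i) ^ Poly_Mapping.lookup a i)
      = c ^ d * (\<Prod>i\<in>UNIV. (x $ i) ^ Poly_Mapping.lookup a i)" if "a \<in> Poly_Mapping.keys p" for a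
    using assms that
    by (auto simp: homogeneous_of_degree_def power_mult_distrib prod.distrib power_sum[symmetric])
  then show ?thesis
    by (simp add: eval_poly_def sum_distrib_left mult_ac)
qed

lemma differentiable_eval_poly: "eval_poly p differentiable (at x)"
proof -
  have prod: "(\<lambda>x. \<Prod>i\<in>A. (x $ i) ^ k i) differentiable (at x)" if "finite A" for A and k :: "'a \<Rightarrow> nat"
    using that
  proof induction
    case (insert j A)
    have "(\<lambda>x. x $ j) differentiable (at x)"
      by (intro bounded_linear_imp_differentiable bounded_linear_vec_nth)
    then have "(\<lambda>x. x $ j ^ k j * (\<Prod>i\<in>A. (x $ i) ^ k i)) differentiable (at x)"
      using insert by (intro differentiable_mult differentiable_power)
    with insert show ?case by simp
  qed simp
  show ?thesis
    unfolding eval_poly_def[abs_def]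
    by (intro differentiable_sum differentiable_mult differentiable_const finite_keys ballI prod finite)
qed

lemma differentiable_eval_sys:
  fixes f :: "'b::finite \<Rightarrow> 'm::finite rpoly"
  shows "eval_sys f differentiable (at x)"
proof (subst differentiable_componentwise_within, rule ballI)
  fix b :: "real^'b" assume "b \<in> Basis"
  then obtain i where b: "b = axis i 1" by (auto simp: Basis_vec_def)
  show "(\<lambda>x. eval_sys f x \<bullet> b) differentiable (at x)"
    unfolding b by (simp add: eval_sys_def inner_axis differentiable_eval_poly)
qed

lemma has_derivative_eval_poly_component:
  "(eval_poly (f i) has_derivative (\<lambda>v. frechet_derivative (eval_sys f) (at x) v $ i)) (at x)"
proof -
  have "(eval_sys f has_derivative frechet_derivative (eval_sys f) (at x)) (at x)"
    using differentiable_eval_sys frechet_derivative_works by blast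
  from bounded_linear.has_derivative[OF bounded_linear_vec_nth this, of i]
  show ?thesis by (simp add: eval_sys_def)
qed

text \<open>Since \<open>p\<close> vanishes at \<open>z\<close>, any multiple of the evaluation at
  \<open>z\<close> may be added for free. The coefficient \<open>- (y \<bullet> z) ^ d\<close>
  projects the kernel polynomial of \<open>y\<close> off that of \<open>z\<close> and so makes the
  Gram sum smallest.\<close>

lemma two_point_bound:
  fixes p :: "'m::finite rpoly"
  assumes p: "homogeneous_of_degree d p" and y: "norm y = 1" and z: "norm z = 1"
    and 0: "eval_poly p z = 0"
  shows "(eval_poly p y)\<^sup>2 \<le> (poly_norm d p)\<^sup>2 * (1 - (y \<bullet> z) ^ (2 * d))"
proof -
  have [simp]: "y \<bullet> y = 1" "z \<bullet> z = 1" using y z by (simp_all add: dot_square_norm)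
  have "(\<Sum>b\<in>UNIV. F b) = F True + F False" for F :: "bool \<Rightarrow> real"
    by (simp add: UNIV_bool)
  then have "(1 * eval_poly p y + - ((y \<bullet> z) ^ d) * eval_poly p z)\<^sup>2
      \<le> (poly_norm d p)\<^sup>2 * ((1 * 1 * (y \<bullet> y) ^ d + 1 * - ((y \<bullet> z) ^ d) * (y \<bullet> z) ^ d)
        + (- ((y \<bullet> z) ^ d) * 1 * (z \<bullet> y) ^ d + - ((y \<bullet> z) ^ d) * - ((y \<bullet> z) ^ d) * (z \<bullet> z) ^ d))"
    using kernel_inequality[OF p, of UNIV "\<lambda>b. if b then 1 else - ((y \<bullet> z) ^ d)" "\<lambda>b. if b then y else z",
        OF finite]
    by (simp only: if_True if_False)
  then show ?thesis
    by (simp add: 0 inner_commute[of z y] power_mult power2_eq_square power_commutes flip: power_mult_distrib)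
qed

lemma Bernoulli_complement:
  fixes s :: real
  assumes "0 \<le> s" "s \<le> 1"
  shows "1 - s ^ d \<le> d * (1 - s)"
  using Bernoulli_inequality[of "s - 1" d] assms by (simp add: algebra_simps)

lemma power_diff_quotient_tendsto:
  fixes a :: real
  shows "((\<lambda>h. ((1 + h * a) ^ d - 1) / h) \<longlongrightarrow> d * a) (at 0)"
proof -
  have "((\<lambda>h. (1 + h * a) ^ d) has_field_derivative d * a) (at 0)"
    by (auto intro!: derivative_eq_intros)
  then show ?thesis by (simp add: has_field_derivative_iff)
qed

lemma power_diff_quotient_tendsto_sq:
  fixes a :: real
  shows "((\<lambda>h. ((1 + h\<^sup>2 * a) ^ d - 1) / h\<^sup>2) \<longlongrightarrow> d * a) (at 0)"
proof -
  have "filterlim (\<lambda>h::real. h\<^sup>2) (at 0) (at 0)"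
    unfolding filterlim_at by (auto simp: eventually_at_filter intro!: tendsto_eq_intros)
  from filterlim_compose[OF power_diff_quotient_tendsto this] show ?thesis .
qed

lemma has_derivative_quotient_tendsto:
  fixes g :: "'a::real_normed_vector \<Rightarrow> real"
  assumes "(g has_derivative D) (at x)"
  shows "((\<lambda>h. (g (x + h *\<^sub>R v) - g x) / h) \<longlongrightarrow> D v) (at 0)"
proof -
  have "((\<lambda>h. g (x + h *\<^sub>R v)) has_derivative (\<lambda>h. D (h *\<^sub>R v))) (at 0)"
    by (rule has_derivative_compose[of "\<lambda>h. x + h *\<^sub>R v" "\<lambda>h. h *\<^sub>R v"])
      (auto intro!: derivative_eq_intros simp: assms)
  then have "((\<lambda>h. g (x + h *\<^sub>R v)) has_field_derivative D v) (at 0)"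
    using linear_scale[OF has_derivative_linear[OF assms]]
    by (simp add: has_field_derivative_def mult_commute_abs)
  then show ?thesis by (simp add: has_field_derivative_iff)
qed

text \<open>The kernel inequality for difference quotients, in the limit. Tangency of
  \<open>v\<close> makes every inner product with \<open>x\<close> equal to 1, so only
  \<open>(1 + h^2 * norm v ^2) ^ d - 1\<close> survives.\<close>

lemma derivative_bound:
  fixes p :: "'m::finite rpoly"
  assumes p: "homogeneous_of_degree d p" and x: "norm x = 1" and v: "x \<bullet> v = 0"
    and D: "(eval_poly p has_derivative D) (at x)"
  shows "(D v)\<^sup>2 \<le> (poly_norm d p)\<^sup>2 * (d * (norm v)\<^sup>2)"
proof (rule tendsto_le[OF trivial_limit_at])
  let ?g = "eval_poly p"
  show "((\<lambda>h. ((?g (x + h *\<^sub>R v) - ?g x) / h)\<^sup>2) \<longlongrightarrow> (D v)\<^sup>2) (at 0)"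
    by (intro tendsto_power has_derivative_quotient_tendsto D)
  show "((\<lambda>h. (poly_norm d p)\<^sup>2 * (((1 + h\<^sup>2 * (norm v)\<^sup>2) ^ d - 1) / h\<^sup>2))
      \<longlongrightarrow> (poly_norm d p)\<^sup>2 * (d * (norm v)\<^sup>2)) (at 0)"
    by (intro tendsto_mult tendsto_const power_diff_quotient_tendsto_sq)
  have [simp]: "x \<bullet> x = 1" "v \<bullet> x = 0" "x \<bullet> v = 0"
    using x v by (simp_all add: dot_square_norm inner_commute)
  have "((?g (x + h *\<^sub>R v) - ?g x) / h)\<^sup>2 \<le> (poly_norm d p)\<^sup>2 * (((1 + h\<^sup>2 * (norm v)\<^sup>2) ^ d - 1) / h\<^sup>2)"
    if "h \<noteq> 0" for h
  proof -
    have "(?g (x + h *\<^sub>R v) - ?g x)\<^sup>2 \<le> (poly_norm d p)\<^sup>2 * ((1 + h\<^sup>2 * (norm v)\<^sup>2) ^ d - 1)"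
      using kernel_inequality[OF p, of UNIV "\<lambda>b. if b then 1 else - 1" "\<lambda>b. if b then x + h *\<^sub>R v else x"]
      unfolding power2_norm_eq_inner
      by (simp add: UNIV_bool inner_add_left inner_add_right power2_eq_square algebra_simps)
    then show ?thesis
      using that by (simp add: power_divide divide_right_mono)
  qed
  then show "\<forall>\<^sub>F h in at 0. ((?g (x + h *\<^sub>R v) - ?g x) / h)\<^sup>2
      \<le> (poly_norm d p)\<^sup>2 * (((1 + h\<^sup>2 * (norm v)\<^sup>2) ^ d - 1) / h\<^sup>2)"
    by (simp add: eventually_at_filter)
qed

lemma kernel_inequality_4:
  fixes p :: "'m::finite rpoly"
  assumes p: "homogeneous_of_degree d p"
  shows "(a * eval_poly p y1 + b * eval_poly p y2 + c * eval_poly p y3 + e * eval_poly p y4)\<^sup>2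
    \<le> (poly_norm d p)\<^sup>2 * (a\<^sup>2 * (y1 \<bullet> y1) ^ d + b\<^sup>2 * (y2 \<bullet> y2) ^ d + c\<^sup>2 * (y3 \<bullet> y3) ^ d
      + e\<^sup>2 * (y4 \<bullet> y4) ^ d + 2 * a * b * (y1 \<bullet> y2) ^ d + 2 * a * c * (y1 \<bullet> y3) ^ d
      + 2 * a * e * (y1 \<bullet> y4) ^ d + 2 * b * c * (y2 \<bullet> y3) ^ d + 2 * b * e * (y2 \<bullet> y4) ^ d
      + 2 * c * e * (y3 \<bullet> y4) ^ d)"
proof -
  have "(\<Sum>i<4. F i) = F 0 + F 1 + F 2 + F 3" for F :: "nat \<Rightarrow> real"
    by (simp add: eval_nat_numeral)
  then have "(a * eval_poly p y1 + b * eval_poly p y2 + c * eval_poly p y3 + e * eval_poly p y4)\<^sup>2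
    \<le> (poly_norm d p)\<^sup>2 * ((a * a * (y1 \<bullet> y1) ^ d + a * b * (y1 \<bullet> y2) ^ d + a * c * (y1 \<bullet> y3) ^ d
        + a * e * (y1 \<bullet> y4) ^ d)
      + (b * a * (y2 \<bullet> y1) ^ d + b * b * (y2 \<bullet> y2) ^ d + b * c * (y2 \<bullet> y3) ^ d + b * e * (y2 \<bullet> y4) ^ d)
      + (c * a * (y3 \<bullet> y1) ^ d + c * b * (y3 \<bullet> y2) ^ d + c * c * (y3 \<bullet> y3) ^ d + c * e * (y3 \<bullet> y4) ^ d)
      + (e * a * (y4 \<bullet> y1) ^ d + e * b * (y4 \<bullet> y2) ^ d + e * c * (y4 \<bullet> y3) ^ d + e * e * (y4 \<bullet> y4) ^ d))"
    using kernel_inequality[OF p, of "{..<4::nat}" "\<lambda>i. [a, b, c, e] ! i" "\<lambda>i. [y1, y2, y3, y4] ! i"]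
    by (simp add: numeral_2_eq_2 numeral_3_eq_3)
  also have "\<dots> = (poly_norm d p)\<^sup>2 * (a\<^sup>2 * (y1 \<bullet> y1) ^ d + b\<^sup>2 * (y2 \<bullet> y2) ^ d + c\<^sup>2 * (y3 \<bullet> y3) ^ d
      + e\<^sup>2 * (y4 \<bullet> y4) ^ d + 2 * a * b * (y1 \<bullet> y2) ^ d + 2 * a * c * (y1 \<bullet> y3) ^ d
      + 2 * a * e * (y1 \<bullet> y4) ^ d + 2 * b * c * (y2 \<bullet> y3) ^ d + 2 * b * e * (y2 \<bullet> y4) ^ d
      + 2 * c * e * (y3 \<bullet> y4) ^ d)"
    unfolding inner_commute[of y2 y1] inner_commute[of y3 y1] inner_commute[of y4 y1]
      inner_commute[of y3 y2] inner_commute[of y4 y2] inner_commute[of y4 y3]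
    by algebra
  finally show ?thesis .
qed

text \<open>The derivative is replaced by a difference quotient at \<open>x\<close>, which leaves a
  combination of four values. Expanding the right side binomially shows its meaning: the terms of
  order 0 and 1 of the kernel \<open>(1 + v \<bullet> w) ^ d\<close> cancel, and only those of order
  at least 2 remain.\<close>

lemma taylor_bound:
  fixes p :: "'m::finite rpoly"
  assumes p: "homogeneous_of_degree d p" and x: "norm x = 1" and v: "x \<bullet> v = 0" "x \<bullet> w = 0"
    and D: "(eval_poly p has_derivative D) (at x)"
  shows "(eval_poly p (x + v) - eval_poly p (x + w) - D (v - w))\<^sup>2
    \<le> (poly_norm d p)\<^sup>2 * ((1 + v \<bullet> v) ^ d + (1 + w \<bullet> w) ^ d - 2 * (1 + v \<bullet> w) ^ d
        - d * ((v - w) \<bullet> (v - w)))"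
proof (rule tendsto_le[OF trivial_limit_at])
  let ?g = "eval_poly p" and ?u = "v - w"
  let ?l = "\<lambda>h. (?g (x + v) - ?g (x + w) - (?g (x + h *\<^sub>R ?u) - ?g x) / h)\<^sup>2"
  let ?r = "\<lambda>h. (poly_norm d p)\<^sup>2 * ((1 + v \<bullet> v) ^ d + (1 + w \<bullet> w) ^ d - 2 * (1 + v \<bullet> w) ^ d
      + ((1 + h\<^sup>2 * (?u \<bullet> ?u)) ^ d - 1) / h\<^sup>2
      - 2 * (((1 + h * (v \<bullet> ?u)) ^ d - 1) / h) + 2 * (((1 + h * (w \<bullet> ?u)) ^ d - 1) / h))"
  show "(?l \<longlongrightarrow> (?g (x + v) - ?g (x + w) - D ?u)\<^sup>2) (at 0)"
    by (intro tendsto_power tendsto_diff tendsto_const has_derivative_quotient_tendsto D)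
  have "(?r \<longlongrightarrow> (poly_norm d p)\<^sup>2 * ((1 + v \<bullet> v) ^ d + (1 + w \<bullet> w) ^ d - 2 * (1 + v \<bullet> w) ^ d
      + d * (?u \<bullet> ?u) - 2 * (d * (v \<bullet> ?u)) + 2 * (d * (w \<bullet> ?u)))) (at 0)"
    by (intro tendsto_mult tendsto_add tendsto_diff tendsto_const power_diff_quotient_tendsto_sq
        power_diff_quotient_tendsto)
  then show "(?r \<longlongrightarrow> (poly_norm d p)\<^sup>2 * ((1 + v \<bullet> v) ^ d + (1 + w \<bullet> w) ^ d
      - 2 * (1 + v \<bullet> w) ^ d - d * (?u \<bullet> ?u))) (at 0)"
    by (simp add: inner_diff_left inner_diff_right inner_commute algebra_simps)
  have [simp]: "x \<bullet> x = 1" "v \<bullet> x = 0" "x \<bullet> v = 0" "w \<bullet> x = 0" "x \<bullet> w = 0"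
    using x v by (simp_all add: dot_square_norm inner_commute)
  have "?l h \<le> ?r h" if h: "h \<noteq> 0" for h
  proof -
    have i: "(x + h *\<^sub>R ?u) \<bullet> (x + h *\<^sub>R ?u) = 1 + h\<^sup>2 * (?u \<bullet> ?u)"
      "(x + v) \<bullet> (x + h *\<^sub>R ?u) = 1 + h * (v \<bullet> ?u)"
      "(x + w) \<bullet> (x + h *\<^sub>R ?u) = 1 + h * (w \<bullet> ?u)"
      "(x + h *\<^sub>R ?u) \<bullet> x = 1" "(x + v) \<bullet> x = 1" "(x + w) \<bullet> x = 1"
      "(x + v) \<bullet> (x + v) = 1 + v \<bullet> v" "(x + w) \<bullet> (x + w) = 1 + w \<bullet> w" "(x + v) \<bullet> (x + w) = 1 + v \<bullet> w"
      by (simp_all add: inner_add_left inner_add_right inner_diff_right inner_diff_left power2_eq_square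
          algebra_simps)
    show ?thesis
      using kernel_inequality_4[OF p, of 1 "x + v" "-1" "x + w" "- 1 / h" "x + h *\<^sub>R ?u" "1 / h" x] h
      unfolding i by (simp add: power_divide diff_divide_distrib power2_eq_square algebra_simps)
  qed
  then show "\<forall>\<^sub>F h in at 0. ?l h \<le> ?r h"
    by (simp add: eventually_at_filter)
qed

section \<open>Numerical estimates\<close>

lemma power_diff_le:
  fixes a b :: real
  assumes "\<bar>b\<bar> \<le> a"
  shows "a ^ j - b ^ j \<le> j * a ^ (j - 1) * (a - b)"
proof (cases j)
  case (Suc k)
  have "a ^ Suc k - b ^ Suc k = (a - b) * (\<Sum>i<Suc k. a ^ i * b ^ (k - i))"
    by (simp only: diff_power_eq_sum)
  also have "\<dots> \<le> (a - b) * (\<Sum>i<Suc k. a ^ k)"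
  proof (intro mult_left_mono sum_mono)
    fix i assume "i \<in> {..<Suc k}"
    then have "a ^ k = a ^ i * a ^ (k - i)" by (simp flip: power_add)
    moreover have "b ^ (k - i) \<le> a ^ (k - i)"
      using power_mono[OF assms, of "k - i"] abs_ge_self[of "b ^ (k - i)"] by (simp add: power_abs)
    ultimately show "a ^ i * b ^ (k - i) \<le> a ^ k"
      using assms by (simp add: mult_left_mono)
  qed (use assms in auto)
  finally show ?thesis using Suc by (simp add: mult_ac)
qed simp

lemma pred_power_le_four_power: "real j \<le> 4 ^ (j - 1)"
proof (induction j)
  case (Suc j)
  then show ?case by (cases j) auto
qed simp

text \<open>For \<open>a = norm v\<close>, \<open>b = norm w\<close>,
  \<open>c = v \<bullet> w\<close> the left side is the squared distance of the \<open>j\<close>-th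
  tensor powers of \<open>v\<close> and \<open>w\<close>, and this is their Lipschitz estimate. The
  proof splits it into a radial part \<open>(a ^ j - b ^ j)^2\<close> and an angular part
  \<open>2 * ((a * b) ^ j - c ^ j)\<close>; the latter costs a factor \<open>j\<close>, absorbed by
  \<open>j \<le> 4 ^ (j - 1)\<close> and \<open>4 * a * b \<le> (a + b)^2\<close>.\<close>

lemma gram_power_le:
  fixes a b c :: real
  assumes "a \<ge> 0" "b \<ge> 0" "\<bar>c\<bar> \<le> a * b" and j: "j \<ge> 1"
  shows "(a\<^sup>2) ^ j + (b\<^sup>2) ^ j - 2 * c ^ j \<le> (a\<^sup>2 + b\<^sup>2 - 2 * c) * ((a + b)\<^sup>2) ^ (j - 1)"
proof -
  define w where "w = ((a + b)\<^sup>2) ^ (j - 1)"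
  have "\<bar>a ^ j - b ^ j\<bar> \<le> \<bar>a - b\<bar> * (a + b) ^ (j - 1)"
  proof -
    obtain k where k: "j = Suc k" using j by (cases j) auto
    have "(\<Sum>i<Suc k. a ^ i * b ^ (k - i)) \<le> (a + b) ^ k"
      unfolding binomial_ring lessThan_Suc_atMost
    proof (rule sum_mono)
      fix i assume "i \<in> {..k}"
      then have "1 * (a ^ i * b ^ (k - i)) \<le> real (k choose i) * (a ^ i * b ^ (k - i))"
        using assms by (intro mult_right_mono) (simp_all add: Suc_leI)
      then show "a ^ i * b ^ (k - i) \<le> of_nat (k choose i) * a ^ i * b ^ (k - i)" by simp
    qed
    moreover have "a ^ j - b ^ j = (a - b) * (\<Sum>i<Suc k. a ^ i * b ^ (k - i))"
      unfolding k by (simp only: diff_power_eq_sum)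
    moreover have "(\<Sum>i<Suc k. a ^ i * b ^ (k - i)) \<ge> 0"
      using assms by (intro sum_nonneg) simp
    ultimately show ?thesis
      by (simp add: abs_mult mult_left_mono k del: sum.lessThan_Suc)
  qed
  then have "(a ^ j - b ^ j)\<^sup>2 \<le> (\<bar>a - b\<bar> * (a + b) ^ (j - 1))\<^sup>2"
    by (intro abs_le_square_iff[THEN iffD1]) (use assms in \<open>simp add: abs_mult\<close>)
  also have "\<dots> = (a - b)\<^sup>2 * w"
    by (simp add: w_def power_mult_distrib flip: power_mult) (simp add: mult.commute)
  finally have 1: "(a ^ j - b ^ j)\<^sup>2 \<le> (a - b)\<^sup>2 * w" .
  have "(a * b) ^ j - c ^ j \<le> j * (a * b) ^ (j - 1) * (a * b - c)"
    by (rule power_diff_le) fact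
  also have "\<dots> \<le> w * (a * b - c)"
  proof (rule mult_right_mono)
    have "j * (a * b) ^ (j - 1) \<le> 4 ^ (j - 1) * (a * b) ^ (j - 1)"
      using assms by (intro mult_right_mono pred_power_le_four_power) simp
    also have "\<dots> = (4 * (a * b)) ^ (j - 1)" by (simp add: power_mult_distrib)
    also have "\<dots> \<le> w" unfolding w_def
      using assms zero_le_power2[of "a - b"] by (intro power_mono) (auto simp: power2_eq_square algebra_simps)
    finally show "j * (a * b) ^ (j - 1) \<le> w" .
  qed (use assms in auto)
  finally have 2: "(a * b) ^ j - c ^ j \<le> w * (a * b - c)" .
  have "(a\<^sup>2) ^ j + (b\<^sup>2) ^ j - 2 * c ^ j = (a ^ j - b ^ j)\<^sup>2 + 2 * ((a * b) ^ j - c ^ j)"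
    by (simp add: power2_diff power_mult_distrib flip: power_mult) (simp add: mult.commute)
  also have "\<dots> \<le> (a - b)\<^sup>2 * w + 2 * (w * (a * b - c))"
    using add_mono[OF 1 mult_left_mono[OF 2, of 2]] by simp
  also have "\<dots> = (a\<^sup>2 + b\<^sup>2 - 2 * c) * w"
    by (simp add: power2_eq_square algebra_simps)
  finally show ?thesis by (simp add: w_def)
qed

text \<open>The sum is \<open>((1 + w) ^ d - 1 - d * w) / w\<close>, written without the division.\<close>

lemma gram_kernel_remainder_le:
  fixes a b c :: real
  assumes "a \<ge> 0" "b \<ge> 0" "\<bar>c\<bar> \<le> a * b"
  shows "(1 + a\<^sup>2) ^ d + (1 + b\<^sup>2) ^ d - 2 * (1 + c) ^ d - d * (a\<^sup>2 + b\<^sup>2 - 2 * c)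
    \<le> (a\<^sup>2 + b\<^sup>2 - 2 * c) * (\<Sum>j=2..d. (d choose j) * ((a + b)\<^sup>2) ^ (j - 1))"
proof -
  let ?D = "\<lambda>j. (a\<^sup>2) ^ j + (b\<^sup>2) ^ j - 2 * c ^ j"
  have b: "(1 + x) ^ d = (\<Sum>j\<le>d. (d choose j) * x ^ j)" for x :: real
    using binomial_ring[of x 1 d] by (simp add: add.commute)
  have "(1 + a\<^sup>2) ^ d + (1 + b\<^sup>2) ^ d - 2 * (1 + c) ^ d = (\<Sum>j\<le>d. (d choose j) * ?D j)"
    unfolding b by (simp add: sum.distrib sum_subtractf sum_distrib_left algebra_simps)
  also have "\<dots> = (\<Sum>j\<in>{0,1}\<inter>{..d}. (d choose j) * ?D j) + (\<Sum>j=2..d. (d choose j) * ?D j)"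
  proof -
    have "{..d} = ({0,1} \<inter> {..d}) \<union> {2..d}"
      by (auto simp: numeral_2_eq_2 not_le)
    then show ?thesis
      by (subst (1) \<open>{..d} = _\<close>) (rule sum.union_disjoint, auto)
  qed
  also have "(\<Sum>j\<in>{0,1}\<inter>{..d}. (d choose j) * ?D j) = d * (a\<^sup>2 + b\<^sup>2 - 2 * c)"
    by (cases d) (auto simp: Int_insert_left)
  also have "(\<Sum>j=2..d. (d choose j) * ?D j)
      \<le> (\<Sum>j=2..d. (d choose j) * ((a\<^sup>2 + b\<^sup>2 - 2 * c) * ((a + b)\<^sup>2) ^ (j - 1)))"
    using assms by (intro sum_mono mult_left_mono gram_power_le) auto
  also have "\<dots> = (a\<^sup>2 + b\<^sup>2 - 2 * c) * (\<Sum>j=2..d. (d choose j) * ((a + b)\<^sup>2) ^ (j - 1))"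
    by (simp add: sum_distrib_left mult_ac)
  finally show ?thesis by simp
qed

text \<open>From \<open>(i + 2) * (i + 1) * (d choose (i + 2)) = d * (d - 1) * (d - 2 choose
  i)\<close> and \<open>(i + 2) * (i + 1) \<ge> 2\<close> the tail is dominated by the binomial
  expansion of \<open>(1 + w) ^ (d - 2)\<close>.\<close>

lemma binomial_tail_le:
  fixes w :: real
  assumes "w \<ge> 0"
  shows "(\<Sum>j=2..d. (d choose j) * w ^ (j - 1)) \<le> d * (d - 1) / 2 * w * (1 + w) ^ (d - 2)"
proof (cases "d \<ge> 2")
  case True
  then obtain e where d: "d = e + 2" using le_Suc_ex[OF True] by auto
  have "(\<Sum>j=2..d. (d choose j) * w ^ (j - 1)) = (\<Sum>i\<le>e. (d choose (i + 2)) * w ^ (i + 1))"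
    unfolding d by (rule sum.reindex_bij_witness[of _ "\<lambda>i. i + 2" "\<lambda>j. j - 2"]) (auto simp: Suc_diff_Suc numeral_2_eq_2)
  also have "\<dots> \<le> (\<Sum>i\<le>e. (d * (d - 1) / 2 * w) * ((e choose i) * w ^ i))"
  proof (rule sum_mono)
    fix i
    have "Suc (Suc i) * (Suc (Suc e) choose Suc (Suc i)) = Suc (Suc e) * (Suc e choose Suc i)"
      and "Suc i * (Suc e choose Suc i) = Suc e * (e choose i)"
      using Suc_times_binomial_eq[of "Suc e" "Suc i"] Suc_times_binomial_eq[of e i]
      by (simp_all only: mult.commute)
    then have "Suc (Suc i) * Suc i * (Suc (Suc e) choose Suc (Suc i)) = Suc (Suc e) * Suc e * (e choose i)"
      by (metis mult.assoc mult.left_commute)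
    then have "(i + 2) * (i + 1) * (d choose (i + 2)) = d * (d - 1) * (e choose i)"
      by (simp only: d add_2_eq_Suc' Suc_eq_plus1[symmetric] diff_Suc_1)
    then have "real ((i + 2) * (i + 1)) * (d choose (i + 2)) = d * (d - 1) * (e choose i)"
      by (metis of_nat_mult)
    moreover have "real 2 * (d choose (i + 2)) \<le> real ((i + 2) * (i + 1)) * (d choose (i + 2))"
      by (intro mult_right_mono) (auto simp: algebra_simps)
    ultimately have "(d choose (i + 2)) \<le> d * (d - 1) / 2 * real (e choose i)" by simp
    then have "(d choose (i + 2)) * (w * w ^ i) \<le> d * (d - 1) / 2 * (e choose i) * (w * w ^ i)"
      using assms by (intro mult_right_mono) auto
    then show "(d choose (i + 2)) * w ^ (i + 1) \<le> (d * (d - 1) / 2 * w) * ((e choose i) * w ^ i)"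
      by (simp add: mult_ac)
  qed
  also have "\<dots> = d * (d - 1) / 2 * w * (\<Sum>i\<le>e. (e choose i) * w ^ i)"
    by (simp only: sum_distrib_left)
  also have "(\<Sum>i\<le>e. (e choose i) * w ^ i) = (1 + w) ^ (d - 2)"
    using binomial_ring[of w 1 e] by (simp add: d add.commute)
  finally show ?thesis
    using True by (simp add: of_nat_diff)
next
  case False
  then have "d = 0 \<or> d = 1" by auto
  with assms show ?thesis by auto
qed

text \<open>This is where the exponent 3/2 of the degree in \<open>A_set\<close> pays off: the
  second-order factor of the Taylor remainder is bounded by \<open>D ^ 3\<close>. Equality holds for
  \<open>D = 2\<close>.\<close>

lemma degree_growth_bound:
  fixes D :: nat and w :: real
  assumes "D \<ge> 1" "0 \<le> w" "w \<le> 4 / D ^ 3"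
  shows "(real D - 1) * (1 + w) ^ (D - 2) \<le> D ^ 3 / 8"
proof -
  consider "D = 1" | "D = 2" | "D \<ge> 3" using assms(1) by linarith
  then show ?thesis
  proof cases
    case 3
    then have D: "real D \<ge> 3" by simp
    \<comment> \<open>The product is \<open>D^3 - 27 * D + 54\<close>, with a double root at 3; it
      keeps \<open>w * (D - 2)\<close> below 4/27.\<close>
    have "0 \<le> (real D - 3)\<^sup>2 * (real D + 6)" using D by simp
    then have cube: "27 * (real D - 2) \<le> real D ^ 3"
      by (simp add: power2_eq_square power3_eq_cube algebra_simps)
    have "(1 + w) ^ (D - 2) \<le> exp w ^ (D - 2)"
      using assms by (intro power_mono) auto
    also have "\<dots> = exp (w * (real D - 2))"
      using 3 by (simp add: exp_of_nat_mult[symmetric] of_nat_diff mult.commute)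
    also have "\<dots> \<le> exp (4 / 27)"
    proof -
      have "w * (real D - 2) \<le> 4 / D ^ 3 * (real D - 2)"
        using assms D by (intro mult_right_mono) auto
      also have "\<dots> \<le> 4 / 27" using cube D by (simp add: field_simps)
      finally show ?thesis by simp
    qed
    also have "exp (4 / 27) \<le> (27 / 23 :: real)"
      using exp_ge_add_one_self[of "- (4 / 27)"] by (simp add: exp_minus field_simps)
    finally have "(real D - 1) * (1 + w) ^ (D - 2) \<le> (real D - 1) * (27 / 23)"
      using D by (intro mult_left_mono) auto
    also have "\<dots> \<le> D ^ 3 / 8" using cube D by (simp add: field_simps)
    finally show ?thesis .
  qed auto
qed

section \<open>The constants \<open>r_0\<close> and \<open>alpha_star\<close>\<close>

lemma discriminant_nonneg:
  fixes a :: real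
  assumes "a \<le> 17 / 100"
  shows "0 \<le> 1 - 6 * a + a\<^sup>2"
proof -
  have "0 \<le> (17 / 100 - a) * (583 / 100 - a)" using assms by simp
  also have "\<dots> = 9911 / 10000 - 6 * a + a\<^sup>2" by (simp add: power2_eq_square field_simps)
  finally show ?thesis by simp
qed

text \<open>The first bound makes the radius exceed the Newton step by at least ten percent, the
  room needed for the quadratic terms; the second bounds the radius in units of
  \<open>1 / G x\<close>. For the first, the square of \<open>1 - 3 * a - 4 * a^2\<close> exceeds
  the discriminant by \<open>24 * a^3 + 16 * a^4\<close>.\<close>

lemma r_0_root_bounds:
  fixes a :: real
  assumes a: "1 / 10 \<le> a" "a \<le> 12 / 100"
  shows "1 + a \<le> r_0 a" "a * r_0 a \<le> 145 / 1000"
proof -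
  let ?s = "sqrt (1 - 6 * a + a\<^sup>2)"
  have "1 - 6 * a + a\<^sup>2 \<le> (1 - 3 * a - 4 * a\<^sup>2)\<^sup>2"
    using a by (simp add: power2_eq_square algebra_simps)
  moreover have "1 - 3 * a - 4 * a\<^sup>2 \<ge> 0"
    using a power_mono[of a "12 / 100" 2] by (simp add: power2_eq_square)
  ultimately have "?s \<le> 1 - 3 * a - 4 * a\<^sup>2"
    by (intro real_le_lsqrt) auto
  then show "1 + a \<le> r_0 a"
    using a by (simp add: r_0_def field_simps power2_eq_square)
  have "54 / 100 \<le> ?s"
  proof (rule real_le_rsqrt)
    have "0 \<le> (12 / 100 - a) * (588 / 100 - a)" using a by simp
    also have "\<dots> = 7056 / 10000 - 6 * a + a\<^sup>2" by (simp add: power2_eq_square field_simps)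
    finally show "(54 / 100)\<^sup>2 \<le> 1 - 6 * a + a\<^sup>2" by (simp add: power2_eq_square)
  qed
  moreover have "a * r_0 a = (1 + a - ?s) / 4"
    using a by (simp add: r_0_def)
  moreover have "(1 + a - s) / 4 \<le> 145 / 1000" if "54 / 100 \<le> s" for s
    using that a by (simp add: field_simps)
  ultimately show "a * r_0 a \<le> 145 / 1000" by metis
qed

text \<open>On the interval from 0 to 17/100 the function \<open>h\<close> is strictly increasing,
  because the square root decreases. A sign change between 1/10 and 12/100 therefore locates the
  least root; any root beyond that interval, also past the second zero of the discriminant, is
  larger.\<close>

lemma alpha_star_bounds: "1 / 10 \<le> alpha_star" "alpha_star \<le> 12 / 100"
proof -
  define s where "s = (\<lambda>a::real. sqrt (1 - 6 * a + a\<^sup>2))"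
  define h where "h = (\<lambda>a. a - alpha_0 * ((3 - a + s a) / 4)\<^sup>2)"
  define P where "P = (\<lambda>a. 0 < a \<and> 0 \<le> 1 - 6 * a + a\<^sup>2 \<and> a = alpha_0 * (1 - a * r_0 a)\<^sup>2)"
  have s17: "4123 / 1000 \<le> sqrt 17" "sqrt 17 \<le> 41232 / 10000"
    by (rule real_le_rsqrt real_le_lsqrt; simp add: power2_eq_square)+
  then have alpha_0: "1576 / 10000 \<le> alpha_0" "alpha_0 \<le> 1578 / 10000"
    by (auto simp: alpha_0_def)
  have h: "P a \<longleftrightarrow> 0 < a \<and> 0 \<le> 1 - 6 * a + a\<^sup>2 \<and> h a = 0" for a
  proof -
    have "a * r_0 a = (1 + a - s a) / 4" if "a > 0"
      using that by (simp add: r_0_def s_def)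
    then have "1 - a * r_0 a = (3 - a + s a) / 4" if "a > 0"
      using that by (simp add: field_simps)
    then show ?thesis unfolding P_def h_def by (metis eq_iff_diff_eq_0)
  qed
  have mono: "h a < h b" if "a < b" "b \<le> 17 / 100" "a > 0" for a b
  proof -
    have "0 \<le> (b - a) * (6 - a - b)" using that by simp
    then have "1 - 6 * b + b\<^sup>2 \<le> 1 - 6 * a + a\<^sup>2" by (simp add: power2_eq_square algebra_simps)
    then have "s b \<le> s a" by (simp add: s_def)
    moreover have "0 \<le> s b" using that by (simp add: s_def discriminant_nonneg)
    ultimately have "((3 - b + s b) / 4)\<^sup>2 \<le> ((3 - a + s a) / 4)\<^sup>2"
      using that by (intro power_mono) auto
    then have "alpha_0 * ((3 - b + s b) / 4)\<^sup>2 \<le> alpha_0 * ((3 - a + s a) / 4)\<^sup>2"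
      using alpha_0 by (intro mult_left_mono) auto
    with \<open>a < b\<close> show ?thesis unfolding h_def by simp
  qed
  have "s (1 / 10) \<ge> 64 / 100" unfolding s_def by (rule real_le_rsqrt) (simp add: power2_eq_square)
  then have "((3 - 1 / 10 + s (1 / 10)) / 4)\<^sup>2 \<ge> (88 / 100)\<^sup>2" by (intro power_mono) auto
  then have "alpha_0 * ((3 - 1 / 10 + s (1 / 10)) / 4)\<^sup>2 \<ge> 1576 / 10000 * (88 / 100)\<^sup>2"
    using alpha_0 by (intro mult_mono) auto
  then have h0: "h (1 / 10) < 0" by (simp add: h_def power2_eq_square)
  have "s (12 / 100) \<le> 543 / 1000" unfolding s_def by (rule real_le_lsqrt) (simp_all add: power2_eq_square)
  moreover have "s (12 / 100) \<ge> 0" by (simp add: s_def power2_eq_square)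
  ultimately have "((3 - 12 / 100 + s (12 / 100)) / 4)\<^sup>2 \<le> (856 / 1000)\<^sup>2" by (intro power_mono) auto
  then have "alpha_0 * ((3 - 12 / 100 + s (12 / 100)) / 4)\<^sup>2 \<le> 1578 / 10000 * (856 / 1000)\<^sup>2"
    using alpha_0 by (intro mult_mono) auto
  then have h1: "h (12 / 100) > 0" by (simp add: h_def power2_eq_square)
  have "continuous_on {1 / 10..12 / 100} h"
    unfolding h_def s_def by (intro continuous_intros) auto
  with h0 h1 obtain a where a: "1 / 10 \<le> a" "a \<le> 12 / 100" "h a = 0"
    using IVT'[of h "1 / 10" 0 "12 / 100"] by force
  have "P a" using a by (simp add: h discriminant_nonneg)
  moreover have "a \<le> b" if "P b" for b
    using mono[of b a] that a unfolding h by force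
  ultimately have "alpha_star = a"
    unfolding alpha_star_def P_def[symmetric] by (rule Least_equality)
  with a show "1 / 10 \<le> alpha_star" "alpha_star \<le> 12 / 100" by auto
qed

section \<open>Point estimates\<close>

lemma norm_vec_sq: "(norm (x :: real^'n))\<^sup>2 = (\<Sum>i\<in>UNIV. (x $ i)\<^sup>2)"
  by (simp add: norm_vec_def L2_set_def sum_nonneg)

locale normalized_system =
  fixes d :: "'n::finite \<Rightarrow> nat" and f :: "'n \<Rightarrow> 'm::finite rpoly"
  assumes degree_pos: "d i \<ge> 1" and in_sphere: "f \<in> sphere_Hd d"
begin

definition D :: nat where "D = Max (range d)"

text \<open>The unit in which radii are measured: membership in \<open>A_set\<close> reads
  \<open>G x * m x * norm (eval_sys f x) < alpha_star\<close>, and the Newton map at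
  \<open>x\<close> has Lipschitz factor \<open>G x * (norm v + norm w) / 4\<close>.\<close>

definition G :: "real^'m \<Rightarrow> real" where
  "G x = real D * sqrt D * onorm (inv_into (orth_compl x) (scaled_deriv d f x))"

abbreviation m :: "real^'m \<Rightarrow> real" where
  "m x \<equiv> onorm (inv_into (orth_compl x) (scaled_deriv d f x))"

abbreviation regular :: "real^'m \<Rightarrow> bool" where
  "regular x \<equiv> bij_betw (scaled_deriv d f x) (orth_compl x) UNIV"

text \<open>The system in the affine chart \<open>x + v\<close> of the tangent space. The division
  by \<open>sqrt (d i)\<close> makes \<open>scaled_deriv d f x\<close> its derivative at
  \<open>v = 0\<close>.\<close>

definition F :: "real^'m \<Rightarrow> real^'m \<Rightarrow> real^'n" where
  "F x v = (\<chi> i. eval_poly (f i) (x + v) / sqrt (d i))"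

abbreviation N :: "'n \<Rightarrow> real" where "N i \<equiv> poly_norm (d i) (f i)"

lemma max_deg_eq: "max_deg d = D"
  by (simp add: max_deg_def D_def)

lemma degree_le: "d i \<le> D"
  by (simp add: D_def)

lemma D_pos: "D \<ge> 1"
  using degree_pos degree_le order_trans by blast

lemma homogeneous: "homogeneous_of_degree (d i) (f i)"
  using in_sphere by (simp add: sphere_Hd_def Hd_def)

lemma sum_N: "(\<Sum>i\<in>UNIV. (N i)\<^sup>2) = 1"
  using in_sphere by (simp add: sphere_Hd_def sys_norm_def)

lemma eval_sys_scaleR_eq_0: "eval_sys f (c *\<^sub>R x) = 0" if "eval_sys f x = 0"
  using that by (simp add: eval_sys_def vec_eq_iff eval_poly_scaleR[OF homogeneous])

lemma sum_N_bound:
  assumes "\<And>i. a i \<le> (N i)\<^sup>2 * C"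
  shows "(\<Sum>i\<in>UNIV. a i) \<le> C"
proof -
  have "(\<Sum>i\<in>UNIV. a i) \<le> (\<Sum>i\<in>UNIV. (N i)\<^sup>2 * C)" by (intro sum_mono assms)
  also have "\<dots> = C" by (simp add: sum_N flip: sum_distrib_right)
  finally show ?thesis .
qed

text \<open>The factor \<open>1 - (y \<bullet> z)^2\<close> is the squared sine of the angle, so
  near a zero the system grows at rate at most \<open>sqrt D\<close>; the threshold of the second
  stopping condition is calibrated to this rate.\<close>

lemma norm_eval_sys_near_zero:
  assumes y: "norm y = 1" and z: "norm z = 1" and 0: "eval_sys f z = 0"
  shows "(norm (eval_sys f y))\<^sup>2 \<le> D * (1 - (y \<bullet> z)\<^sup>2)"
  unfolding norm_vec_sq
proof (rule sum_N_bound)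
  fix i
  have s: "(y \<bullet> z)\<^sup>2 \<le> 1"
    using Cauchy_Schwarz_ineq[of y z] y z by (simp add: dot_square_norm)
  have "(eval_sys f y $ i)\<^sup>2 \<le> (N i)\<^sup>2 * (1 - (y \<bullet> z) ^ (2 * d i))"
    using two_point_bound[OF homogeneous y z, of i] 0 by (simp add: eval_sys_def vec_eq_iff)
  also have "1 - (y \<bullet> z) ^ (2 * d i) \<le> d i * (1 - (y \<bullet> z)\<^sup>2)"
    using Bernoulli_complement[of "(y \<bullet> z)\<^sup>2" "d i"] s by (simp add: power_mult)
  also have "d i * (1 - (y \<bullet> z)\<^sup>2) \<le> D * (1 - (y \<bullet> z)\<^sup>2)"
    using s degree_le by (intro mult_right_mono) auto
  finally show "(eval_sys f y $ i)\<^sup>2 \<le> (N i)\<^sup>2 * (D * (1 - (y \<bullet> z)\<^sup>2))"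
    by (simp add: mult_left_mono)
qed

text \<open>The row factor \<open>1 / sqrt (d i)\<close> cancels the degree in
  \<open>derivative_bound\<close>. Consequently the inverse has norm at least 1, which is
  \<open>m_ge_1\<close>.\<close>

lemma norm_scaled_deriv_le:
  assumes x: "norm x = 1" and v: "v \<in> orth_compl x"
  shows "norm (scaled_deriv d f x v) \<le> norm v"
proof -
  have "(norm (scaled_deriv d f x v))\<^sup>2 \<le> (norm v)\<^sup>2"
    unfolding norm_vec_sq[of "scaled_deriv d f x v"]
  proof (rule sum_N_bound)
    fix i
    have "(frechet_derivative (eval_sys f) (at x) v $ i)\<^sup>2 \<le> (N i)\<^sup>2 * (d i * (norm v)\<^sup>2)"
      using v by (intro derivative_bound[OF homogeneous x _ has_derivative_eval_poly_component])
        (simp add: orth_compl_def)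
    then show "(scaled_deriv d f x v $ i)\<^sup>2 \<le> (N i)\<^sup>2 * (norm v)\<^sup>2"
      using degree_pos[of i] by (simp add: scaled_deriv_def power_divide field_simps)
  qed
  then show ?thesis by (simp add: power2_le_iff_abs_le)
qed

lemma norm_taylor_remainder_le:
  assumes x: "norm x = 1" and v: "v \<in> orth_compl x" and w: "w \<in> orth_compl x"
  shows "(norm (F x v - F x w - scaled_deriv d f x (v - w)))\<^sup>2
    \<le> (norm (v - w))\<^sup>2 * ((real D - 1) / 2 * (norm v + norm w)\<^sup>2 * (1 + (norm v + norm w)\<^sup>2) ^ (D - 2))"
  unfolding norm_vec_sq[of "F x v - _ - _"]
proof (rule sum_N_bound)
  fix i
  let ?W = "(norm v + norm w)\<^sup>2"
  let ?D = "\<lambda>u. frechet_derivative (eval_sys f) (at x) u $ i"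
  have d: "d i \<ge> 1" using degree_pos .
  have vw: "norm (v - w) ^ 2 = (norm v)\<^sup>2 + (norm w)\<^sup>2 - 2 * (v \<bullet> w)"
    by (simp add: power2_norm_eq_inner inner_diff_left inner_diff_right inner_commute)
  have "(eval_poly (f i) (x + v) - eval_poly (f i) (x + w) - ?D (v - w))\<^sup>2
      \<le> (N i)\<^sup>2 * ((1 + v \<bullet> v) ^ d i + (1 + w \<bullet> w) ^ d i - 2 * (1 + v \<bullet> w) ^ d i
        - d i * ((v - w) \<bullet> (v - w)))"
    using v w by (intro taylor_bound[OF homogeneous x _ _ has_derivative_eval_poly_component])
      (simp_all add: orth_compl_def)
  also have "(1 + v \<bullet> v) ^ d i + (1 + w \<bullet> w) ^ d i - 2 * (1 + v \<bullet> w) ^ d i - d i * ((v - w) \<bullet> (v - w))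
      \<le> (norm (v - w))\<^sup>2 * (\<Sum>j=2..d i. (d i choose j) * ?W ^ (j - 1))"
    using gram_kernel_remainder_le[of "norm v" "norm w" "v \<bullet> w" "d i"] Cauchy_Schwarz_ineq2[of v w]
    unfolding vw[symmetric] by (simp add: power2_norm_eq_inner)
  also have "(\<Sum>j=2..d i. (d i choose j) * ?W ^ (j - 1)) \<le> d i * (real (d i) - 1) / 2 * ?W * (1 + ?W) ^ (d i - 2)"
    using binomial_tail_le[of ?W "d i"] by simp
  also have "\<dots> \<le> d i * ((real D - 1) / 2 * ?W * (1 + ?W) ^ (D - 2))"
  proof -
    have "(real (d i) - 1) / 2 * ?W * (1 + ?W) ^ (d i - 2) \<le> (real D - 1) / 2 * ?W * (1 + ?W) ^ (D - 2)"
      using degree_le[of i] d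
      by (intro mult_mono[OF mult_right_mono power_increasing]) auto
    then show ?thesis using d by (simp add: mult.assoc)
  qed
  finally have *: "(eval_poly (f i) (x + v) - eval_poly (f i) (x + w) - ?D (v - w))\<^sup>2
      \<le> (N i)\<^sup>2 * ((norm (v - w))\<^sup>2 * (d i * ((real D - 1) / 2 * ?W * (1 + ?W) ^ (D - 2))))"
    by (simp add: mult_left_mono)
  have "((F x v - F x w - scaled_deriv d f x (v - w)) $ i)\<^sup>2
      = (eval_poly (f i) (x + v) - eval_poly (f i) (x + w) - ?D (v - w))\<^sup>2 / d i"
    by (simp add: F_def scaled_deriv_def power_divide flip: diff_divide_distrib)
  also have "\<dots> \<le> (N i)\<^sup>2 * ((norm (v - w))\<^sup>2 * (d i * ((real D - 1) / 2 * ?W * (1 + ?W) ^ (D - 2)))) / d i"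
    by (intro divide_right_mono *) simp
  also have "\<dots> = (N i)\<^sup>2 * ((norm (v - w))\<^sup>2 * ((real D - 1) / 2 * ?W * (1 + ?W) ^ (D - 2)))"
    using d by simp
  finally show "((F x v - F x w - scaled_deriv d f x (v - w)) $ i)\<^sup>2
      \<le> (N i)\<^sup>2 * ((norm (v - w))\<^sup>2 * ((real D - 1) / 2 * ?W * (1 + ?W) ^ (D - 2)))" .
qed

section \<open>Invertible derivatives and the Newton map\<close>

lemma linear_scaled_deriv: "linear (scaled_deriv d f x)"
proof -
  have "linear (frechet_derivative (eval_sys f) (at x))"
    by (rule linear_frechet_derivative) (rule differentiable_eval_sys)
  then show ?thesis
    by (intro linearI) (simp_all add: scaled_deriv_def vec_eq_iff linear_add linear_scale add_divide_distrib)
qed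

lemma subspace_orth_compl: "subspace (orth_compl x)"
  by (simp add: orth_compl_def subspace_hyperplane)

lemma regular_inverse:
  assumes "regular x"
  shows "inv_into (orth_compl x) (scaled_deriv d f x) y \<in> orth_compl x"
    and "scaled_deriv d f x (inv_into (orth_compl x) (scaled_deriv d f x) y) = y"
    and "bounded_linear (inv_into (orth_compl x) (scaled_deriv d f x))"
proof -
  let ?L = "scaled_deriv d f x" let ?I = "inv_into (orth_compl x) ?L"
  show I: "?I y \<in> orth_compl x" "?L (?I y) = y" for y
    using assms by (auto simp: bij_betw_def inv_into_into f_inv_into_f)
  have inj: "u = v" if "u \<in> orth_compl x" "v \<in> orth_compl x" "?L u = ?L v" for u v
    using assms that by (auto simp: bij_betw_def inj_on_def)
  have "linear ?I"
  proof (rule linearI)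
    fix a b c
    show "?I (a + b) = ?I a + ?I b"
      by (intro inj I subspace_add subspace_orth_compl) (simp add: linear_add[OF linear_scaled_deriv] I)
    show "?I (c *\<^sub>R a) = c *\<^sub>R ?I a"
      by (intro inj I subspace_scale subspace_orth_compl) (simp add: linear_scale[OF linear_scaled_deriv] I)
  qed
  then show "bounded_linear ?I" by (simp add: linear_conv_bounded_linear)
qed

lemma norm_inverse_le:
  assumes "regular x"
  shows "norm (inv_into (orth_compl x) (scaled_deriv d f x) y) \<le> m x * norm y"
  using onorm[OF regular_inverse(3)[OF assms]] .

lemma norm_le_m_times:
  assumes "regular x" "v \<in> orth_compl x"
  shows "norm v \<le> m x * norm (scaled_deriv d f x v)"
  using norm_inverse_le[OF assms(1), of "scaled_deriv d f x v"] assms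
  by (simp add: bij_betw_def inv_into_f_f)

lemma m_ge_1:
  assumes x: "norm x = 1" and r: "regular x"
  shows "m x \<ge> 1"
proof -
  obtain y :: "real^'n" where y: "norm y = 1" using vector_choose_size[of 1] by auto
  let ?v = "inv_into (orth_compl x) (scaled_deriv d f x) y"
  have "1 \<le> norm ?v"
    using norm_scaled_deriv_le[OF x, of ?v] regular_inverse[OF r] y by simp
  also have "\<dots> \<le> m x" using norm_inverse_le[OF r, of y] y by simp
  finally show ?thesis .
qed

lemma G_ge_1:
  assumes "norm x = 1" "regular x"
  shows "G x \<ge> 1"
proof -
  have "1 * 1 * 1 \<le> real D * sqrt D * m x"
    using m_ge_1[OF assms] D_pos by (intro mult_mono) auto
  then show ?thesis by (simp add: G_def)
qed

text \<open>Because \<open>m x \<ge> 1\<close>, the hypothesis \<open>S\<close> gives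
  \<open>W \<le> 4 / D ^ 3\<close>, the range of \<open>degree_growth_bound\<close>, and the
  resulting \<open>D ^ 3 / 8\<close> is absorbed by
  \<open>(G x)^2 = D ^ 3 * (m x)^2\<close>.\<close>

lemma contraction:
  assumes x: "norm x = 1" and r: "regular x"
    and v: "v \<in> orth_compl x" and w: "w \<in> orth_compl x" and S: "G x * (norm v + norm w) \<le> 2"
  shows "m x * norm (F x v - F x w - scaled_deriv d f x (v - w))
    \<le> G x * (norm v + norm w) / 4 * norm (v - w)"
proof -
  define W where "W = (norm v + norm w)\<^sup>2"
  have m1: "m x \<ge> 1" by (rule m_ge_1) fact+
  have D1: "real D \<ge> 1" using D_pos by simp
  have Gsq: "(G x)\<^sup>2 = D ^ 3 * (m x)\<^sup>2"
    by (simp add: G_def power_mult_distrib power3_eq_cube power2_eq_square)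
  have G1: "G x \<ge> 1" by (rule G_ge_1) fact+
  have S2: "(G x)\<^sup>2 * W \<le> 4"
    using power_mono[OF S, of 2] G1 by (simp add: W_def power_mult_distrib)
  have "D ^ 3 * W \<le> (G x)\<^sup>2 * W"
  proof -
    have "1 \<le> (m x)\<^sup>2" using m1 by simp
    then have "real D ^ 3 * 1 \<le> real D ^ 3 * (m x)\<^sup>2"
      by (rule mult_left_mono) simp
    then have "real D ^ 3 * 1 * W \<le> real D ^ 3 * (m x)\<^sup>2 * W"
      by (rule mult_right_mono) (simp add: W_def)
    then show ?thesis by (simp add: Gsq)
  qed
  then have "W \<le> 4 / D ^ 3" using S2 D1 by (simp add: field_simps)
  then have deg: "(real D - 1) * (1 + W) ^ (D - 2) \<le> D ^ 3 / 8"
    using D_pos by (intro degree_growth_bound) (auto simp: W_def)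
  have "(m x * norm (F x v - F x w - scaled_deriv d f x (v - w)))\<^sup>2
      \<le> (m x)\<^sup>2 * ((norm (v - w))\<^sup>2 * ((real D - 1) / 2 * W * (1 + W) ^ (D - 2)))"
    unfolding power_mult_distrib W_def
    by (rule mult_left_mono[OF norm_taylor_remainder_le[OF x v w]]) simp
  also have "\<dots> = ((m x)\<^sup>2 * (norm (v - w))\<^sup>2 * W / 2) * ((real D - 1) * (1 + W) ^ (D - 2))"
    by simp
  also have "\<dots> \<le> ((m x)\<^sup>2 * (norm (v - w))\<^sup>2 * W / 2) * (D ^ 3 / 8)"
    by (intro mult_left_mono deg) (simp add: W_def)
  also have "\<dots> = (G x * (norm v + norm w) / 4 * norm (v - w))\<^sup>2"
    unfolding power_mult_distrib power_divide Gsq by (simp add: W_def)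
  finally show ?thesis
    by (rule power2_le_imp_le) (use G1 in simp)
qed

lemma zero_unique:
  assumes x: "norm x = 1" and r: "regular x"
    and v: "v \<in> orth_compl x" "F x v = 0" and w: "w \<in> orth_compl x" "F x w = 0"
    and S: "G x * (norm v + norm w) \<le> 2"
  shows "v = w"
proof -
  have "norm (v - w) \<le> m x * norm (scaled_deriv d f x (v - w))"
    using v w by (intro norm_le_m_times r subspace_diff subspace_orth_compl)
  also have "\<dots> \<le> G x * (norm v + norm w) / 4 * norm (v - w)"
    using contraction[OF x r v(1) w(1) S] v w by simp
  also have "\<dots> \<le> 2 / 4 * norm (v - w)"
    using S by (intro mult_right_mono) auto
  finally show ?thesis by simp
qed

text \<open>Banach's theorem for the Newton map \<open>?T\<close> with the derivative frozen at the
  centre. The ball is mapped into itself because the first step takes at most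
  \<open>95 / 100 * R\<close> and the remainder at most \<open>15 / 400 * R\<close>.\<close>

lemma zero_exists:
  assumes x: "norm x = 1" and r: "regular x"
    and b: "m x * norm (eval_sys f x) \<le> 95 / 100 * R" and R: "G x * R \<le> 15 / 100"
  obtains v where "v \<in> orth_compl x" "norm v \<le> R" "F x v = 0"
proof -
  let ?L = "scaled_deriv d f x" let ?I = "inv_into (orth_compl x) ?L"
  let ?T = "\<lambda>v. v - ?I (F x v)"
  let ?B = "orth_compl x \<inter> cball 0 R"
  have G1: "G x \<ge> 1" by (rule G_ge_1) fact+
  have R0: "R \<ge> 0"
  proof -
    have "0 \<le> m x * norm (eval_sys f x)" using m_ge_1[OF x r] by (intro mult_nonneg_nonneg) auto
    with b show ?thesis by linarith
  qed
  have I: "bounded_linear ?I" "\<And>y. ?I y \<in> orth_compl x" "\<And>y. ?L (?I y) = y"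
    using regular_inverse[OF r] by auto
  have lip: "norm (?T v - ?T w) \<le> G x * (norm v + norm w) / 4 * norm (v - w)"
    if v: "v \<in> ?B" and w: "w \<in> ?B" for v w
  proof -
    have vw: "v - w \<in> orth_compl x" using v w by (simp add: subspace_diff subspace_orth_compl)
    have "G x * (norm v + norm w) \<le> G x * (2 * R)"
      using v w G1 by (intro mult_left_mono) auto
    then have S: "G x * (norm v + norm w) \<le> 2" using R by simp
    have "?I (?L (v - w)) = v - w"
      using r vw by (simp add: bij_betw_def inv_into_f_f)
    then have "?T v - ?T w = - ?I (F x v - F x w - ?L (v - w))"
      by (simp add: linear_diff[OF bounded_linear.linear[OF I(1)]])
    then have "norm (?T v - ?T w) \<le> m x * norm (F x v - F x w - ?L (v - w))"
      using norm_inverse_le[OF r] by simp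
    also have "\<dots> \<le> G x * (norm v + norm w) / 4 * norm (v - w)"
      using v w by (intro contraction x r S) auto
    finally show ?thesis .
  qed
  have F0: "norm (F x 0) \<le> norm (eval_sys f x)"
  proof -
    have "(eval_poly (f i) x / sqrt (d i))\<^sup>2 \<le> (eval_poly (f i) x)\<^sup>2" for i
      using degree_pos[of i] by (simp add: power_divide divide_le_eq mult_ge1_I mult_le_cancel_left1)
    then have "(norm (F x 0))\<^sup>2 \<le> (norm (eval_sys f x))\<^sup>2"
      unfolding norm_vec_sq by (intro sum_mono) (simp add: F_def eval_sys_def)
    then show ?thesis by (simp add: power2_le_iff_abs_le)
  qed
  have "\<exists>!v\<in>?B. ?T v = v"
  proof (rule Banach_fix[where c = "1 / 2"])
    show "complete ?B"
      by (intro compact_imp_complete closed_Int_compact closed_subspace subspace_orth_compl) simp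
    have "0 \<in> ?B" using R0 subspace_0[OF subspace_orth_compl, of x] by simp
    then show "?B \<noteq> {}" by blast
    show "?T ` ?B \<subseteq> ?B"
    proof clarify
      fix v assume v: "v \<in> orth_compl x" "v \<in> cball 0 R"
      have "norm (?T v) \<le> norm (?T v - ?T 0) + norm (?T 0)"
        using norm_triangle_ineq[of "?T v - ?T 0" "?T 0"] by simp
      also have "norm (?T v - ?T 0) \<le> G x * norm v / 4 * norm v"
        using lip[of v 0] v R0 by (simp add: subspace_0 subspace_orth_compl)
      also have "\<dots> \<le> G x * R / 4 * R"
        using v G1 R0 by (simp add: mult_mono)
      also have "\<dots> \<le> 15 / 100 / 4 * R"
        using R0 R[THEN divide_right_mono, of 4] by (intro mult_right_mono) auto
      also have "norm (?T 0) \<le> m x * norm (eval_sys f x)"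
        using order_trans[OF norm_inverse_le[OF r] mult_left_mono[OF F0]] m_ge_1[OF x r] by simp
      finally have "norm (?T v) \<le> R" using b R0 by simp
      then show "?T v \<in> ?B"
        using v I(2) by (simp add: subspace_diff subspace_orth_compl)
    qed
    show "dist (?T v) (?T w) \<le> 1 / 2 * dist v w" if v: "v \<in> ?B" and w: "w \<in> ?B" for v w
    proof -
      have "G x * (norm v + norm w) \<le> G x * (2 * R)"
        using v w G1 by (intro mult_left_mono) auto
      then have "G x * (norm v + norm w) / 4 * norm (v - w) \<le> 1 / 2 * norm (v - w)"
        using R by (intro mult_right_mono) auto
      from order_trans[OF lip[OF v w] this] show "dist (?T v) (?T w) \<le> 1 / 2 * dist v w"
        unfolding dist_norm .
    qed
  qed auto
  then obtain v where v: "v \<in> ?B" "?I (F x v) = 0" by auto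
  have "F x v = ?L 0" using I(3)[of "F x v"] v by simp
  then have "F x v = 0" by (simp add: linear_0[OF linear_scaled_deriv])
  then show ?thesis using v that by auto
qed

end

section \<open>The zero attached to a point\<close>

lemma norm_diff_unit_sq:
  assumes "norm x = 1" "norm z = 1"
  shows "(norm (x - z))\<^sup>2 = 2 - 2 * (x \<bullet> z)"
proof -
  have "(norm (x - z))\<^sup>2 = (norm x)\<^sup>2 + (norm z)\<^sup>2 - 2 * (x \<bullet> z)"
    by (simp add: power2_norm_eq_inner inner_diff_left inner_diff_right inner_commute)
  with assms show ?thesis by simp
qed

lemma chord_le_ang_dist:
  assumes "norm x = 1" "norm z = 1"
  shows "norm (x - z) \<le> ang_dist x z"
proof -
  have "\<bar>x \<bullet> z\<bar> \<le> 1" using Cauchy_Schwarz_ineq2[of x z] assms by simp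
  then have c: "cos (ang_dist x z) = x \<bullet> z" and a: "ang_dist x z \<ge> 0"
    unfolding ang_dist_def by (auto intro: cos_arccos arccos_lbound)
  have "cos (ang_dist x z) = 1 - 2 * (sin (ang_dist x z / 2))\<^sup>2"
    using cos_double_sin[of "ang_dist x z / 2"] by simp
  moreover have "(sin (ang_dist x z / 2))\<^sup>2 \<le> (ang_dist x z / 2)\<^sup>2"
    using abs_sin_x_le_abs_x[of "ang_dist x z / 2"] by (simp only: abs_le_square_iff)
  ultimately have "(norm (x - z))\<^sup>2 \<le> (ang_dist x z)\<^sup>2"
    unfolding norm_diff_unit_sq[OF assms] c[symmetric] by (simp add: power_divide)
  then show ?thesis using a by (rule power2_le_imp_le)
qed

text \<open>Central projection to the tangent space at \<open>x\<close>: zeros of the system in the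
  open hemisphere around \<open>x\<close> become zeros of \<open>F x\<close>, and the norm is the
  tangent of the angle.\<close>

definition gnomonic :: "real^'m \<Rightarrow> real^'m \<Rightarrow> real^'m" where
  "gnomonic x z = z /\<^sub>R (x \<bullet> z) - x"

lemma gnomonic_orth:
  assumes "norm x = 1" "x \<bullet> z > 0"
  shows "gnomonic x z \<in> orth_compl x"
  using assms by (simp add: gnomonic_def orth_compl_def inner_diff_right dot_square_norm)

lemma norm_gnomonic_sq:
  assumes "norm x = 1" "norm z = 1" "x \<bullet> z > 0"
  shows "(norm (gnomonic x z))\<^sup>2 = 1 / (x \<bullet> z)\<^sup>2 - 1"
proof -
  have "(norm (gnomonic x z))\<^sup>2 = (norm z)\<^sup>2 / (x \<bullet> z)\<^sup>2 + (norm x)\<^sup>2 - 2"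
    using assms(3) unfolding power2_norm_eq_inner gnomonic_def
    by (simp add: inner_diff_left inner_diff_right inner_commute power2_eq_square field_simps)
  with assms show ?thesis by simp
qed

lemma gnomonic_inj:
  assumes "norm z = 1" "norm w = 1" "x \<bullet> z > 0" "x \<bullet> w > 0" "gnomonic x z = gnomonic x w"
  shows "z = w"
proof -
  have e: "z /\<^sub>R (x \<bullet> z) = w /\<^sub>R (x \<bullet> w)" using assms(5) by (simp add: gnomonic_def)
  then have "norm (z /\<^sub>R (x \<bullet> z)) = norm (w /\<^sub>R (x \<bullet> w))" by simp
  then have "x \<bullet> z = x \<bullet> w" using assms by simp
  with e assms show ?thesis by simp
qed

lemma norm_gnomonic_le_chord:
  assumes x: "norm x = 1" and z: "norm z = 1" and c: "norm (x - z) \<le> c" "c \<le> 1 / 2"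
  shows "x \<bullet> z > 0" "norm (gnomonic x z) \<le> c / (1 - c\<^sup>2 / 2)"
proof -
  have c0: "c \<ge> 0" using c(1) norm_ge_zero order_trans by blast
  have "c\<^sup>2 \<le> (1 / 2)\<^sup>2" using c c0 by (intro power_mono) auto
  then have k: "1 - c\<^sup>2 / 2 > 0" by (simp add: power2_eq_square)
  have "(norm (x - z))\<^sup>2 \<le> c\<^sup>2" using c by (intro power_mono) auto
  then have xz: "1 - c\<^sup>2 / 2 \<le> x \<bullet> z" using norm_diff_unit_sq[OF x z] by simp
  with k show pos: "x \<bullet> z > 0" by simp
  have "(norm (gnomonic x z))\<^sup>2 = 1 / (x \<bullet> z)\<^sup>2 - 1"
    by (rule norm_gnomonic_sq[OF x z pos])
  also have "\<dots> \<le> 1 / (1 - c\<^sup>2 / 2)\<^sup>2 - 1"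
    using xz k pos by (intro diff_right_mono divide_left_mono power_mono mult_pos_pos zero_less_power) auto
  also have "\<dots> \<le> (c / (1 - c\<^sup>2 / 2))\<^sup>2"
  proof -
    have "1 - (1 - c\<^sup>2 / 2)\<^sup>2 \<le> c\<^sup>2" by (simp add: power2_diff)
    then have "(1 - (1 - c\<^sup>2 / 2)\<^sup>2) / (1 - c\<^sup>2 / 2)\<^sup>2 \<le> c\<^sup>2 / (1 - c\<^sup>2 / 2)\<^sup>2"
      by (rule divide_right_mono) simp
    then show ?thesis using k by (simp add: diff_divide_distrib power_divide)
  qed
  finally show "norm (gnomonic x z) \<le> c / (1 - c\<^sup>2 / 2)"
    using k c0 by (intro power2_le_imp_le[of "norm _"]) auto
qed

context normalized_system
begin

lemma A_setD:
  assumes "x \<in> A_set d f"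
  shows "norm x = 1" "regular x" "G x * m x * norm (eval_sys f x) < alpha_star"
proof -
  show "norm x = 1" using assms by (simp add: A_set_def)
  show r: "regular x" using assms by (auto simp: A_set_def mu_def split: if_splits)
  have "real D powr (3 / 2) = real D powr (1 + 1 / 2)" by simp
  also have "\<dots> = real D * sqrt D"
    using D_pos by (simp only: powr_add powr_half_sqrt of_nat_0_le_iff) simp
  finally have "real D powr (3 / 2) = real D * sqrt D" .
  then show "G x * m x * norm (eval_sys f x) < alpha_star"
    using assms r by (simp add: A_set_def mu_def max_deg_eq G_def power2_eq_square mult_ac)
qed

text \<open>The last two bounds are the hypotheses of \<open>zero_exists\<close> for
  \<open>R = radius d f x\<close>; the factor 95/100 is a rounded inverse of
  \<open>r_0 alpha_star \<ge> 11 / 10\<close>.\<close>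

lemma radius_bounds:
  assumes x: "x \<in> A_set d f"
  shows "radius d f x \<ge> 0" "m x * norm (eval_sys f x) \<le> 95 / 100 * radius d f x"
    "G x * radius d f x \<le> 145 / 1000"
proof -
  note a = alpha_star_bounds r_0_root_bounds[OF alpha_star_bounds]
  have b: "m x * norm (eval_sys f x) \<ge> 0" (is "?b \<ge> 0")
    using m_ge_1[OF A_setD(1,2)[OF x]] by (intro mult_nonneg_nonneg) auto
  have r: "radius d f x = r_0 alpha_star * ?b"
    using A_setD(2)[OF x] by (simp add: radius_def mu_def)
  show "radius d f x \<ge> 0" unfolding r by (rule mult_nonneg_nonneg[OF _ b]) (use a in auto)
  have "11 / 10 * ?b \<le> r_0 alpha_star * ?b" using a b by (intro mult_right_mono) auto
  then show "?b \<le> 95 / 100 * radius d f x" using b unfolding r by linarith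
  have "G x * radius d f x = r_0 alpha_star * (G x * m x * norm (eval_sys f x))"
    by (simp add: r mult_ac)
  also have "\<dots> \<le> r_0 alpha_star * alpha_star"
    using A_setD(3)[OF x] a by (intro mult_left_mono) auto
  finally show "G x * radius d f x \<le> 145 / 1000" using a by (simp add: mult.commute)
qed

lemma radius_le:
  assumes x: "x \<in> A_set d f"
  shows "radius d f x \<le> 145 / 1000"
proof -
  have "1 * radius d f x \<le> G x * radius d f x"
    using radius_bounds(1)[OF x] G_ge_1[OF A_setD(1,2)[OF x]] by (intro mult_right_mono)
  then show ?thesis using radius_bounds(3)[OF x] by simp
qed

lemma B_setD:
  assumes "norm x = 1" "z \<in> B_set d f x"
  shows "norm z = 1" "norm (x - z) \<le> radius d f x"
  using chord_le_ang_dist[of x z] assms by (auto simp: B_set_def)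

text \<open>A tangent vector \<open>v\<close> corresponds to the angle
  \<open>arctan (norm v)\<close>, which is at most \<open>norm v\<close>; so the Euclidean ball of
  \<open>zero_exists\<close> projects into the angular ball \<open>B_set\<close>.\<close>

lemma zero_in_B_set:
  assumes x: "x \<in> A_set d f"
  shows "\<exists>z\<in>B_set d f x. eval_sys f z = 0"
proof -
  note x1 = A_setD(1)[OF x] and r = A_setD(2)[OF x]
  obtain v where v: "v \<in> orth_compl x" "norm v \<le> radius d f x" "F x v = 0"
    using zero_exists[OF x1 r radius_bounds(2)[OF x]] radius_bounds(3)[OF x] by auto
  have xv: "x \<bullet> v = 0" using v by (simp add: orth_compl_def)
  have n: "(norm (x + v))\<^sup>2 = 1 + (norm v)\<^sup>2"
    using x1 xv by (simp add: power2_norm_eq_inner inner_add_left inner_add_right inner_commute)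
      (simp add: dot_square_norm)
  then have n': "norm (x + v) = sqrt (1 + (norm v)\<^sup>2)"
    by (metis norm_ge_zero real_sqrt_unique)
  have n0: "norm (x + v) > 0"
    unfolding n' by (simp add: add_pos_nonneg)
  define z where "z = (x + v) /\<^sub>R norm (x + v)"
  have "eval_poly (f i) (x + v) = 0" for i
    using v(3) degree_pos[of i] by (auto simp: F_def vec_eq_iff)
  then have "eval_sys f (x + v) = 0" by (simp add: eval_sys_def vec_eq_iff)
  then have "eval_sys f z = 0" unfolding z_def by (rule eval_sys_scaleR_eq_0)
  moreover have "z \<in> B_set d f x"
  proof -
    have "x \<bullet> z = 1 / norm (x + v)"
      using x1 xv by (simp add: z_def inner_add_right dot_square_norm divide_inverse)
    also have "\<dots> = cos (arctan (norm v))" by (simp add: n' cos_arctan)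
    finally have "ang_dist x z = arctan (norm v)"
      unfolding ang_dist_def using arctan_ubound[of "norm v"] pi_gt_zero
      by (simp add: arccos_cos del: pi_gt_zero)
    also have "\<dots> \<le> norm v" by (rule arctan_le_self) simp
    finally show ?thesis using v n0 by (simp add: B_set_def z_def)
  qed
  ultimately show ?thesis by blast
qed

definition zeta :: "real^'m \<Rightarrow> real^'m" where
  "zeta x = (SOME z. z \<in> B_set d f x \<and> eval_sys f z = 0)"

lemma zeta:
  assumes "x \<in> A_set d f"
  shows "zeta x \<in> B_set d f x" "eval_sys f (zeta x) = 0" "norm (zeta x) = 1"
    "norm (x - zeta x) \<le> radius d f x"
proof -
  have "zeta x \<in> B_set d f x \<and> eval_sys f (zeta x) = 0"
    unfolding zeta_def by (rule someI_ex) (use zero_in_B_set[OF assms] in blast)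
  then show "zeta x \<in> B_set d f x" "eval_sys f (zeta x) = 0" by auto
  with B_setD[OF A_setD(1)[OF assms]] show "norm (zeta x) = 1" "norm (x - zeta x) \<le> radius d f x"
    by auto
qed

lemma near_zeros_eq:
  assumes x: "norm x = 1" "regular x"
    and z: "norm z = 1" "eval_sys f z = 0" "x \<bullet> z > 0"
    and w: "norm w = 1" "eval_sys f w = 0" "x \<bullet> w > 0"
    and S: "G x * (norm (gnomonic x z) + norm (gnomonic x w)) \<le> 2"
  shows "z = w"
proof -
  have F0: "F x (gnomonic x z) = 0" if "eval_sys f z = 0" for z
    using eval_sys_scaleR_eq_0[OF that, of "inverse (x \<bullet> z)"]
    by (simp add: F_def gnomonic_def eval_sys_def vec_eq_iff)
  show ?thesis
    using z w by (intro gnomonic_inj[of z w x] zero_unique[OF x _ _ _ _ S] F0 gnomonic_orth x)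
qed

text \<open>Both zeros are compared in the tangent space at \<open>y\<close>, the point with the
  smaller condition number. As \<open>G y \<le> G x\<close>, both radii are at most
  \<open>c = 145 / 1000 / G y\<close>, and the zeros are within \<open>3 * c\<close> and
  \<open>c\<close> of \<open>y\<close>. Doubling these chords bounds their tangent norms, and
  \<open>8 * c * G y = 1.16\<close> is below the limit 2 of uniqueness.\<close>

lemma zeta_eq_of_regular_le:
  assumes x: "x \<in> A_set d f" and y: "y \<in> A_set d f"
    and z: "z \<in> B_set d f x" "z \<in> B_set d f y" and m: "m y \<le> m x"
  shows "zeta x = zeta y"
proof -
  note x1 = A_setD(1,2)[OF x] and y1 = A_setD(1,2)[OF y]
  define c where "c = 145 / 1000 / G y"
  have Gy: "G y \<ge> 1" by (rule G_ge_1) fact+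
  have Gxy: "G y \<le> G x" unfolding G_def using m by (simp add: mult_left_mono)
  have c: "radius d f y \<le> c" "c \<ge> 0" "c \<le> 145 / 1000" "G y * c = 145 / 1000"
    using radius_bounds[OF y] Gy by (auto simp: c_def field_simps)
  have "G y * radius d f x \<le> G x * radius d f x"
    using Gxy radius_bounds(1)[OF x] by (rule mult_right_mono)
  then have cx: "radius d f x \<le> c"
    using radius_bounds(3)[OF x] Gy by (simp add: c_def field_simps)
  have "norm (y - zeta x) \<le> norm (y - z) + norm (x - z) + norm (x - zeta x)"
    using norm_triangle_ineq[of "y - z" "z - x"] norm_triangle_ineq[of "y - x" "x - zeta x"]
    by (simp add: norm_minus_commute)
  also have "\<dots> \<le> 3 * c"
    using B_setD(2)[OF x1(1) z(1)] B_setD(2)[OF y1(1) z(2)] zeta(4)[OF x] cx c by simp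
  finally have a: "norm (y - zeta x) \<le> 3 * c" .
  have b: "norm (y - zeta y) \<le> c" using zeta(4)[OF y] c by simp
  have q: "k / (1 - k\<^sup>2 / 2) \<le> 2 * k" if "0 \<le> k" "k \<le> 1 / 2" for k :: real
  proof -
    have "k\<^sup>2 \<le> (1 / 2)\<^sup>2" using that by (intro power_mono) auto
    then have "1 / 2 \<le> 1 - k\<^sup>2 / 2" by (simp add: power2_eq_square)
    then have "k / (1 - k\<^sup>2 / 2) \<le> k / (1 / 2)" using that by (intro divide_left_mono) auto
    then show ?thesis by simp
  qed
  note ga = norm_gnomonic_le_chord[OF y1(1) zeta(3)[OF x] a]
  note gb = norm_gnomonic_le_chord[OF y1(1) zeta(3)[OF y] b]
  have "norm (gnomonic y (zeta x)) + norm (gnomonic y (zeta y)) \<le> 2 * (3 * c) + 2 * c"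
    using ga(2) gb(2) q[of "3 * c"] q[of c] c by simp
  then have "G y * (norm (gnomonic y (zeta x)) + norm (gnomonic y (zeta y))) \<le> G y * (2 * (3 * c) + 2 * c)"
    using Gy by (intro mult_left_mono) auto
  also have "\<dots> \<le> 2" using c by (simp add: algebra_simps)
  finally show ?thesis
    using c ga(1) gb(1) by (intro near_zeros_eq[OF y1] zeta x y) auto
qed

lemma zeta_eq:
  assumes "x \<in> A_set d f" "y \<in> A_set d f" "B_set d f x \<inter> B_set d f y \<noteq> {}"
  shows "zeta x = zeta y"
proof -
  obtain z where "z \<in> B_set d f x" "z \<in> B_set d f y" using assms(3) by blast
  then show ?thesis
    using zeta_eq_of_regular_le[of x y z] zeta_eq_of_regular_le[of y x z] assms linear[of "m x" "m y"]
    by metis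
qed

text \<open>A zero with tangent norm below 12.5 radii would make the quantity in
  \<open>near_zeros_eq\<close> at most \<open>(12.5 + 1.03) * 0.145\<close>, just below its limit 2,
  and hence be \<open>zeta x\<close>. This is the origin of 8/100.\<close>

lemma radius_le_of_other_zero:
  assumes x: "x \<in> A_set d f" and z: "norm z = 1" "eval_sys f z = 0" "x \<bullet> z > 0" "z \<noteq> zeta x"
  shows "radius d f x \<le> 8 / 100 * norm (gnomonic x z)"
proof (rule ccontr)
  assume "\<not> ?thesis"
  then have h: "norm (gnomonic x z) \<le> 100 / 8 * radius d f x" by simp
  note x1 = A_setD(1,2)[OF x]
  let ?c = "radius d f x"
  have Gx: "G x \<ge> 1" by (rule G_ge_1) fact+
  have c: "0 \<le> ?c" "?c \<le> 145 / 1000" by (rule radius_bounds(1)[OF x], rule radius_le[OF x])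
  note g = norm_gnomonic_le_chord[OF x1(1) zeta(3)[OF x] zeta(4)[OF x]]
  have "?c\<^sup>2 \<le> (145 / 1000)\<^sup>2" using c by (intro power_mono) auto
  then have "98 / 100 \<le> 1 - ?c\<^sup>2 / 2" by (simp add: power2_eq_square)
  then have "?c / (1 - ?c\<^sup>2 / 2) \<le> ?c / (98 / 100)" using c by (intro divide_left_mono) auto
  then have "norm (gnomonic x z) + norm (gnomonic x (zeta x)) \<le> 100 / 8 * ?c + 100 / 98 * ?c"
    using h g(2) c by simp
  then have "G x * (norm (gnomonic x z) + norm (gnomonic x (zeta x))) \<le> G x * (100 / 8 * ?c + 100 / 98 * ?c)"
    using Gx by (intro mult_left_mono) auto
  also have "\<dots> = (100 / 8 + 100 / 98) * (G x * ?c)" by (simp add: algebra_simps)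
  also have "\<dots> \<le> (100 / 8 + 100 / 98) * (145 / 1000)"
    by (intro mult_left_mono radius_bounds x) simp
  finally have "z = zeta x"
    using c g(1) z by (intro near_zeros_eq[OF x1] zeta x) auto
  with z show False by simp
qed

end

section \<open>The mesh\<close>

text \<open>The left side is the squared sine of the angle between \<open>a\<close> and
  \<open>z\<close>. Times \<open>(norm a)^2\<close> it is the squared distance from \<open>a\<close>
  to the line of \<open>z\<close>, hence at most that to any point \<open>t *\<^sub>R z\<close> on
  it.\<close>

lemma one_minus_inner_sq_le:
  fixes a z :: "real^'m"
  assumes a: "norm a \<ge> 1" and z: "norm z = 1"
  shows "1 - ((a /\<^sub>R norm a) \<bullet> z)\<^sup>2 \<le> (norm (a - t *\<^sub>R z))\<^sup>2 / (norm a)\<^sup>2"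
proof -
  have a0: "norm a > 0" using a by linarith
  have "(norm (a - t *\<^sub>R z))\<^sup>2 = (norm a)\<^sup>2 - 2 * t * (a \<bullet> z) + t\<^sup>2"
  proof -
    have "(norm (a - t *\<^sub>R z))\<^sup>2 = (norm a)\<^sup>2 + (norm (t *\<^sub>R z))\<^sup>2 - 2 * (a \<bullet> (t *\<^sub>R z))"
      unfolding power2_norm_eq_inner by (simp add: inner_diff_left inner_diff_right inner_commute)
    then show ?thesis using z by simp
  qed
  moreover have "0 \<le> (t - a \<bullet> z)\<^sup>2" by simp
  ultimately have "(norm a)\<^sup>2 - (a \<bullet> z)\<^sup>2 \<le> (norm (a - t *\<^sub>R z))\<^sup>2"
    by (simp add: power2_diff mult_ac)
  then have "((norm a)\<^sup>2 - (a \<bullet> z)\<^sup>2) / (norm a)\<^sup>2 \<le> (norm (a - t *\<^sub>R z))\<^sup>2 / (norm a)\<^sup>2"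
    by (rule divide_right_mono) simp
  moreover have "1 - ((a /\<^sub>R norm a) \<bullet> z)\<^sup>2 = ((norm a)\<^sup>2 - (a \<bullet> z)\<^sup>2) / (norm a)\<^sup>2"
    using a0 by (simp add: field_simps)
  ultimately show ?thesis by simp
qed

text \<open>The squared tangent is \<open>s / (1 - s)\<close> for the squared sine \<open>s\<close>.
  With \<open>s \<le> 1 / 5\<close> this costs a factor 5/4, and
  \<open>sqrt (5 / 4) < 9 / 8\<close>.\<close>

lemma norm_gnomonic_le:
  fixes a c :: "real^'m"
  assumes a: "norm a \<ge> 1" and c: "norm c \<ge> 1" and e: "norm (a - c) \<le> e" and e5: "e\<^sup>2 \<le> 1 / 5"
  shows "(a /\<^sub>R norm a) \<bullet> (c /\<^sub>R norm c) > 0"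
    and "norm (gnomonic (a /\<^sub>R norm a) (c /\<^sub>R norm c)) \<le> 9 / 8 * e / norm a"
proof -
  let ?x = "a /\<^sub>R norm a" and ?z = "c /\<^sub>R norm c"
  have a0: "norm a > 0" and c0: "norm c > 0" and e0: "e \<ge> 0"
    using a c e norm_ge_zero[of "a - c"] by linarith+
  have x1: "norm ?x = 1" and z1: "norm ?z = 1" using a0 c0 by simp_all
  have e2: "(norm (a - c))\<^sup>2 \<le> e\<^sup>2" using e by (intro power_mono) auto
  have "(norm (a - c))\<^sup>2 = (norm a)\<^sup>2 + (norm c)\<^sup>2 - 2 * (a \<bullet> c)"
    by (simp add: power2_norm_eq_inner inner_diff_left inner_diff_right inner_commute)
  moreover have "1 \<le> (norm a)\<^sup>2" "1 \<le> (norm c)\<^sup>2" using a c by simp_all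
  ultimately have "a \<bullet> c > 0" using e2 e5 by linarith
  then show pos: "?x \<bullet> ?z > 0" using a0 c0 by simp
  define s where "s = e\<^sup>2 / (norm a)\<^sup>2"
  have s: "0 \<le> s" "s \<le> 1 / 5"
  proof -
    show "0 \<le> s" by (simp add: s_def)
    have "e\<^sup>2 / (norm a)\<^sup>2 \<le> e\<^sup>2 / 1" using \<open>1 \<le> (norm a)\<^sup>2\<close> by (intro divide_left_mono) auto
    then have "s \<le> e\<^sup>2" by (simp add: s_def)
    with e5 show "s \<le> 1 / 5" by linarith
  qed
  have "1 - (?x \<bullet> ?z)\<^sup>2 \<le> (norm (a - norm c *\<^sub>R ?z))\<^sup>2 / (norm a)\<^sup>2"
    by (rule one_minus_inner_sq_le[OF a z1])
  also have "\<dots> \<le> s" using c0 e2 by (simp add: s_def divide_right_mono)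
  finally have "1 - s \<le> (?x \<bullet> ?z)\<^sup>2" by simp
  then have "1 / (?x \<bullet> ?z)\<^sup>2 - 1 \<le> 1 / (1 - s) - 1"
    using s pos by (intro diff_right_mono divide_left_mono mult_pos_pos zero_less_power) auto
  also have "\<dots> = s / (1 - s)" using s by (simp add: field_simps)
  also have "\<dots> \<le> s / (4 / 5)" using s by (intro divide_left_mono) auto
  also have "\<dots> = 5 / 4 * (e\<^sup>2 / (norm a)\<^sup>2)" by (simp add: s_def)
  also have "\<dots> \<le> 81 / 64 * (e\<^sup>2 / (norm a)\<^sup>2)" by (rule mult_right_mono) simp_all
  also have "\<dots> = (9 / 8 * e / norm a)\<^sup>2"
    by (simp add: power_mult_distrib power_divide power2_eq_square)
  finally have "(norm (gnomonic ?x ?z))\<^sup>2 \<le> (9 / 8 * e / norm a)\<^sup>2"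
    by (simp only: norm_gnomonic_sq[OF x1 z1 pos])
  then show "norm (gnomonic ?x ?z) \<le> 9 / 8 * e / norm a"
    by (rule power2_le_imp_le) (use e0 a0 in simp)
qed

lemma ang_dist_le_norm_gnomonic:
  assumes x: "norm x = 1" and z: "norm z = 1" and pos: "x \<bullet> z > 0"
  shows "ang_dist x z \<le> norm (gnomonic x z)"
proof -
  have "1 + (norm (gnomonic x z))\<^sup>2 = (1 / (x \<bullet> z))\<^sup>2"
    using norm_gnomonic_sq[OF x z pos] by (simp add: power_divide)
  then have "sqrt (1 + (norm (gnomonic x z))\<^sup>2) = 1 / (x \<bullet> z)"
    using pos by (simp only: real_sqrt_abs) simp
  then have "x \<bullet> z = cos (arctan (norm (gnomonic x z)))"
    by (simp add: cos_arctan)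
  then have "ang_dist x z = arctan (norm (gnomonic x z))"
    unfolding ang_dist_def using arctan_ubound[of "norm (gnomonic x z)"] pi_gt_zero
    by (simp add: arccos_cos del: pi_gt_zero)
  also have "\<dots> \<le> norm (gnomonic x z)" by (rule arctan_le_self) simp
  finally show ?thesis .
qed

text \<open>The hypothesis \<open>ai\<close> says that the axis makes an angle of at least 45
  degrees with \<open>a\<close>. The Gram determinant \<open>s^2 * ((norm a)^2 - (a $ i)^2)\<close>
  then bounds the sine of the angle between \<open>a\<close> and \<open>b\<close> from below by
  \<open>\<bar>s\<bar> / (sqrt 2 * norm b)\<close>; the chord is no shorter than the sine, and
  \<open>7 / 10 < 1 / sqrt 2\<close>.\<close>

lemma chord_axis_ge:
  fixes a :: "real^'m"
  assumes b: "b = a + s *\<^sub>R axis i 1" and a0: "norm a \<ge> 1" and b0: "norm b \<ge> 1"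
    and ai: "2 * (a $ i)\<^sup>2 \<le> (norm a)\<^sup>2"
  shows "7 / 10 * \<bar>s\<bar> / norm b \<le> norm (a /\<^sub>R norm a - b /\<^sub>R norm b)"
proof -
  let ?x = "a /\<^sub>R norm a" and ?y = "b /\<^sub>R norm b"
  have n: "norm a > 0" "norm b > 0" using a0 b0 by linarith+
  have ab: "a \<bullet> b = (norm a)\<^sup>2 + s * (a $ i)"
    by (simp add: b inner_add_right inner_axis power2_norm_eq_inner)
  have bb: "(norm b)\<^sup>2 = (norm a)\<^sup>2 + 2 * s * (a $ i) + s\<^sup>2"
    unfolding b power2_norm_eq_inner
    by (simp add: inner_add_right inner_add_left inner_axis inner_axis' power2_eq_square algebra_simps)
  have "(norm a)\<^sup>2 * (norm b)\<^sup>2 - (a \<bullet> b)\<^sup>2 = s\<^sup>2 * ((norm a)\<^sup>2 - (a $ i)\<^sup>2)"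
    unfolding ab bb by (simp add: power2_eq_square algebra_simps)
  also have "\<dots> \<ge> s\<^sup>2 * ((norm a)\<^sup>2 / 2)"
    using ai by (intro mult_left_mono) auto
  finally have h: "s\<^sup>2 * (norm a)\<^sup>2 / 2 \<le> (norm a)\<^sup>2 * (norm b)\<^sup>2 - (a \<bullet> b)\<^sup>2" by simp
  have "(7 / 10 * \<bar>s\<bar> / norm b)\<^sup>2 = 49 / 100 * (s\<^sup>2 / (norm b)\<^sup>2)"
    by (simp add: power_mult_distrib power_divide power2_eq_square)
  also have "\<dots> \<le> 1 / 2 * (s\<^sup>2 / (norm b)\<^sup>2)" by (rule mult_right_mono) simp_all
  also have "\<dots> = (s\<^sup>2 * (norm a)\<^sup>2 / 2) / ((norm a)\<^sup>2 * (norm b)\<^sup>2)"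
    using n by simp
  also have "\<dots> \<le> ((norm a)\<^sup>2 * (norm b)\<^sup>2 - (a \<bullet> b)\<^sup>2) / ((norm a)\<^sup>2 * (norm b)\<^sup>2)"
    by (rule divide_right_mono[OF h]) simp
  also have "\<dots> = 1 - (?x \<bullet> ?y)\<^sup>2"
    using n by (simp add: field_simps)
  also have "\<dots> \<le> 2 - 2 * (?x \<bullet> ?y)"
    using zero_le_power2[of "1 - ?x \<bullet> ?y"] by (simp add: power2_diff)
  also have "\<dots> = (norm (?x - ?y))\<^sup>2"
    using n by (intro norm_diff_unit_sq[symmetric]) auto
  finally show ?thesis by (rule power2_le_imp_le) simp
qed

lemma infnorm_eq_1I:
  fixes z :: "real^'m"
  assumes "\<And>i. \<bar>z $ i\<bar> \<le> 1" "\<bar>z $ j\<bar> = 1"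
  shows "infnorm z = 1"
proof (rule antisym)
  show "infnorm z \<le> 1"
    unfolding infnorm_Max using assms(1) by (auto simp: Basis_vec_def inner_axis)
  show "1 \<le> infnorm z" using component_le_infnorm_cart[of z j] assms(2) by simp
qed

lemma norm_ge_1_of_component:
  fixes z :: "real^'m"
  assumes "\<bar>z $ j\<bar> = 1"
  shows "norm z \<ge> 1"
  using component_le_norm_cart[of z j] assms by simp

text \<open>The final mesh size is written \<open>1 / K\<close> with a natural number
  \<open>K\<close>. The bounds on \<open>K\<close> hold from the first tested mesh size on;
  \<open>K8\<close> says that \<open>\<eta> * sqrt n\<close> is at most
  \<open>1 / sqrt 8\<close>.\<close>

locale stopped_system = normalized_system d f
  for d :: "'n::finite \<Rightarrow> nat" and f :: "'n \<Rightarrow> 'm::finite rpoly" +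
  fixes K :: nat
  assumes card: "CARD('m) = CARD('n) + 1" and K4: "K \<ge> 4" and K8: "8 * CARD('n) \<le> K\<^sup>2"
    and stop: "stop_cond d f (1 / K)"
begin

abbreviation \<eta> :: real where "\<eta> \<equiv> 1 / K"

text \<open>Mesh points before normalization. On the cube surface neighbours differ by multiples of
  axis vectors, so distances are estimated there and carried to the sphere by
  \<open>norm_gnomonic_le\<close> and \<open>chord_axis_ge\<close>.\<close>

definition grid :: "(real^'m) set" where
  "grid = {a. (\<forall>i. a $ i * K \<in> \<int>) \<and> (\<forall>i. \<bar>a $ i\<bar> \<le> 1) \<and> (\<exists>i. \<bar>a $ i\<bar> = 1)}"

lemma norm_grid_ge_1: "a \<in> grid \<Longrightarrow> norm a \<ge> 1"
  unfolding grid_def using norm_ge_1_of_component by blast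

lemma grid_in_mesh:
  assumes "a \<in> grid"
  shows "a /\<^sub>R norm a \<in> mesh \<eta>"
proof -
  have "infnorm a = 1" using assms infnorm_eq_1I[of a] unfolding grid_def by auto
  with assms show ?thesis unfolding mesh_def grid_def by auto
qed

lemma finite_vertices: "finite (vertices d f \<eta>)"
proof -
  let ?S = "(\<lambda>k. real_of_int k / K) ` {- int K..int K}"
  let ?A = "{a :: real^'m. \<forall>i. a $ i \<in> ?S}"
  have "?A \<subseteq> vec_lambda ` (PiE UNIV (\<lambda>_. ?S))"
  proof
    fix a assume "a \<in> ?A"
    then have "vec_nth a \<in> PiE UNIV (\<lambda>_. ?S)" by auto
    then show "a \<in> vec_lambda ` (PiE UNIV (\<lambda>_. ?S))"
      by (metis image_eqI vec_nth_inverse)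
  qed
  then have "finite ?A"
    by (rule finite_subset) (intro finite_imageI finite_PiE, auto)
  moreover have "mesh \<eta> \<subseteq> (\<lambda>a. a /\<^sub>R norm a) ` ?A"
  proof
    fix y :: "real^'m" assume "y \<in> mesh \<eta>"
    then obtain a where a: "y = a /\<^sub>R norm a" "\<And>i. a $ i * K \<in> \<int>" "infnorm a = 1"
      by (auto simp: mesh_def)
    have "a $ i \<in> ?S" for i
    proof -
      obtain k where k: "a $ i * K = real_of_int k" using a(2) by (auto elim: Ints_cases)
      have "\<bar>a $ i\<bar> \<le> 1" using component_le_infnorm_cart[of a i] a(3) by simp
      then have "\<bar>real_of_int k\<bar> \<le> K"
        using K4 unfolding k[symmetric] by (simp add: abs_mult mult_left_le_one_le mult_le_cancel_right1)
      then have "k \<in> {- int K..int K}" by auto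
      moreover have "a $ i = real_of_int k / K" using k K4 by (simp add: field_simps)
      ultimately show ?thesis by blast
    qed
    then show "y \<in> (\<lambda>a. a /\<^sub>R norm a) ` ?A" using a(1) by blast
  qed
  ultimately have "finite (mesh \<eta> :: (real^'m) set)" by (meson finite_imageI finite_subset)
  then show ?thesis by (simp add: vertices_def)
qed

section \<open>Connected components and zeros\<close>

definition R :: "((real^'m) \<times> (real^'m)) set" where
  "R = (edges d f \<eta>)\<^sup>* \<inter> vertices d f \<eta> \<times> vertices d f \<eta>"

text \<open>Vertices with the same zero have it in both balls and are adjacent, while
  \<open>zeta\<close> is constant along edges by \<open>zeta_eq\<close>. The components are
  therefore cliques.\<close>

lemma R_iff:
  "(x, y) \<in> R \<longleftrightarrow> x \<in> vertices d f \<eta> \<and> y \<in> vertices d f \<eta> \<and> zeta x = zeta y"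
proof -
  have "zeta x = zeta y" if "(x, y) \<in> (edges d f \<eta>)\<^sup>*"
    using that
  proof induction
    case (step y z)
    then have "zeta y = zeta z" by (intro zeta_eq) (auto simp: edges_def vertices_def)
    with step show ?case by simp
  qed simp
  moreover have "(x, y) \<in> edges d f \<eta>"
    if "x \<in> vertices d f \<eta>" "y \<in> vertices d f \<eta>" "zeta x = zeta y"
    using that zeta(1)[of x] zeta(1)[of y] by (auto simp: edges_def vertices_def)
  ultimately show ?thesis by (auto simp: R_def)
qed

lemma components_eq: "components_G d f \<eta> = (\<lambda>x. {y \<in> vertices d f \<eta>. zeta y = zeta x}) ` vertices d f \<eta>"
proof -
  have "R `` {x} = {y \<in> vertices d f \<eta>. zeta y = zeta x}" if "x \<in> vertices d f \<eta>" for x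
    using that by (auto simp: R_iff)
  then have "(\<lambda>x. R `` {x}) ` vertices d f \<eta> = (\<lambda>x. {y \<in> vertices d f \<eta>. zeta y = zeta x}) ` vertices d f \<eta>"
    by (rule image_cong[OF refl])
  moreover have "vertices d f \<eta> // R = (\<lambda>x. R `` {x}) ` vertices d f \<eta>"
    by (simp add: quotient_def UNION_singleton_eq_range)
  ultimately show ?thesis
    by (simp only: components_G_def R_def[symmetric])
qed

lemma card_components: "card (components_G d f \<eta>) = card (zeta ` vertices d f \<eta>)"
proof -
  have "components_G d f \<eta> = (\<lambda>z. {y \<in> vertices d f \<eta>. zeta y = z}) ` zeta ` vertices d f \<eta>"
    by (simp add: components_eq image_image)
  moreover have "inj_on (\<lambda>z. {y \<in> vertices d f \<eta>. zeta y = z}) (zeta ` vertices d f \<eta>)"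
  proof (rule inj_onI)
    fix z w
    assume "z \<in> zeta ` vertices d f \<eta>"
      and e: "{y \<in> vertices d f \<eta>. zeta y = z} = {y \<in> vertices d f \<eta>. zeta y = w}"
    then obtain x where "x \<in> {y \<in> vertices d f \<eta>. zeta y = z}" by auto
    moreover from this have "x \<in> {y \<in> vertices d f \<eta>. zeta y = w}" unfolding e .
    ultimately show "z = w" by simp
  qed
  ultimately show ?thesis by (simp add: card_image)
qed

lemma zeta_eq_of_near:
  assumes "x \<in> vertices d f \<eta>" "y \<in> vertices d f \<eta>" "ang_dist x y \<le> 2 * \<eta> * sqrt CARD('n)"
  shows "zeta x = zeta y"
proof (rule ccontr)
  assume ne: "zeta x \<noteq> zeta y"
  let ?C = "\<lambda>x. {y \<in> vertices d f \<eta>. zeta y = zeta x}"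
  have C: "?C x \<in> components_G d f \<eta>" "?C y \<in> components_G d f \<eta>"
    unfolding components_eq using assms(1,2) by (blast intro: imageI)+
  have xy: "x \<in> ?C x" "y \<in> ?C y" using assms by simp_all
  then have "?C x \<noteq> ?C y" using ne by auto
  from stop[unfolded stop_cond_def, THEN conjunct1, rule_format, OF C this xy]
  have "2 * \<eta> * sqrt CARD('n) < ang_dist x y" .
  with assms show False by simp
qed

lemma in_vertices:
  assumes "a \<in> grid" "norm (eval_sys f (a /\<^sub>R norm a)) \<le> \<eta> * sqrt (real CARD('n) * D) / 2"
  shows "a /\<^sub>R norm a \<in> vertices d f \<eta>"
proof (rule ccontr)
  assume "a /\<^sub>R norm a \<notin> vertices d f \<eta>"
  then have "a /\<^sub>R norm a \<in> mesh \<eta> - A_set d f"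
    using grid_in_mesh[OF assms(1)] by (simp add: vertices_def)
  from stop[unfolded stop_cond_def max_deg_eq, THEN conjunct2, rule_format, OF this] assms(2)
  show False by linarith
qed

text \<open>The allowed distance times the rate \<open>sqrt D\<close> is exactly the threshold for
  points outside \<open>A_set\<close>. The scaling \<open>t\<close> is free so that the zero can be
  moved to the height of the grid point: \<open>norm c\<close> for the cell of \<open>z\<close>,
  \<open>norm a\<close> for \<open>zeta x\<close>.\<close>

lemma in_verticesI:
  assumes a: "a \<in> grid" and z: "norm z = 1" "eval_sys f z = 0"
    and l: "norm (a - t *\<^sub>R z) \<le> \<eta> * sqrt CARD('n) / 2"
  shows "a /\<^sub>R norm a \<in> vertices d f \<eta>"
proof (rule in_vertices[OF a])
  have a1: "norm a \<ge> 1" by (rule norm_grid_ge_1[OF a])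
  then have "norm a > 0" by linarith
  then have n1: "norm (a /\<^sub>R norm a) = 1" by simp
  have "(norm (eval_sys f (a /\<^sub>R norm a)))\<^sup>2 \<le> D * (1 - ((a /\<^sub>R norm a) \<bullet> z)\<^sup>2)"
    by (rule norm_eval_sys_near_zero[OF n1 z])
  also have "\<dots> \<le> D * ((norm (a - t *\<^sub>R z))\<^sup>2 / (norm a)\<^sup>2)"
    by (intro mult_left_mono one_minus_inner_sq_le a1 z) simp
  also have "\<dots> \<le> D * (norm (a - t *\<^sub>R z))\<^sup>2"
  proof -
    have "(norm (a - t *\<^sub>R z))\<^sup>2 / (norm a)\<^sup>2 \<le> (norm (a - t *\<^sub>R z))\<^sup>2 / 1"
      using a1 by (intro divide_left_mono) auto
    then show ?thesis by (intro mult_left_mono) auto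
  qed
  also have "\<dots> \<le> D * (\<eta> * sqrt CARD('n) / 2)\<^sup>2"
    using l by (intro mult_left_mono power_mono) auto
  also have "\<dots> = (\<eta> * sqrt (real CARD('n) * D) / 2)\<^sup>2"
    by (simp add: power_mult_distrib power_divide real_sqrt_mult)
  finally show "norm (eval_sys f (a /\<^sub>R norm a)) \<le> \<eta> * sqrt (real CARD('n) * D) / 2"
    by (rule power2_le_imp_le) simp
qed

text \<open>Otherwise the first stopping condition gives both vertices one zero different from
  \<open>c /\<^sub>R norm c\<close>. By \<open>radius_le_of_other_zero\<close> their chord is at
  most \<open>9 / 100 * (\<alpha> / norm a + \<beta> / norm b)\<close>, and by
  \<open>chord_axis_ge\<close> at least \<open>7 / 10 * \<bar>s\<bar> / norm b\<close>. After
  \<open>norm b \<le> 5 / 4 * norm a\<close>, the hypothesis \<open>ineq\<close> is ten times the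
  failure of this comparison.\<close>

lemma neighbour_forces_zero:
  assumes a: "a \<in> grid" and b: "b \<in> grid" "b = a + s *\<^sub>R axis i 1"
    and s: "\<bar>s\<bar> \<le> 1 / 4" "\<bar>s\<bar> \<le> \<eta> * sqrt CARD('n)" and ai: "2 * (a $ i)\<^sup>2 \<le> (norm a)\<^sup>2"
    and x: "a /\<^sub>R norm a \<in> vertices d f \<eta>" and y: "b /\<^sub>R norm b \<in> vertices d f \<eta>"
    and c: "norm c \<ge> 1" "eval_sys f c = 0"
    and \<alpha>: "norm (a - c) \<le> \<alpha>" "\<alpha>\<^sup>2 \<le> 1 / 5" and \<beta>: "norm (b - c) \<le> \<beta>" "\<beta>\<^sup>2 \<le> 1 / 5"
    and ineq: "9 / 10 * (5 / 4 * \<alpha> + \<beta>) < 7 * \<bar>s\<bar>"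
  shows "zeta (a /\<^sub>R norm a) = c /\<^sub>R norm c"
proof (rule ccontr)
  let ?x = "a /\<^sub>R norm a" and ?y = "b /\<^sub>R norm b" and ?z = "c /\<^sub>R norm c"
  assume ne: "zeta ?x \<noteq> ?z"
  have a1: "norm a \<ge> 1" and b1: "norm b \<ge> 1" using norm_grid_ge_1 a b(1) by auto
  have n0: "norm a > 0" "norm b > 0" "norm c > 0" using a1 b1 c(1) by linarith+
  have u: "norm ?x = 1" "norm ?y = 1" "norm ?z = 1" using n0 by simp_all
  have z0: "eval_sys f ?z = 0" by (rule eval_sys_scaleR_eq_0[OF c(2)])
  have s2: "\<bar>s\<bar>\<^sup>2 \<le> 1 / 5"
    using power_mono[OF s(1), of 2] by (simp add: power2_eq_square)
  have ab: "norm (a - b) \<le> \<bar>s\<bar>" by (simp add: b(2))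
  note gxy = norm_gnomonic_le[OF a1 b1 ab s2]
  have "ang_dist ?x ?y \<le> 9 / 8 * \<bar>s\<bar> / norm a"
    using ang_dist_le_norm_gnomonic[OF u(1,2) gxy(1)] gxy(2) by simp
  also have "\<dots> \<le> 9 / 8 * \<bar>s\<bar> / 1" using a1 by (intro divide_left_mono) auto
  also have "\<dots> \<le> 2 * \<eta> * sqrt CARD('n)" using s(2) by simp
  finally have eq: "zeta ?x = zeta ?y" by (intro zeta_eq_of_near x y)
  have A: "?x \<in> A_set d f" "?y \<in> A_set d f" using x y by (auto simp: vertices_def)
  note gx = norm_gnomonic_le[OF a1 c(1) \<alpha>] and gy = norm_gnomonic_le[OF b1 c(1) \<beta>]
  have \<alpha>0: "\<alpha> \<ge> 0" using \<alpha>(1) norm_ge_zero order_trans by blast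
  have nb: "norm b \<le> 5 / 4 * norm a"
    using norm_triangle_ineq[of a "s *\<^sub>R axis i 1"] s(1) a1 by (simp add: b(2))
  have "norm (?x - ?y) \<le> norm (?x - zeta ?x) + norm (?y - zeta ?x)"
    using norm_triangle_ineq[of "?x - zeta ?x" "zeta ?x - ?y"] by (simp add: norm_minus_commute)
  also have "\<dots> \<le> radius d f ?x + radius d f ?y"
    using zeta(4)[OF A(1)] zeta(4)[OF A(2)] eq by simp
  also have "\<dots> \<le> 8 / 100 * norm (gnomonic ?x ?z) + 8 / 100 * norm (gnomonic ?y ?z)"
    using ne eq by (intro add_mono radius_le_of_other_zero A u z0 gx gy) auto
  also have "\<dots> \<le> 8 / 100 * (9 / 8 * \<alpha> / norm a) + 8 / 100 * (9 / 8 * \<beta> / norm b)"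
    by (intro add_mono mult_left_mono gx gy) simp_all
  also have "9 / 8 * \<alpha> / norm a \<le> 9 / 8 * \<alpha> * (5 / 4) / norm b"
  proof -
    have "9 / 8 * \<alpha> * norm b \<le> 9 / 8 * \<alpha> * (5 / 4 * norm a)"
      using nb \<alpha>0 by (intro mult_left_mono) auto
    then show ?thesis using n0 by (simp add: divide_simps)
  qed
  finally have "norm (?x - ?y) \<le> (9 / 100 * (5 / 4 * \<alpha> + \<beta>)) / norm b"
    by (simp add: add_divide_distrib)
  also have "\<dots> < (7 / 10 * \<bar>s\<bar>) / norm b"
    using ineq n0 by (intro divide_strict_right_mono) auto
  also have "\<dots> \<le> norm (?x - ?y)"
    by (rule chord_axis_ge[OF b(2) a1 b1 ai])
  finally show False by simp
qed

end

section \<open>Several equations\<close>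

text \<open>A linear map and its adjoint have the same operator norm; here the map sends
  \<open>w\<close> to the family \<open>sqrt (\<pi> i) * (w \<bullet> b i)\<close>.\<close>

lemma weighted_sum_norm_sq_le:
  fixes b :: "'i \<Rightarrow> 'a::real_inner"
  assumes \<pi>: "\<And>i. i \<in> I \<Longrightarrow> \<pi> i \<ge> 0" and L: "L \<ge> 0"
    and b: "\<And>w. (\<Sum>i\<in>I. \<pi> i * (w \<bullet> b i)\<^sup>2) \<le> L * (norm w)\<^sup>2"
  shows "(norm (\<Sum>i\<in>I. (\<pi> i * e i) *\<^sub>R b i))\<^sup>2 \<le> L * (\<Sum>i\<in>I. \<pi> i * (e i)\<^sup>2)"
proof -
  define V where "V = (\<Sum>i\<in>I. (\<pi> i * e i) *\<^sub>R b i)"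
  have S0: "0 \<le> (\<Sum>i\<in>I. \<pi> i * (e i)\<^sup>2)" using \<pi> by (intro sum_nonneg) simp
  have "(norm V)\<^sup>2 = (\<Sum>i\<in>I. \<pi> i * e i * (V \<bullet> b i))"
    by (subst power2_norm_eq_inner) (subst (2) V_def, simp add: inner_sum_right)
  also have "\<dots> = (\<Sum>i\<in>I. (sqrt (\<pi> i) * e i) * (sqrt (\<pi> i) * (V \<bullet> b i)))"
    using \<pi> by (intro sum.cong) (auto simp: algebra_simps)
  finally have "((norm V)\<^sup>2)\<^sup>2 \<le> (\<Sum>i\<in>I. (sqrt (\<pi> i) * e i)\<^sup>2) * (\<Sum>i\<in>I. (sqrt (\<pi> i) * (V \<bullet> b i))\<^sup>2)"
    by (simp only: Cauchy_Schwarz_ineq_sum)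
  also have "\<dots> = (\<Sum>i\<in>I. \<pi> i * (e i)\<^sup>2) * (\<Sum>i\<in>I. \<pi> i * (V \<bullet> b i)\<^sup>2)"
    using \<pi> by (simp add: power_mult_distrib)
  also have "\<dots> \<le> (\<Sum>i\<in>I. \<pi> i * (e i)\<^sup>2) * (L * (norm V)\<^sup>2)"
    by (intro mult_left_mono b S0)
  finally have "(norm V)\<^sup>2 * (norm V)\<^sup>2 \<le> (L * (\<Sum>i\<in>I. \<pi> i * (e i)\<^sup>2)) * (norm V)\<^sup>2"
    by (simp add: power2_eq_square mult_ac)
  then have "(norm V)\<^sup>2 \<le> L * (\<Sum>i\<in>I. \<pi> i * (e i)\<^sup>2)" if "V \<noteq> 0"
    by (rule mult_right_le_imp_le) (use that in simp)
  moreover have "(norm V)\<^sup>2 \<le> L * (\<Sum>i\<in>I. \<pi> i * (e i)\<^sup>2)" if "V = 0"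
    using S0 L that by simp
  ultimately have "(norm V)\<^sup>2 \<le> L * (\<Sum>i\<in>I. \<pi> i * (e i)\<^sup>2)" by blast
  then show ?thesis by (simp add: V_def)
qed

text \<open>
  Schur's bound for the entrywise product of the Gram matrix of the \<open>b i\<close> with a power of the Gram
  matrix of the unit vectors \<open>y i\<close>, which is again a Gram matrix with unit diagonal.
\<close>

lemma schur_power_bound:
  fixes b y :: "'i \<Rightarrow> real^'m"
  assumes \<pi>: "\<And>i. i \<in> I \<Longrightarrow> \<pi> i \<ge> 0" and L: "L \<ge> 0"
    and b: "\<And>w. (\<Sum>i\<in>I. \<pi> i * (w \<bullet> b i)\<^sup>2) \<le> L * (norm w)\<^sup>2"
    and y: "\<And>i. i \<in> I \<Longrightarrow> norm (y i) = 1"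
  shows "(\<Sum>i\<in>I. \<Sum>j\<in>I. \<pi> i * e i * (\<pi> j * e j) * (b i \<bullet> b j) * (y i \<bullet> y j) ^ k)
    \<le> L * (\<Sum>i\<in>I. \<pi> i * (e i)\<^sup>2)"
proof (induction k arbitrary: e)
  case 0
  have "(\<Sum>i\<in>I. \<Sum>j\<in>I. \<pi> i * e i * (\<pi> j * e j) * (b i \<bullet> b j)) = (norm (\<Sum>i\<in>I. (\<pi> i * e i) *\<^sub>R b i))\<^sup>2"
    by (simp add: power2_norm_eq_inner inner_sum_left inner_sum_right sum_distrib_left mult_ac inner_commute)
  with weighted_sum_norm_sq_le[OF \<pi> L b, of e] show ?case by simp
next
  case (Suc k)
  \<comment> \<open>One factor \<open>y i \<bullet> y j\<close> is split into coordinates, which are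
    absorbed into \<open>e\<close>. The induction hypothesis applies to each coordinate, and unit
    length of \<open>y i\<close> recombines the bounds.\<close>
  have "(\<Sum>i\<in>I. \<Sum>j\<in>I. \<pi> i * e i * (\<pi> j * e j) * (b i \<bullet> b j) * (y i \<bullet> y j) ^ Suc k)
      = (\<Sum>i\<in>I. \<Sum>j\<in>I. \<Sum>l\<in>UNIV. \<pi> i * (e i * y i $ l) * (\<pi> j * (e j * y j $ l)) * (b i \<bullet> b j) * (y i \<bullet> y j) ^ k)"
  proof (intro sum.cong refl)
    fix i j
    have "\<pi> i * e i * (\<pi> j * e j) * (b i \<bullet> b j) * (y i \<bullet> y j) ^ Suc k
        = (\<Sum>l\<in>UNIV. y i $ l * y j $ l) * (\<pi> i * e i * (\<pi> j * e j) * (b i \<bullet> b j) * (y i \<bullet> y j) ^ k)"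
      by (simp add: inner_vec_def)
    also have "\<dots> = (\<Sum>l\<in>UNIV. \<pi> i * (e i * y i $ l) * (\<pi> j * (e j * y j $ l)) * (b i \<bullet> b j) * (y i \<bullet> y j) ^ k)"
      unfolding sum_distrib_right by (intro sum.cong refl) (simp only: mult_ac)
    finally show "\<pi> i * e i * (\<pi> j * e j) * (b i \<bullet> b j) * (y i \<bullet> y j) ^ Suc k = \<dots>" .
  qed
  also have "\<dots> = (\<Sum>l\<in>UNIV. \<Sum>i\<in>I. \<Sum>j\<in>I. \<pi> i * (e i * y i $ l) * (\<pi> j * (e j * y j $ l)) * (b i \<bullet> b j) * (y i \<bullet> y j) ^ k)"
    by (simp only: sum.swap[of _ "UNIV :: 'm set" I])
  also have "\<dots> \<le> (\<Sum>l\<in>UNIV. L * (\<Sum>i\<in>I. \<pi> i * (e i * y i $ l)\<^sup>2))"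
    by (intro sum_mono Suc.IH)
  also have "\<dots> = L * (\<Sum>i\<in>I. \<Sum>l\<in>UNIV. \<pi> i * (e i * y i $ l)\<^sup>2)"
    by (simp only: sum_distrib_left[symmetric] sum.swap[of _ I "UNIV :: 'm set"])
  also have "(\<Sum>i\<in>I. \<Sum>l\<in>UNIV. \<pi> i * (e i * y i $ l)\<^sup>2) = (\<Sum>i\<in>I. \<pi> i * (e i)\<^sup>2)"
  proof (intro sum.cong refl)
    fix i assume i: "i \<in> I"
    have "(\<Sum>l\<in>UNIV. \<pi> i * (e i * y i $ l)\<^sup>2) = \<pi> i * (e i)\<^sup>2 * (norm (y i))\<^sup>2"
      by (simp add: norm_vec_sq sum_distrib_left power_mult_distrib mult_ac)
    then show "(\<Sum>l\<in>UNIV. \<pi> i * (e i * y i $ l)\<^sup>2) = \<pi> i * (e i)\<^sup>2" using y[OF i] by simp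
  qed
  finally show ?case .
qed

text \<open>
  The values at points around a zero \<open>z\<close> are controlled by the operator norm of the weighted
  projections of these points, and not only by their distances to \<open>z\<close>.
\<close>

lemma weighted_values_bound:
  fixes p :: "'m::finite rpoly" and y :: "'i \<Rightarrow> real^'m"
  assumes p: "homogeneous_of_degree d p" and z: "norm z = 1" and 0: "eval_poly p z = 0"
    and I: "finite I" and \<pi>: "\<And>i. i \<in> I \<Longrightarrow> \<pi> i \<ge> 0" and L: "L \<ge> 0"
    and y: "\<And>i. i \<in> I \<Longrightarrow> norm (y i) = 1"
    and proj: "\<And>w. (\<Sum>i\<in>I. \<pi> i * (w \<bullet> (y i - (y i \<bullet> z) *\<^sub>R z))\<^sup>2) \<le> L * (norm w)\<^sup>2"
  shows "(\<Sum>i\<in>I. \<pi> i * (eval_poly p (y i))\<^sup>2) \<le> (poly_norm d p)\<^sup>2 * (d * L)"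
proof -
  define a where "a = (\<lambda>i. y i \<bullet> z)"
  define b where "b = (\<lambda>i. y i - a i *\<^sub>R z)"
  define e where "e = (\<lambda>i. eval_poly p (y i))"
  define g where "g = (\<lambda>i. \<pi> i * e i)"
  define S where "S = (\<Sum>i\<in>I. \<pi> i * (e i)\<^sup>2)"
  define T where "T = (\<Sum>i\<in>I. g i * a i ^ d)"
  have bL: "(\<Sum>i\<in>I. \<pi> i * (w \<bullet> b i)\<^sup>2) \<le> L * (norm w)\<^sup>2" for w
    using proj[of w] unfolding b_def a_def .
  have zz: "z \<bullet> z = 1" using z by (simp add: dot_square_norm)
  have bb: "y i \<bullet> y j - a i * a j = b i \<bullet> b j" for i j
    by (simp add: b_def a_def inner_diff_left inner_diff_right zz inner_commute algebra_simps)
  have S0: "S \<ge> 0" unfolding S_def using \<pi> by (intro sum_nonneg) simp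
  \<comment> \<open>The additional index \<open>None\<close> carries the zero \<open>z\<close> with
    coefficient \<open>- T\<close>. This projects the combination off the kernel polynomial of
    \<open>z\<close> without changing the value on the left.\<close>
  let ?J = "insert None (Some ` I)"
  let ?c = "\<lambda>i. case i of None \<Rightarrow> - T | Some i \<Rightarrow> g i"
  let ?y = "\<lambda>i. case i of None \<Rightarrow> z | Some i \<Rightarrow> y i"
  have sumJ: "(\<Sum>i\<in>?J. h i) = h None + (\<Sum>i\<in>I. h (Some i))" for h :: "'i option \<Rightarrow> real"
    using I by (subst sum.insert) (auto simp: sum.reindex)
  have "S\<^sup>2 = (\<Sum>i\<in>?J. ?c i * eval_poly p (?y i))\<^sup>2"
    by (simp only: sumJ option.case 0) (simp add: S_def g_def e_def power2_eq_square mult_ac)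
  also have "\<dots> \<le> (poly_norm d p)\<^sup>2 * (\<Sum>i\<in>?J. \<Sum>j\<in>?J. ?c i * ?c j * (?y i \<bullet> ?y j) ^ d)"
    by (rule kernel_inequality[OF p]) (use I in simp)
  also have "(\<Sum>i\<in>?J. \<Sum>j\<in>?J. ?c i * ?c j * (?y i \<bullet> ?y j) ^ d)
      = (\<Sum>i\<in>I. \<Sum>j\<in>I. g i * g j * (y i \<bullet> y j) ^ d) - T * T"
  proof -
    have t: "(\<Sum>i\<in>I. - T * g i * (z \<bullet> y i) ^ d) = - T * T"
      "(\<Sum>i\<in>I. g i * - T * (y i \<bullet> z) ^ d) = - T * T"
      unfolding T_def a_def sum_distrib_left by (simp_all add: inner_commute mult_ac)
    show ?thesis
      by (simp only: sumJ option.case sum.distrib t zz) simp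
  qed
  also have "\<dots> = (\<Sum>i\<in>I. \<Sum>j\<in>I. g i * g j * ((y i \<bullet> y j) ^ d - (a i * a j) ^ d))"
    by (simp add: T_def sum_product right_diff_distrib sum_subtractf power_mult_distrib mult_ac)
  also have "\<dots> \<le> d * (L * S)"
  proof (cases d)
    case (Suc k)
    have "(\<Sum>i\<in>I. \<Sum>j\<in>I. g i * g j * ((y i \<bullet> y j) ^ d - (a i * a j) ^ d))
        = (\<Sum>i\<in>I. \<Sum>j\<in>I. \<Sum>m<d. \<pi> i * (e i * a i ^ (k - m)) * (\<pi> j * (e j * a j ^ (k - m)))
            * (b i \<bullet> b j) * (y i \<bullet> y j) ^ m)"
    proof (intro sum.cong refl)
      fix i j
      \<comment> \<open>Factoring the difference of powers pulls out the Gram entry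
        \<open>b i \<bullet> b j\<close>. The powers of \<open>a i\<close> and \<open>a j\<close>,
        of modulus at most 1, go into \<open>e\<close>, so that each of the \<open>d\<close>
        summands has the shape of \<open>schur_power_bound\<close>.\<close>
      have "(y i \<bullet> y j) ^ d - (a i * a j) ^ d
          = (b i \<bullet> b j) * (\<Sum>m<d. (y i \<bullet> y j) ^ m * (a i * a j) ^ (k - m))"
        unfolding Suc by (simp only: diff_power_eq_sum bb)
      then show "g i * g j * ((y i \<bullet> y j) ^ d - (a i * a j) ^ d)
          = (\<Sum>m<d. \<pi> i * (e i * a i ^ (k - m)) * (\<pi> j * (e j * a j ^ (k - m)))
            * (b i \<bullet> b j) * (y i \<bullet> y j) ^ m)"
        unfolding g_def by (simp only: sum_distrib_left power_mult_distrib mult_ac)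
    qed
    also have "\<dots> = (\<Sum>m<d. \<Sum>i\<in>I. \<Sum>j\<in>I. \<pi> i * (e i * a i ^ (k - m)) * (\<pi> j * (e j * a j ^ (k - m)))
            * (b i \<bullet> b j) * (y i \<bullet> y j) ^ m)"
      by (simp only: sum.swap[of _ "{..<d}" I])
    also have "\<dots> \<le> (\<Sum>m<d. L * (\<Sum>i\<in>I. \<pi> i * (e i * a i ^ (k - m))\<^sup>2))"
      by (intro sum_mono schur_power_bound \<pi> L y bL)
    also have "\<dots> \<le> (\<Sum>m<d. L * S)"
    proof (intro sum_mono mult_left_mono L)
      fix m
      have "(e i * a i ^ (k - m))\<^sup>2 \<le> (e i)\<^sup>2" if "i \<in> I" for i
      proof -
        have "\<bar>a i\<bar> \<le> 1" using Cauchy_Schwarz_ineq2[of "y i" z] y[OF that] z by (simp add: a_def)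
        then have "(a i ^ (k - m))\<^sup>2 \<le> 1"
          by (simp add: power_le_one power_abs abs_square_le_1)
        then have "(e i)\<^sup>2 * (a i ^ (k - m))\<^sup>2 \<le> (e i)\<^sup>2 * 1" by (rule mult_left_mono) simp
        then show ?thesis by (simp add: power_mult_distrib)
      qed
      then show "(\<Sum>i\<in>I. \<pi> i * (e i * a i ^ (k - m))\<^sup>2) \<le> S"
        unfolding S_def using \<pi> by (intro sum_mono mult_left_mono) auto
    qed
    also have "\<dots> = d * (L * S)" by simp
    finally show ?thesis .
  qed simp
  finally have "S\<^sup>2 \<le> (poly_norm d p)\<^sup>2 * (d * (L * S))"
    by (simp add: mult_left_mono)
  then have "S * S \<le> ((poly_norm d p)\<^sup>2 * (d * L)) * S"
    by (simp add: power2_eq_square mult_ac)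
  then have "S \<le> (poly_norm d p)\<^sup>2 * (d * L)"
    using S0 L by (cases "S = 0") auto
  then show ?thesis by (simp add: S_def e_def)
qed

lemma (in normalized_system) weighted_norms_bound:
  fixes L :: real
  assumes z: "norm z = 1" and 0: "eval_sys f z = 0"
    and I: "finite I" and \<pi>: "\<And>i. i \<in> I \<Longrightarrow> \<pi> i \<ge> 0" and L: "L \<ge> 0"
    and y: "\<And>i. i \<in> I \<Longrightarrow> norm (y i) = 1"
    and b: "\<And>w. (\<Sum>i\<in>I. \<pi> i * (w \<bullet> (y i - (y i \<bullet> z) *\<^sub>R z))\<^sup>2) \<le> L * (norm w)\<^sup>2"
  shows "(\<Sum>i\<in>I. \<pi> i * (norm (eval_sys f (y i)))\<^sup>2) \<le> D * L"
proof -
  have "(\<Sum>i\<in>I. \<pi> i * (norm (eval_sys f (y i)))\<^sup>2)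
      = (\<Sum>j\<in>UNIV. \<Sum>i\<in>I. \<pi> i * (eval_poly (f j) (y i))\<^sup>2)"
    by (subst sum.swap) (simp add: norm_vec_sq eval_sys_def sum_distrib_left)
  also have "\<dots> \<le> D * L"
  proof (rule sum_N_bound)
    fix j
    have "eval_poly (f j) z = 0" using 0 by (simp add: eval_sys_def vec_eq_iff)
    then have "(\<Sum>i\<in>I. \<pi> i * (eval_poly (f j) (y i))\<^sup>2) \<le> (N j)\<^sup>2 * (d j * L)"
      by (intro weighted_values_bound[OF homogeneous z _ I \<pi> L y b])
    also have "\<dots> \<le> (N j)\<^sup>2 * (D * L)"
      using degree_le[of j] L by (intro mult_left_mono mult_right_mono) auto
    finally show "(\<Sum>i\<in>I. \<pi> i * (eval_poly (f j) (y i))\<^sup>2) \<le> (N j)\<^sup>2 * (D * L)" .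
  qed
  finally show ?thesis .
qed

text \<open>
  For two indices the weights are chosen such that the mean of the unit vectors minus \<open>t\<close> is a
  multiple of \<open>(1, 1)\<close>, which diagonalizes the quadratic form.
\<close>

lemma cell_weights_exist:
  fixes t :: "'i \<Rightarrow> real"
  assumes J: "finite J" "card J \<ge> 2" and t: "\<And>j. j \<in> J \<Longrightarrow> 0 \<le> t j \<and> t j \<le> 1 / 2"
  obtains \<pi> where "\<And>j. j \<in> J \<Longrightarrow> \<pi> j \<ge> 0" "sum \<pi> J = 1"
    "\<And>u. (\<Sum>i\<in>J. \<pi> i * (u i - (\<Sum>j\<in>J. t j * u j))\<^sup>2) \<le> card J / 4 * (\<Sum>j\<in>J. (u j)\<^sup>2)"
proof (cases "card J = 2")
  case True
  then obtain p q where J2: "J = {p, q}" "p \<noteq> q" by (auto simp: card_2_iff)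
  let ?\<pi> = "\<lambda>j. if j = p then 1 / 2 + (t p - t q) / 2 else 1 / 2 - (t p - t q) / 2"
  have tt: "0 \<le> t p" "t p \<le> 1 / 2" "0 \<le> t q" "t q \<le> 1 / 2" using t J2 by auto
  show ?thesis
  proof
    show "?\<pi> j \<ge> 0" if "j \<in> J" for j using tt by (auto simp: field_simps)
    show "sum ?\<pi> J = 1" using J2 by simp
    fix u :: "'i \<Rightarrow> real"
    let ?r = "1 / 4 - ((t p - t q) / 2)\<^sup>2" and ?q = "((1 - t p - t q) / 2)\<^sup>2"
    have "(\<Sum>i\<in>J. ?\<pi> i * (u i - (\<Sum>j\<in>J. t j * u j))\<^sup>2) = ?r * (u p - u q)\<^sup>2 + ?q * (u p + u q)\<^sup>2"
      using J2 by (simp add: power2_eq_square field_simps)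
    also have "\<dots> \<le> 1 / 4 * (u p - u q)\<^sup>2 + 1 / 4 * (u p + u q)\<^sup>2"
    proof (intro add_mono mult_right_mono)
      have "((1 - t p - t q) / 2)\<^sup>2 \<le> (1 / 2)\<^sup>2" using tt by (intro power_mono) auto
      then show "?q \<le> 1 / 4" by (simp add: power2_eq_square)
    qed simp_all
    also have "\<dots> = card J / 4 * (\<Sum>j\<in>J. (u j)\<^sup>2)"
      using J2 True by (simp add: power2_eq_square field_simps)
    finally show "(\<Sum>i\<in>J. ?\<pi> i * (u i - (\<Sum>j\<in>J. t j * u j))\<^sup>2) \<le> card J / 4 * (\<Sum>j\<in>J. (u j)\<^sup>2)" .
  qed
next
  case False
  define n where "n = real (card J)"
  have n: "n \<ge> 3" using False J(2) by (simp add: n_def)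
  show ?thesis
  proof
    show "1 / n \<ge> 0" using n by simp
    show "(\<Sum>j\<in>J. 1 / n) = 1" using n by (simp add: n_def)
    fix u :: "'i \<Rightarrow> real"
    let ?\<tau> = "\<Sum>j\<in>J. t j * u j" and ?U = "\<Sum>j\<in>J. (u j)\<^sup>2" and ?m = "(\<Sum>j\<in>J. u j) / n"
    have "(\<Sum>i\<in>J. 1 / n * (u i - c)\<^sup>2) = ?U / n - 2 * c * ?m + c\<^sup>2" for c
    proof -
      have "(\<Sum>i\<in>J. (u i - c)\<^sup>2) = ?U - 2 * c * (\<Sum>j\<in>J. u j) + n * c\<^sup>2" for c
        by (simp add: power2_diff sum.distrib sum_subtractf n_def mult_ac
            flip: sum_distrib_left sum_distrib_right)
      then have "(\<Sum>i\<in>J. 1 / n * (u i - c)\<^sup>2) = (?U - 2 * c * (\<Sum>j\<in>J. u j) + n * c\<^sup>2) / n"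
        by (simp flip: sum_divide_distrib)
      then show ?thesis using n by (simp add: field_simps)
    qed
    then have "(\<Sum>i\<in>J. 1 / n * (u i - ?\<tau>)\<^sup>2) = ?U / n - 2 * ?\<tau> * ?m + ?\<tau>\<^sup>2" .
    also have "\<dots> \<le> ?U / n + (?m - ?\<tau>)\<^sup>2"
    proof -
      have "x - 2 * y * m + y\<^sup>2 \<le> x + (m - y)\<^sup>2" for x y m :: real
        by (simp add: power2_diff algebra_simps)
      then show ?thesis .
    qed
    also have "?m - ?\<tau> = (\<Sum>j\<in>J. (1 / n - t j) * u j)"
      by (simp add: left_diff_distrib sum_subtractf sum_divide_distrib)
    also have "?U / n + (\<Sum>j\<in>J. (1 / n - t j) * u j)\<^sup>2 \<le> ?U / n + (\<Sum>j\<in>J. (1 / n - t j)\<^sup>2) * ?U"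
      by (intro add_left_mono Cauchy_Schwarz_ineq_sum)
    also have "\<dots> \<le> ?U / n + (n / 4 - 1 / n) * ?U"
    proof (intro add_left_mono mult_right_mono)
      \<comment> \<open>Here \<open>n \<ge> 3\<close> enters: for \<open>n = 2\<close> and
        \<open>t j = 0\<close> the summands would have to satisfy \<open>1 / 4 \<le> 0\<close>, so
        equal weights do not suffice for two indices.\<close>
      have "(\<Sum>j\<in>J. (1 / n - t j)\<^sup>2) \<le> (\<Sum>j\<in>J. 1 / 4 - (1 / n)\<^sup>2)"
      proof (rule sum_mono)
        fix j assume "j \<in> J"
        then have tj: "0 \<le> t j" "t j \<le> 1 / 2" using t by auto
        have n3: "1 / n \<le> 1 / 3" using n by (simp add: field_simps)
        have "(1 / n - t j)\<^sup>2 = (1 / n)\<^sup>2 - t j * (2 / n - t j)"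
          by (simp add: power2_eq_square algebra_simps)
        also have "\<dots> \<le> 1 / 4 - (1 / n)\<^sup>2"
        proof -
          define k where "k = 1 / n"
          have k: "0 \<le> k" "k \<le> 1 / 3" using n n3 by (auto simp: k_def)
          have "t j * (t j - 2 * k) \<le> 1 / 4 - 2 * k\<^sup>2"
          proof (cases "t j \<le> 2 * k")
            case True
            then have "t j * (t j - 2 * k) \<le> 0" using tj by (simp add: mult_nonneg_nonpos)
            moreover have "k\<^sup>2 \<le> (1 / 3)\<^sup>2" using k by (intro power_mono) auto
            ultimately show ?thesis by (simp add: power2_eq_square)
          next
            case False
            then have "t j * (t j - 2 * k) \<le> 1 / 2 * (1 / 2 - 2 * k)"
              using tj by (intro mult_mono) auto
            moreover have "k * k \<le> k * (1 / 3)" using k by (intro mult_left_mono) auto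
            ultimately show ?thesis using k by (simp add: power2_eq_square)
          qed
          then show ?thesis by (simp add: k_def algebra_simps)
        qed
        finally show "(1 / n - t j)\<^sup>2 \<le> 1 / 4 - (1 / n)\<^sup>2" .
      qed
      also have "\<dots> = n / 4 - 1 / n"
        using n by (simp add: n_def[symmetric] power2_eq_square field_simps)
      finally show "(\<Sum>j\<in>J. (1 / n - t j)\<^sup>2) \<le> n / 4 - 1 / n" .
    qed (simp add: sum_nonneg)
    also have "\<dots> = n / 4 * ?U" using n by (simp add: algebra_simps)
    finally show "(\<Sum>i\<in>J. 1 / n * (u i - ?\<tau>)\<^sup>2) \<le> card J / 4 * ?U"
      by (simp add: n_def)
  qed
qed

lemma orthogonal_component:
  fixes w z :: "'a::real_inner"
  assumes "norm z = 1"
  shows "(w - (w \<bullet> z) *\<^sub>R z) \<bullet> z = 0" "(norm (w - (w \<bullet> z) *\<^sub>R z))\<^sup>2 \<le> (norm w)\<^sup>2"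
    "w \<bullet> (y - (y \<bullet> z) *\<^sub>R z) = (w - (w \<bullet> z) *\<^sub>R z) \<bullet> y"
proof -
  have zz: "z \<bullet> z = 1" using assms by (simp add: dot_square_norm)
  show 1: "(w - (w \<bullet> z) *\<^sub>R z) \<bullet> z = 0" by (simp add: inner_diff_left zz)
  have "(norm (w - (w \<bullet> z) *\<^sub>R z))\<^sup>2 = w \<bullet> w - (w \<bullet> z)\<^sup>2"
    unfolding power2_norm_eq_inner
    by (simp add: inner_diff_left inner_diff_right zz inner_commute power2_eq_square)
  then show "(norm (w - (w \<bullet> z) *\<^sub>R z))\<^sup>2 \<le> (norm w)\<^sup>2" by (simp add: power2_norm_eq_inner)
  show "w \<bullet> (y - (y \<bullet> z) *\<^sub>R z) = (w - (w \<bullet> z) *\<^sub>R z) \<bullet> y"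
    by (simp add: inner_diff_left inner_diff_right inner_commute)
qed

section \<open>A zero and the grid point next to it\<close>

context stopped_system
begin

lemma gridI:
  assumes "\<And>i. a $ i * K \<in> \<int>" "\<And>i. \<bar>a $ i\<bar> \<le> 1" "\<bar>a $ j\<bar> = 1"
  shows "a \<in> grid"
  using assms by (auto simp: grid_def)

lemma eta_bounds: "\<eta> > 0" "\<eta> \<le> 1 / 4" "\<eta> * sqrt CARD('n) \<le> 36 / 100"
proof -
  show "\<eta> > 0" "\<eta> \<le> 1 / 4" using K4 by (auto simp: field_simps)
  have "real (8 * CARD('n)) \<le> real (K\<^sup>2)" using K8 by (simp only: of_nat_le_iff)
  then have "(sqrt CARD('n))\<^sup>2 \<le> (36 / 100 * K)\<^sup>2" by (simp add: power_mult_distrib power2_eq_square)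
  then have "sqrt CARD('n) \<le> 36 / 100 * K" by (rule power2_le_imp_le) simp
  then show "\<eta> * sqrt CARD('n) \<le> 36 / 100" using K4 by (simp add: field_simps)
qed

end

text \<open>The point \<open>c\<close> is a zero scaled to the cube surface, \<open>a\<close> is its
  coordinatewise rounding to the grid, and \<open>i0\<close> names a face containing both.\<close>

locale stopped_cell = stopped_system d f K
  for d :: "'n::finite \<Rightarrow> nat" and f :: "'n \<Rightarrow> 'm::finite rpoly" and K +
  fixes a c :: "real^'m" and i0 :: 'm
  assumes a_grid: "a \<in> grid" and c_le: "\<bar>c $ i\<bar> \<le> 1" and c_i0: "\<bar>c $ i0\<bar> = 1" and a_i0: "a $ i0 = c $ i0"
    and ac: "\<bar>a $ i - c $ i\<bar> \<le> 1 / K / 2" and zero: "eval_sys f c = 0"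
begin

abbreviation x :: "real^'m" where "x \<equiv> a /\<^sub>R norm a"

abbreviation z :: "real^'m" where "z \<equiv> c /\<^sub>R norm c"

lemma norm_a: "norm a \<ge> 1"
  by (rule norm_grid_ge_1[OF a_grid])

lemma norm_c: "norm c \<ge> 1"
  by (rule norm_ge_1_of_component[OF c_i0])

lemma norms: "norm x = 1" "norm z = 1"
proof -
  have "norm a > 0" "norm c > 0" using norm_a norm_c by linarith+
  then show "norm x = 1" "norm z = 1" by simp_all
qed

lemma z_zero: "eval_sys f z = 0"
  by (rule eval_sys_scaleR_eq_0[OF zero])

lemma card_J: "card (UNIV - {i0}) = CARD('n)"
  using card by simp

lemma norm_a_minus_c: "norm (a - c) \<le> \<eta> * sqrt CARD('n) / 2"
proof -
  have "(norm (a - c))\<^sup>2 = (\<Sum>i\<in>UNIV - {i0}. (a $ i - c $ i)\<^sup>2)"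
    unfolding norm_vec_sq by (subst sum.remove[of _ i0]) (auto simp: a_i0)
  also have "\<dots> \<le> (\<Sum>i\<in>UNIV - {i0}. (\<eta> / 2)\<^sup>2)"
    using ac eta_bounds(1) by (intro sum_mono) (metis abs_le_square_iff abs_of_pos half_gt_zero)
  also have "\<dots> = (\<eta> * sqrt CARD('n) / 2)\<^sup>2"
    by (simp only: sum_constant card_J) (simp add: power_mult_distrib power_divide)
  finally show ?thesis by (rule power2_le_imp_le) simp
qed

lemma x_vertex: "x \<in> vertices d f \<eta>"
proof (rule in_verticesI[OF a_grid norms(2) z_zero])
  have "norm c > 0" using norm_c by linarith
  then show "norm (a - norm c *\<^sub>R z) \<le> \<eta> * sqrt CARD('n) / 2" using norm_a_minus_c by simp
qed

lemma component_le: "i \<noteq> i0 \<Longrightarrow> 2 * (a $ i)\<^sup>2 \<le> (norm a)\<^sup>2"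
proof -
  assume i: "i \<noteq> i0"
  have "(a $ i)\<^sup>2 \<le> 1" using a_grid by (simp add: grid_def abs_square_le_1)
  moreover have "(a $ i0)\<^sup>2 = 1" using c_i0 a_i0 by (simp add: abs_square_eq_1)
  moreover have "(\<Sum>j\<in>{i, i0}. (a $ j)\<^sup>2) \<le> (norm a)\<^sup>2"
    unfolding norm_vec_sq by (intro sum_mono2) auto
  ultimately show ?thesis using i by simp
qed

text \<open>In units of \<open>\<eta>\<close> the distances to \<open>c\<close> are at most
  \<open>sqrt n / 2\<close> and \<open>1 + sqrt n / 2\<close>, so the condition of
  \<open>neighbour_forces_zero\<close> becomes \<open>81 / 80 * sqrt n + 9 / 10 < 7\<close>, which
  holds for \<open>sqrt n \<le> 5\<close>.\<close>

lemma unit_step: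
  assumes n: "CARD('n) \<le> 25" and b: "a + s *\<^sub>R axis i 1 \<in> grid" and s: "\<bar>s\<bar> = \<eta>"
    and ai: "2 * (a $ i)\<^sup>2 \<le> (norm a)\<^sup>2"
    and y: "(a + s *\<^sub>R axis i 1) /\<^sub>R norm (a + s *\<^sub>R axis i 1) \<in> vertices d f \<eta>"
  shows "zeta x = z"
proof -
  define q where "q = \<eta> * sqrt CARD('n)"
  note eta = eta_bounds(1,2) eta_bounds(3)[folded q_def]
  have q0: "q \<ge> 0" by (simp add: q_def)
  note nac = norm_a_minus_c[folded q_def]
  show ?thesis
  proof (rule neighbour_forces_zero[OF a_grid b refl _ _ ai x_vertex y norm_c zero nac])
    have "norm (a + s *\<^sub>R axis i 1 - c) \<le> norm (s *\<^sub>R axis i 1 :: real^'m) + norm (a - c)"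
      using norm_triangle_ineq[of "s *\<^sub>R axis i 1" "a - c"] by (simp add: algebra_simps)
    moreover have "norm (s *\<^sub>R axis i 1 :: real^'m) = \<bar>s\<bar>" by simp
    ultimately show "norm (a + s *\<^sub>R axis i 1 - c) \<le> \<eta> + q / 2"
      using nac s by linarith
    show "\<bar>s\<bar> \<le> 1 / 4" "\<bar>s\<bar> \<le> \<eta> * sqrt CARD('n)"
      using eta s mult_left_mono[of 1 "sqrt CARD('n)" \<eta>] by auto
    have "(q / 2)\<^sup>2 \<le> (18 / 100)\<^sup>2" by (rule power_mono) (use eta q0 in linarith)+
    then show "(q / 2)\<^sup>2 \<le> 1 / 5" by (simp add: power2_eq_square)
    have "\<eta> + q / 2 \<le> 43 / 100" "0 \<le> \<eta> + q / 2" using eta q0 by linarith+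
    then have "(\<eta> + q / 2)\<^sup>2 \<le> (43 / 100)\<^sup>2" by (rule power_mono)
    then show "(\<eta> + q / 2)\<^sup>2 \<le> 1 / 5" by (rule order_trans) (simp add: power2_eq_square)
    have "sqrt CARD('n) \<le> 5" using n by (intro real_le_lsqrt) (auto simp flip: of_nat_le_iff)
    then have "q \<le> \<eta> * 5" unfolding q_def using eta by (intro mult_left_mono) auto
    then show "9 / 10 * (5 / 4 * (q / 2) + (\<eta> + q / 2)) < 7 * \<bar>s\<bar>"
    proof -
      have "9 / 10 * (5 / 4 * (q / 2) + (e + q / 2)) < 7 * e" if "q \<le> e * 5" "e > 0" for e
      proof -
        have "9 / 10 * (5 / 4 * (q / 2) + (e + q / 2)) = 81 / 80 * q + 9 / 10 * e"
          by (simp add: field_simps)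
        then show ?thesis using that by linarith
      qed
      then show ?thesis using s eta(1) \<open>q \<le> \<eta> * 5\<close> by metis
    qed
  qed
qed

text \<open>If \<open>zeta x\<close> is not \<open>z\<close>, then \<open>a\<close> is within
  \<open>45 / 1000 * q\<close> of the line through \<open>zeta x\<close>. A step of at most
  \<open>45 / 100 * q\<close> stays inside the radius \<open>q / 2\<close> of
  \<open>in_verticesI\<close>, applied at \<open>zeta x\<close> instead of \<open>z\<close>.
  Rounding \<open>sqrt n / 4\<close> up adds less than 1, which \<open>sqrt n \<ge> 5\<close> keeps
  within 45/100.\<close>

lemma large_case:
  assumes n: "CARD('n) \<ge> 25"
  shows "zeta x = z"
proof (rule ccontr)
  assume ne: "zeta x \<noteq> z"
  define q where "q = \<eta> * sqrt CARD('n)"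
  note eta = eta_bounds(1,2) eta_bounds(3)[folded q_def]
  note nac = norm_a_minus_c[folded q_def]
  have n5: "sqrt CARD('n) \<ge> 5"
    using n by (intro real_le_rsqrt) (auto simp flip: of_nat_le_iff)
  define k where "k = \<lceil>sqrt CARD('n) / 4\<rceil>"
  have k: "sqrt CARD('n) / 4 \<le> k" "k \<le> 45 / 100 * sqrt CARD('n)"
    using n5 ceiling_correct[of "sqrt CARD('n) / 4"] by (auto simp: k_def)
  have k\<eta>: "q / 4 \<le> k * \<eta>" "k * \<eta> \<le> 45 / 100 * q"
    using mult_left_mono[OF k(1), of \<eta>] mult_left_mono[OF k(2), of \<eta>] eta by (auto simp: mult_ac q_def)
  have "card (UNIV - {i0}) \<noteq> 0" using card_J n by simp
  then obtain i where i: "i \<noteq> i0" by (metis Diff_iff card.empty ex_in_conv singletonI)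
  \<comment> \<open>The sign points towards the middle of the face, so the step cannot leave the
    cube.\<close>
  define s where "s = (if a $ i \<le> 0 then k * \<eta> else - (k * \<eta>))"
  define b where "b = a + s *\<^sub>R axis i 1"
  have "real_of_int k \<ge> 0" using k(1) n5 by linarith
  then have s: "\<bar>s\<bar> = k * \<eta>" by (simp add: s_def)
  have q0: "q > 0" using eta by (simp add: q_def)
  have b_i: "b $ j = (if j = i then a $ i + s else a $ j)" for j
    by (simp add: b_def axis_def)
  have b_grid: "b \<in> grid"
  proof -
    have "(a $ i + s) * K \<in> \<int>"
    proof -
      have "(a $ i + s) * K = a $ i * K + real_of_int (if a $ i \<le> 0 then k else - k)"
        using K4 by (auto simp: s_def field_simps)
      then show ?thesis using a_grid by (simp add: grid_def)
    qed
    moreover have "\<bar>a $ i + s\<bar> \<le> 1"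
    proof -
      have "\<bar>a $ i\<bar> \<le> 1" using a_grid by (simp add: grid_def)
      moreover have "\<bar>s\<bar> \<le> 1" unfolding s using k\<eta>(2) eta(3) by linarith
      moreover have "a $ i \<le> 0 \<Longrightarrow> s \<ge> 0" "\<not> a $ i \<le> 0 \<Longrightarrow> s \<le> 0"
        using \<open>real_of_int k \<ge> 0\<close> by (auto simp: s_def)
      ultimately show ?thesis by linarith
    qed
    moreover have "\<bar>b $ i0\<bar> = 1" using i a_i0 c_i0 by (simp add: b_i)
    ultimately show ?thesis
      by (intro gridI[of _ i0]) (use a_grid in \<open>auto simp: b_i grid_def\<close>)
  qed
  have xA: "x \<in> A_set d f" using x_vertex by (simp add: vertices_def)
  have q5: "(q / 2)\<^sup>2 \<le> 1 / 5"
  proof -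
    have "(q / 2)\<^sup>2 \<le> (18 / 100)\<^sup>2" by (rule power_mono) (use eta q0 in linarith)+
    then show ?thesis by (simp add: power2_eq_square)
  qed
  note g = norm_gnomonic_le[OF norm_a norm_c nac q5]
  have a0: "norm a > 0" using norm_a by linarith
  have "norm (x - zeta x) \<le> 8 / 100 * norm (gnomonic x z)"
    using radius_le_of_other_zero[OF xA norms(2) z_zero g(1)] zeta(4)[OF xA] ne by auto
  also have "\<dots> \<le> 8 / 100 * (9 / 8 * (q / 2) / norm a)"
    using g(2) by (rule mult_left_mono) simp
  finally have "norm a * norm (x - zeta x) \<le> norm a * (8 / 100 * (9 / 8 * (q / 2) / norm a))"
    using a0 by (intro mult_left_mono) auto
  also have "\<dots> = 45 / 1000 * q" using a0 by simp
  finally have az: "norm a * norm (x - zeta x) \<le> 45 / 1000 * q" .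
  have "a - norm a *\<^sub>R zeta x = norm a *\<^sub>R (x - zeta x)"
    using a0 by (simp add: scaleR_right_diff_distrib)
  then have az': "norm (a - norm a *\<^sub>R zeta x) \<le> 45 / 1000 * q"
    using az by simp
  have y: "b /\<^sub>R norm b \<in> vertices d f \<eta>"
  proof (rule in_verticesI[OF b_grid zeta(3)[OF xA] zeta(2)[OF xA]])
    have "norm (b - norm a *\<^sub>R zeta x) \<le> norm (s *\<^sub>R axis i 1 :: real^'m) + norm (a - norm a *\<^sub>R zeta x)"
      using norm_triangle_ineq[of "s *\<^sub>R axis i 1" "a - norm a *\<^sub>R zeta x"] by (simp add: b_def algebra_simps)
    moreover have "norm (s *\<^sub>R axis i 1 :: real^'m) = \<bar>s\<bar>" by simp
    ultimately show "norm (b - norm a *\<^sub>R zeta x) \<le> \<eta> * sqrt CARD('n) / 2"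
      unfolding q_def[symmetric] using az' s k\<eta> q0 by linarith
  qed
  have "zeta x = z"
  proof (rule neighbour_forces_zero[OF a_grid b_grid b_def _ _ component_le[OF i] x_vertex y norm_c zero nac q5])
    show "\<bar>s\<bar> \<le> 1 / 4" "\<bar>s\<bar> \<le> \<eta> * sqrt CARD('n)"
      unfolding q_def[symmetric] using s k\<eta> eta q0 by linarith+
    have "norm (b - c) \<le> norm (s *\<^sub>R axis i 1 :: real^'m) + norm (a - c)"
      using norm_triangle_ineq[of "s *\<^sub>R axis i 1" "a - c"] by (simp add: b_def algebra_simps)
    moreover have "norm (s *\<^sub>R axis i 1 :: real^'m) = \<bar>s\<bar>" by simp
    ultimately show "norm (b - c) \<le> 95 / 100 * q"
      using nac s k\<eta> by linarith
    have "(95 / 100 * q)\<^sup>2 \<le> (35 / 100)\<^sup>2" by (rule power_mono) (use eta q0 in linarith)+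
    then show "(95 / 100 * q)\<^sup>2 \<le> 1 / 5" by (simp add: power2_eq_square)
    show "9 / 10 * (5 / 4 * (q / 2) + 95 / 100 * q) < 7 * \<bar>s\<bar>"
    proof -
      have "q / 4 \<le> \<bar>s\<bar>" using k\<eta>(1) s by simp
      moreover have "9 / 10 * (5 / 4 * (q / 2) + 95 / 100 * q) = 567 / 400 * q" by simp
      ultimately show ?thesis using q0 by linarith
    qed
  qed
  with ne show False by simp
qed

text \<open>For \<open>v\<close> orthogonal to \<open>c\<close> one has \<open>v \<bullet> (b i - c)
  = \<eta> * (u i - (\<Sum>j. t j * u j))\<close>, the form treated in
  \<open>cell_weights_exist\<close>. The resulting \<open>?L\<close> makes \<open>D * ?L\<close>
  equal to the square of the threshold in the second stopping condition, so a weighted mean not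
  above it puts one neighbour not above it.\<close>

lemma medium_case:
  assumes n: "CARD('n) \<ge> 2" "CARD('n) \<le> 25"
  shows "zeta x = z"
proof -
  let ?J = "UNIV - {i0}"
  note eta = eta_bounds
  define t where "t = (\<lambda>j. \<bar>c $ j - a $ j\<bar> * K)"
  \<comment> \<open>The direction from \<open>a\<close> towards \<open>c\<close>. In case of a tie
    it points inwards, so that \<open>b j\<close> does not leave the cube when \<open>a $ j\<close>
    is 1 or -1.\<close>
  define \<sigma> where "\<sigma> = (\<lambda>j. if a $ j < c $ j \<or> a $ j = c $ j \<and> a $ j \<le> 0 then 1 else - 1 :: real)"
  define b where "b = (\<lambda>j. a + (\<sigma> j * \<eta>) *\<^sub>R axis j 1)"
  define y where "y = (\<lambda>j. b j /\<^sub>R norm (b j))"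
  have t: "0 \<le> t j \<and> t j \<le> 1 / 2" for j
    using ac[of j] K4 by (simp add: t_def abs_minus_commute field_simps)
  have ct: "a $ j - c $ j = - \<sigma> j * \<eta> * t j" for j
    using K4 by (auto simp: t_def \<sigma>_def)
  have \<sigma>2: "(\<sigma> j)\<^sup>2 = 1" "\<bar>\<sigma> j\<bar> = 1" for j by (auto simp: \<sigma>_def)
  have b_i: "b j $ l = (if l = j then a $ j + \<sigma> j * \<eta> else a $ l)" for j l
    by (simp add: b_def axis_def)
  have b_grid: "b j \<in> grid" if j: "j \<in> ?J" for j
  proof -
    have "a $ j * K \<in> \<int>" using a_grid by (simp add: grid_def)
    then obtain p where p: "a $ j * K = real_of_int p" by (rule Ints_cases)
    then have aj: "a $ j = p / K" using K4 by (simp add: field_simps)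
    have "\<bar>a $ j\<bar> \<le> 1" using a_grid by (simp add: grid_def)
    then have ap: "\<bar>real_of_int p\<bar> \<le> K" unfolding aj using K4 by (simp add: abs_divide)
    define r where "r = (if \<sigma> j = 1 then p + 1 else p - 1)"
    have r: "a $ j + \<sigma> j * \<eta> = r / K"
      using \<sigma>2[of j] by (auto simp: r_def aj abs_if diff_divide_distrib add_divide_distrib split: if_splits)
    have "\<bar>r\<bar> \<le> int K"
    proof (cases "\<sigma> j = 1")
      case True
      have "p < int K"
      proof (cases "a $ j < c $ j")
        case True
        then have "a $ j < 1" using c_le[of j] by linarith
        then show ?thesis using K4 by (simp add: aj)
      next
        case False
        then have "a $ j \<le> 0" using \<open>\<sigma> j = 1\<close> by (auto simp: \<sigma>_def split: if_splits)
        then show ?thesis using K4 by (simp add: aj divide_le_0_iff)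
      qed
      then show ?thesis using True ap by (simp add: r_def)
    next
      case False
      have "p > - int K"
      proof (cases "c $ j < a $ j")
        case True
        then have "a $ j > - 1" using c_le[of j] by linarith
        then have "- real K < p" using K4 by (simp add: aj field_simps)
        then show ?thesis by linarith
      next
        case False
        then have "a $ j > 0" using \<open>\<sigma> j \<noteq> 1\<close> by (auto simp: \<sigma>_def split: if_splits)
        then show ?thesis using K4 by (simp add: aj zero_less_divide_iff)
      qed
      then show ?thesis using False ap by (simp add: r_def)
    qed
    then have "\<bar>real_of_int r\<bar> \<le> K" by linarith
    then have "\<bar>a $ j + \<sigma> j * \<eta>\<bar> \<le> 1" unfolding r using K4 by (simp add: abs_divide)
    moreover have "(a $ j + \<sigma> j * \<eta>) * K \<in> \<int>" unfolding r using K4 by simp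
    moreover have "\<bar>b j $ i0\<bar> = 1" using j a_i0 c_i0 by (simp add: b_i)
    ultimately show ?thesis
      by (intro gridI[of _ i0]) (use a_grid in \<open>auto simp: b_i grid_def\<close>)
  qed
  have b1: "norm (b j) \<ge> 1" if "j \<in> ?J" for j by (rule norm_grid_ge_1[OF b_grid[OF that]])
  obtain \<pi> where \<pi>: "\<And>j. j \<in> ?J \<Longrightarrow> \<pi> j \<ge> 0" "sum \<pi> ?J = 1"
    "\<And>u. (\<Sum>i\<in>?J. \<pi> i * (u i - (\<Sum>j\<in>?J. t j * u j))\<^sup>2) \<le> card ?J / 4 * (\<Sum>j\<in>?J. (u j)\<^sup>2)"
    using cell_weights_exist[of ?J t] t n(1) unfolding card_J by auto
  let ?L = "\<eta>\<^sup>2 * CARD('n) / 4"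
  have proj: "(\<Sum>i\<in>?J. \<pi> i * (w \<bullet> (y i - (y i \<bullet> z) *\<^sub>R z))\<^sup>2) \<le> ?L * (norm w)\<^sup>2" for w
  proof -
    define v where "v = w - (w \<bullet> z) *\<^sub>R z"
    define u where "u = (\<lambda>j. \<sigma> j * v $ j)"
    have vz: "v \<bullet> z = 0" and vw: "(norm v)\<^sup>2 \<le> (norm w)\<^sup>2"
      unfolding v_def by (rule orthogonal_component[OF norms(2)])+
    have vc: "v \<bullet> c = 0"
      using vz norm_c by auto
    have "(w \<bullet> (y i - (y i \<bullet> z) *\<^sub>R z))\<^sup>2 \<le> (\<eta> * (u i - (\<Sum>j\<in>?J. t j * u j)))\<^sup>2" if i: "i \<in> ?J" for i
    proof -
      have "w \<bullet> (y i - (y i \<bullet> z) *\<^sub>R z) = v \<bullet> y i"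
        unfolding v_def by (rule orthogonal_component(3)[OF norms(2)])
      also have "\<dots> = (v \<bullet> (b i - c)) / norm (b i)"
        by (simp add: y_def inner_diff_right vc divide_inverse mult.commute)
      also have "v \<bullet> (b i - c) = (\<Sum>l\<in>?J. v $ l * (b i $ l - c $ l))"
        unfolding inner_vec_def using i by (subst sum.remove[of _ i0]) (auto simp: b_i a_i0)
      also have "\<dots> = (\<Sum>l\<in>?J. (if l = i then v $ l * (\<sigma> l * \<eta>) else 0) - \<eta> * (t l * u l))"
      proof (rule sum.cong[OF refl])
        fix l
        have e: "b i $ l - c $ l = (if l = i then \<sigma> l * \<eta> else 0) + (a $ l - c $ l)" by (simp add: b_i)
        then show "v $ l * (b i $ l - c $ l) = (if l = i then v $ l * (\<sigma> l * \<eta>) else 0) - \<eta> * (t l * u l)"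
          unfolding e ct u_def by (simp add: algebra_simps)
      qed
      also have "\<dots> = \<eta> * (u i - (\<Sum>j\<in>?J. t j * u j))"
        using i by (simp add: sum_subtractf u_def right_diff_distrib sum_distrib_left mult_ac)
      finally have "(w \<bullet> (y i - (y i \<bullet> z) *\<^sub>R z))\<^sup>2 = (\<eta> * (u i - (\<Sum>j\<in>?J. t j * u j)))\<^sup>2 / (norm (b i))\<^sup>2"
        by (simp only: power_divide)
      also have "\<dots> \<le> (\<eta> * (u i - (\<Sum>j\<in>?J. t j * u j)))\<^sup>2 / 1"
        using b1[OF i] by (intro divide_left_mono) auto
      finally show ?thesis by simp
    qed
    then have "(\<Sum>i\<in>?J. \<pi> i * (w \<bullet> (y i - (y i \<bullet> z) *\<^sub>R z))\<^sup>2)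
        \<le> (\<Sum>i\<in>?J. \<pi> i * (\<eta> * (u i - (\<Sum>j\<in>?J. t j * u j)))\<^sup>2)"
      using \<pi>(1) by (intro sum_mono mult_left_mono) auto
    also have "\<dots> = \<eta>\<^sup>2 * (\<Sum>i\<in>?J. \<pi> i * (u i - (\<Sum>j\<in>?J. t j * u j))\<^sup>2)"
      unfolding sum_distrib_left by (intro sum.cong refl) (simp only: power_mult_distrib mult_ac)
    also have "\<dots> \<le> \<eta>\<^sup>2 * (card ?J / 4 * (\<Sum>j\<in>?J. (u j)\<^sup>2))"
      by (intro mult_left_mono \<pi>(3)) simp
    also have "(\<Sum>j\<in>?J. (u j)\<^sup>2) = (\<Sum>j\<in>?J. (v $ j)\<^sup>2)"
      by (simp add: u_def power_mult_distrib \<sigma>2)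
    also have "\<eta>\<^sup>2 * (card ?J / 4 * (\<Sum>j\<in>?J. (v $ j)\<^sup>2)) \<le> \<eta>\<^sup>2 * (card ?J / 4 * (norm v)\<^sup>2)"
      unfolding norm_vec_sq by (intro mult_left_mono sum_mono2) auto
    also have "\<dots> \<le> \<eta>\<^sup>2 * (card ?J / 4 * (norm w)\<^sup>2)"
      by (intro mult_left_mono vw) auto
    finally show ?thesis unfolding card_J by simp
  qed
  have S: "(\<Sum>i\<in>?J. \<pi> i * (norm (eval_sys f (y i)))\<^sup>2) \<le> D * ?L"
  proof (rule weighted_norms_bound[OF norms(2) z_zero _ \<pi>(1) _ _ proj])
    show "norm (y i) = 1" if "i \<in> ?J" for i
    proof -
      have "norm (b i) > 0" using b1[OF that] by linarith
      then show ?thesis by (simp add: y_def)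
    qed
  qed auto
  have "\<exists>i\<in>?J. (norm (eval_sys f (y i)))\<^sup>2 \<le> D * ?L"
  proof (rule ccontr)
    assume "\<not> ?thesis"
    then have gt: "D * ?L < (norm (eval_sys f (y i)))\<^sup>2" if "i \<in> ?J" for i
      using that by (meson not_le)
    obtain i where i: "i \<in> ?J" "\<pi> i > 0"
    proof -
      have "\<exists>i\<in>?J. \<pi> i \<noteq> 0" using \<pi>(2) by (metis sum.neutral zero_neq_one)
      then show ?thesis using \<pi>(1) that by force
    qed
    have "D * ?L = (\<Sum>i\<in>?J. \<pi> i * (D * ?L))"
      by (simp only: sum_distrib_right[symmetric] \<pi>(2) mult_1)
    also have "\<dots> < (\<Sum>i\<in>?J. \<pi> i * (norm (eval_sys f (y i)))\<^sup>2)"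
    proof (rule sum_strict_mono_ex1)
      show "\<forall>i\<in>?J. \<pi> i * (D * ?L) \<le> \<pi> i * (norm (eval_sys f (y i)))\<^sup>2"
        using \<pi>(1) gt by (intro ballI mult_left_mono) (auto intro: less_imp_le)
      show "\<exists>i\<in>?J. \<pi> i * (D * ?L) < \<pi> i * (norm (eval_sys f (y i)))\<^sup>2"
        using i gt by (intro bexI[of _ i] mult_strict_left_mono) auto
    qed simp
    finally show False using S by simp
  qed
  then obtain i where i: "i \<in> ?J" and v: "(norm (eval_sys f (y i)))\<^sup>2 \<le> D * ?L" by blast
  note v
  also have "D * ?L = (\<eta> * sqrt (real CARD('n) * D) / 2)\<^sup>2"
    by (simp add: power_mult_distrib power_divide real_sqrt_mult)
  finally have "norm (eval_sys f (y i)) \<le> \<eta> * sqrt (real CARD('n) * D) / 2"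
    by (rule power2_le_imp_le) simp
  then have "b i /\<^sub>R norm (b i) \<in> vertices d f \<eta>"
    unfolding y_def by (rule in_vertices[OF b_grid[OF i]])
  then show ?thesis
    using unit_step[OF n(2), of "\<sigma> i * \<eta>" i] b_grid[OF i] component_le[of i] i \<sigma>2(2)[of i] eta(1)
    by (simp add: b_def abs_mult)
qed

end

section \<open>A single equation\<close>

lemma exp_minus_ge_cubic:
  fixes t :: real
  shows "1 - t + t\<^sup>2 / 2 - t ^ 3 / 6 \<le> exp (- t)"
proof -
  obtain s where "exp (- t) = (\<Sum>m<4. (- t) ^ m / fact m) + exp s / fact 4 * (- t) ^ 4"
    using Maclaurin_exp_le[of "- t" 4] by blast
  moreover have "exp s / fact 4 * (- t) ^ 4 \<ge> 0" by simp
  ultimately show ?thesis by (simp add: eval_nat_numeral field_simps)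
qed

text \<open>The range is dictated by \<open>two_zeros_bound\<close>, where
  \<open>W \<le> 4557 / 10000 * u\<close> and \<open>u < 2\<close>.\<close>

lemma exp_remainder_le:
  fixes x :: real
  assumes "0 \<le> x" "x \<le> 92 / 100"
  shows "exp x - 1 - x \<le> 8 / 10 * x\<^sup>2"
proof -
  have x2: "x\<^sup>2 \<le> (92 / 100)\<^sup>2" using assms by (intro power_mono) auto
  obtain s where s: "\<bar>s\<bar> \<le> \<bar>x\<bar>" "exp x = (\<Sum>m<4. x ^ m / fact m) + exp s / fact 4 * x ^ 4"
    using Maclaurin_exp_le[of x 4] by blast
  have "exp s \<le> exp x" using s(1) assms by simp
  also have "exp x \<le> 1 + x + x\<^sup>2" using assms by (intro exp_bound) auto
  also have "\<dots> \<le> 28 / 10" using assms x2 by (simp add: power2_eq_square)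
  finally have "exp s / fact 4 * x ^ 4 \<le> (28 / 10) / 24 * x ^ 4"
    by (intro mult_right_mono) (auto simp: fact_numeral)
  then have "exp x - 1 - x \<le> x\<^sup>2 * (1 / 2 + x / 6 + 28 / 240 * x\<^sup>2)"
    using s(2) by (simp add: eval_nat_numeral field_simps)
  also have "\<dots> \<le> x\<^sup>2 * (8 / 10)"
    using assms x2 by (intro mult_left_mono) (auto simp: power2_eq_square)
  finally show ?thesis by simp
qed

lemma exp_minus_ge_tangent:
  fixes t :: real
  assumes "0 \<le> \<beta>" "\<beta> \<le> exp (- c)" "t \<le> 1 + c"
  shows "\<beta> * (1 + c - t) \<le> exp (- t)"
proof -
  have "\<beta> * (1 + c - t) = \<beta> * (1 + (c - t))" by (simp only: add_diff_eq)
  also have "\<dots> \<le> exp (- c) * (1 + (c - t))"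
    by (rule mult_right_mono) (use assms in auto)
  also have "\<dots> \<le> exp (- c) * exp (c - t)" by (intro mult_left_mono exp_ge_add_one_self) simp
  finally show ?thesis by (simp flip: exp_add)
qed

lemma exp_minus_1_ge: "3676 / 10000 \<le> exp (- 1 :: real)"
  using e_less_272 by (simp add: exp_minus field_simps)

lemma exp_minus_3_halves_ge: "2228 / 10000 \<le> exp (- (3 / 2) :: real)"
proof -
  have "(2228 / 10000)\<^sup>2 \<le> (3676 / 10000 :: real) ^ 3" by (simp add: power2_eq_square power3_eq_cube)
  also have "\<dots> \<le> exp (- 1) ^ 3" by (intro power_mono exp_minus_1_ge) simp
  also have "\<dots> = (exp (- (3 / 2)))\<^sup>2" by (simp flip: exp_of_nat_mult)
  finally show ?thesis by (rule power2_le_imp_le) simp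
qed

text \<open>The quotient of the two sides without the constant peaks at about 0.407 near
  \<open>t = 1.26\<close>. On the four ranges the lower bounds for \<open>exp (- t)\<close> are the
  tangents at 0, 1 and 3/2, and 0.\<close>

lemma one_minus_exp_sq_le:
  fixes t :: real
  assumes "0 \<le> t"
  shows "(1 - exp (- t))\<^sup>2 \<le> 42 / 100 * t"
proof -
  have 0: "0 \<le> 1 - exp (- t)" using assms by simp
  have le: "(1 - exp (- t))\<^sup>2 \<le> h\<^sup>2" if "1 - exp (- t) \<le> h" for h
    using that 0 by (intro power_mono) auto
  consider "t \<le> 42 / 100" | "42 / 100 \<le> t" "t \<le> 122 / 100" | "122 / 100 \<le> t" "t \<le> 24 / 10" | "24 / 10 \<le> t"
    by linarith
  then show ?thesis
  proof cases
    case 1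
    have "(1 - exp (- t))\<^sup>2 \<le> t\<^sup>2" using exp_ge_add_one_self[of "- t"] by (intro le) simp
    also have "\<dots> \<le> 42 / 100 * t" using mult_right_mono[OF 1 assms] by (simp add: power2_eq_square)
    finally show ?thesis .
  next
    case 2
    have "(1 - exp (- t))\<^sup>2 \<le> (1 - 3676 / 10000 * (1 + 1 - t))\<^sup>2"
      using exp_minus_ge_tangent[OF _ exp_minus_1_ge, of t] 2 by (intro le) simp
    also have "\<dots> \<le> 42 / 100 * t"
    proof -
      have "0 \<le> (t - 42 / 100) * (122 / 100 - t)" using 2 by simp
      then show ?thesis using 2 by (simp add: power2_eq_square field_simps)
    qed
    finally show ?thesis .
  next
    case 3
    have "(1 - exp (- t))\<^sup>2 \<le> (1 - 2228 / 10000 * (1 + 3 / 2 - t))\<^sup>2"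
      using exp_minus_ge_tangent[OF _ exp_minus_3_halves_ge, of t] 3 by (intro le) simp
    also have "\<dots> \<le> 42 / 100 * t"
    proof -
      have "0 \<le> (t - 122 / 100) * (24 / 10 - t)" using 3 by simp
      then show ?thesis using 3 by (simp add: power2_eq_square field_simps)
    qed
    finally show ?thesis .
  next
    case 4
    have "(1 - exp (- t))\<^sup>2 \<le> 1\<^sup>2" by (intro le) simp
    with 4 show ?thesis by simp
  qed
qed

text \<open>The left side is decreasing in \<open>G\<close>, so it suffices to insert polynomial
  lower bounds for \<open>exp (- t)\<close>: a truncated series for \<open>t \<le> 1\<close>, the
  tangent at 3/2 beyond.\<close>

lemma odd_case_inequality:
  fixes t G :: real
  assumes t: "0 \<le> t" "t \<le> 2" and G: "exp (- t) \<le> G"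
  shows "1 / 2 - (1 - t / 16) * G\<^sup>2 / 2 - t * G * (1 - 37 / 100 * t) \<le> t / 4"
proof -
  have mono: "1 / 2 - (1 - t / 16) * G\<^sup>2 / 2 - t * G * (1 - 37 / 100 * t)
      \<le> 1 / 2 - (1 - t / 16) * h\<^sup>2 / 2 - t * h * (1 - 37 / 100 * t)" if "0 \<le> h" "h \<le> exp (- t)" for h
  proof -
    have "h\<^sup>2 \<le> G\<^sup>2" using that G by (intro power_mono) auto
    then have "(1 - t / 16) * h\<^sup>2 \<le> (1 - t / 16) * G\<^sup>2" using t by (intro mult_left_mono) auto
    moreover have "t * h * (1 - 37 / 100 * t) \<le> t * G * (1 - 37 / 100 * t)"
      using that G t by (intro mult_right_mono mult_left_mono) auto
    moreover have "1 / 2 - a / 2 - b \<le> 1 / 2 - a' / 2 - b'" if "a' \<le> a" "b' \<le> b" for a a' b b' :: real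
      using that by simp
    ultimately show ?thesis by blast
  qed
  show ?thesis
  proof (cases "t \<le> 1")
    case True
    define s where "s = 1 - t"
    have s: "0 \<le> s" "s \<le> 1" "t = 1 - s" using True t by (auto simp: s_def)
    \<comment> \<open>Since \<open>h + t = 1 + t^2 / 3\<close>, the main part
      \<open>1 / 2 - h^2 / 2 - t * h\<close> equals \<open>t^2 / 6 - t^4 / 18\<close> and has no
      linear term.\<close>
    define h where "h = 1 - t + t\<^sup>2 / 3"
    have "t\<^sup>2 * t \<le> t\<^sup>2 * 1" using True by (intro mult_left_mono) auto
    then have "h \<le> 1 - t + t\<^sup>2 / 2 - t ^ 3 / 6" by (simp add: h_def power2_eq_square power3_eq_cube)
    then have hq: "h \<le> exp (- t)" using exp_minus_ge_cubic[of t] by simp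
    have h0: "0 \<le> h" "h \<le> 1" using True t mult_left_le[of t t] by (auto simp: h_def power2_eq_square)
    have "1 / 2 - (1 - t / 16) * h\<^sup>2 / 2 - t * h * (1 - 37 / 100 * t)
        = t * (t * (1 / 6 - t\<^sup>2 / 18 + 37 / 100 * h) + h\<^sup>2 / 32)"
      by (simp add: h_def power2_eq_square field_simps)
    also have "\<dots> \<le> t * (1 / 4)"
    proof (intro mult_left_mono)
      have "h\<^sup>2 \<le> h" using h0 by (simp add: power2_eq_square mult_left_le)
      then have "t * (1 / 6 - t\<^sup>2 / 18 + 37 / 100 * h) + h\<^sup>2 / 32
          \<le> t * (1 / 6 - t\<^sup>2 / 18 + 37 / 100 * h) + h / 32" by simp
      also have "\<dots> \<le> 1 / 4"
      proof -
        have e: "1 / 4 - (t * (1 / 6 - t\<^sup>2 / 18 + 37 / 100 * h) + h / 32)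
            = (10656 - 21600 * s + 324000 * s\<^sup>2 + 140544 * s ^ 3) / 2073600"
          unfolding h_def s(3) by (simp add: power2_eq_square power3_eq_cube field_simps)
        have "0 \<le> 10656 - 21600 * s + 324000 * s\<^sup>2"
          using zero_le_power2[of "s - 1 / 20"] s by (simp add: power2_eq_square field_simps)
        then have "0 \<le> (10656 - 21600 * s + 324000 * s\<^sup>2 + 140544 * s ^ 3) / 2073600"
          by (rule divide_nonneg_nonneg[OF add_nonneg_nonneg]) (use s in auto)
        then have "0 \<le> 1 / 4 - (t * (1 / 6 - t\<^sup>2 / 18 + 37 / 100 * h) + h / 32)" by (simp only: e)
        then show ?thesis by simp
      qed
      finally show "t * (1 / 6 - t\<^sup>2 / 18 + 37 / 100 * h) + h\<^sup>2 / 32 \<le> 1 / 4" .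
    qed (use t in auto)
    finally have "1 / 2 - (1 - t / 16) * h\<^sup>2 / 2 - t * h * (1 - 37 / 100 * t) \<le> t / 4" by simp
    with mono[OF h0(1) hq] show ?thesis by (rule order_trans)
  next
    case False
    define s where "s = t - 1"
    have s: "0 \<le> s" "s \<le> 1" "t = 1 + s" using False t by (auto simp: s_def)
    define h where "h = 2228 / 10000 * (1 + 3 / 2 - t)"
    have hq: "h \<le> exp (- t)" unfolding h_def
      using t by (intro exp_minus_ge_tangent exp_minus_3_halves_ge) auto
    have h0: "0 \<le> h" using t by (simp add: h_def)
    have "7 / 8 * h\<^sup>2 \<le> (1 - t / 16) * h\<^sup>2" using t by (intro mult_right_mono) auto
    then have "1 / 2 - (1 - t / 16) * h\<^sup>2 / 2 - t * h * (1 - 37 / 100 * t)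
        \<le> 1 / 2 - 7 / 16 * h\<^sup>2 - t * h * (1 - 37 / 100 * t)" by simp
    also have "\<dots> \<le> t / 4"
    proof -
      \<comment> \<open>The constant completes the square in the cubic and quadratic terms of the
        difference, which leaves a linear remainder with positive coefficients.\<close>
      have "0 \<le> s * (s - 127891656 / 131897600)\<^sup>2" using s by simp
      then show ?thesis using s(1,2) unfolding h_def s(3) power2_eq_square by (simp add: field_simps)
    qed
    finally have "1 / 2 - (1 - t / 16) * h\<^sup>2 / 2 - t * h * (1 - 37 / 100 * t) \<le> t / 4" .
    with mono[OF h0 hq] show ?thesis by (rule order_trans)
  qed
qed

text \<open>By Bernoulli's inequality the derivative of \<open>(1 + t) ^ d - (1 - t) ^ d\<close> is
  smallest at 0, where it is \<open>2 * d\<close>.\<close>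

lemma odd_part_increment:
  fixes x y :: real
  assumes "- 1 \<le> x" "x \<le> y" "y \<le> 1"
  shows "2 * real d * (y - x) \<le> ((1 + y) ^ d - (1 - y) ^ d) - ((1 + x) ^ d - (1 - x) ^ d)"
proof -
  let ?h = "\<lambda>t::real. (1 + t) ^ d - (1 - t) ^ d - 2 * real d * t"
  have "?h x \<le> ?h y"
  proof (rule DERIV_nonneg_imp_nondecreasing[OF assms(2)])
    fix t assume t: "x \<le> t" "t \<le> y"
    have "(?h has_real_derivative d * ((1 + t) ^ (d - 1) + (1 - t) ^ (d - 1) - 2)) (at t)"
      by (auto intro!: derivative_eq_intros simp: algebra_simps)
    moreover have "2 \<le> (1 + t) ^ (d - 1) + (1 - t) ^ (d - 1)"
      using Bernoulli_inequality[of t "d - 1"] Bernoulli_inequality[of "- t" "d - 1"] t assms by simp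
    then have "0 \<le> d * ((1 + t) ^ (d - 1) + (1 - t) ^ (d - 1) - 2)" by simp
    ultimately show "\<exists>z. (?h has_real_derivative z) (at t) \<and> 0 \<le> z" by blast
  qed
  then show ?thesis by (simp add: algebra_simps)
qed

text \<open>
  A binary form of norm 1 with zeros at \<open>o1 + r *\<^sub>R o2\<close> and \<open>o1 + q *\<^sub>R o2\<close> close to
  \<open>o1\<close> cannot be large at both of the directions \<open>o1 \<plusminus> T *\<^sub>R o2\<close>. If the two values have the
  same sign, the even part of the form would be too large at \<open>T\<close>; otherwise the odd part would be.
\<close>

lemma two_zeros_bound:
  fixes p :: "'m::finite rpoly" and o1 o2 :: "real^'m" and P :: "real \<Rightarrow> real" and T e r q :: real
  assumes P_def: "\<And>t. P t = eval_poly p (o1 + t *\<^sub>R o2)"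
    and hom: "homogeneous_of_degree d p" and N: "poly_norm d p = 1"
    and o: "norm o1 = 1" "norm o2 = 1" "o1 \<bullet> o2 = 0"
    and zeros: "P r = 0" "P q = 0" "r \<noteq> q"
    and T: "0 < T" "T \<le> e" "e \<le> 1 / 4"
    and r: "\<bar>r\<bar> \<le> 175 / 1000 * e" and rq: "\<bar>r\<bar> + \<bar>q\<bar> \<le> 675 / 1000 * e"
    and large: "(P T)\<^sup>2 > d * e\<^sup>2 / 4 * (1 + T\<^sup>2) ^ d" "(P (- T))\<^sup>2 > d * e\<^sup>2 / 4 * (1 + T\<^sup>2) ^ d"
  shows False
proof -
  \<comment> \<open>\<open>B\<close> is the Gram entry of the kernel polynomials at \<open>T\<close>
    and at \<open>- T\<close>. Multiplying by \<open>G\<close> normalizes the inequalities to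
    \<open>u / 4\<close> on the left, with \<open>exp (- t) \<le> G \<le> 1\<close>.\<close>
  define u where "u = d * e\<^sup>2"
  define t where "t = d * T\<^sup>2"
  define B where "B = (1 + T\<^sup>2) ^ d"
  define G where "G = 1 / B"
  have oo: "o1 \<bullet> o1 = 1" "o2 \<bullet> o2 = 1" "o2 \<bullet> o1 = 0"
    using o by (simp_all add: dot_square_norm inner_commute)
  have inner: "(o1 + a *\<^sub>R o2) \<bullet> (o1 + b *\<^sub>R o2) = 1 + a * b" for a b
    using o(3) oo by (simp add: inner_add_left inner_add_right)
  have kernel: "(a * P x1 + b * P x2 + c * P x3 + k * P x4)\<^sup>2
      \<le> a\<^sup>2 * (1 + x1 * x1) ^ d + b\<^sup>2 * (1 + x2 * x2) ^ d + c\<^sup>2 * (1 + x3 * x3) ^ d + k\<^sup>2 * (1 + x4 * x4) ^ d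
        + 2 * a * b * (1 + x1 * x2) ^ d + 2 * a * c * (1 + x1 * x3) ^ d + 2 * a * k * (1 + x1 * x4) ^ d
        + 2 * b * c * (1 + x2 * x3) ^ d + 2 * b * k * (1 + x2 * x4) ^ d + 2 * c * k * (1 + x3 * x4) ^ d"
    for a x1 b x2 c x3 k x4
    using kernel_inequality_4[OF hom, of a "o1 + x1 *\<^sub>R o2" b "o1 + x2 *\<^sub>R o2" c "o1 + x3 *\<^sub>R o2" k "o1 + x4 *\<^sub>R o2"]
    unfolding inner N P_def by simp
  have e0: "e > 0" using T by simp
  have T2: "T\<^sup>2 \<le> e\<^sup>2" "e\<^sup>2 \<le> (1 / 4)\<^sup>2"
    using T e0 by (auto intro!: power_mono)
  then have T16: "T\<^sup>2 \<le> 1 / 16" by (simp add: power2_eq_square)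
  have B1: "B \<ge> 1" unfolding B_def by (rule one_le_power) simp
  have G: "0 < G" "G \<le> 1" "B * G = 1" using B1 by (auto simp: G_def)
  have tu: "0 \<le> t" "t \<le> u" using T2 by (auto simp: t_def u_def mult_left_mono)
  have BT: "B \<le> exp t"
  proof -
    have "B \<le> exp (T\<^sup>2) ^ d" unfolding B_def by (intro power_mono) auto
    then show ?thesis by (simp add: t_def exp_of_nat_mult)
  qed
  have qG: "exp (- t) \<le> G"
    using BT B1 by (simp add: G_def exp_minus inverse_eq_divide divide_left_mono)
  have large': "(P T)\<^sup>2 > u / 4 * B" "(P (- T))\<^sup>2 > u / 4 * B"
    using large by (auto simp: u_def B_def)
  have uB: "0 \<le> u / 4 * B" using B1 by (simp add: u_def)
  have u4: "u < 4"
  proof -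
    have "(P T)\<^sup>2 \<le> B" using kernel[of 1 T 0 0 0 0 0 0] by (simp add: B_def power2_eq_square)
    with large' have "u / 4 * B < 1 * B" by simp
    then show ?thesis using B1 by simp
  qed
  have combine: "((\<bar>P T\<bar> + \<bar>P (- T)\<bar>) / 2)\<^sup>2 > u / 4 * B"
  proof -
    define w where "w = sqrt (u / 4 * B)"
    have "w < \<bar>P T\<bar>" "w < \<bar>P (- T)\<bar>"
      using large' by (auto simp: w_def intro!: real_less_lsqrt simp flip: real_sqrt_less_iff[of _ "(P _)\<^sup>2"])
    then have "w < (\<bar>P T\<bar> + \<bar>P (- T)\<bar>) / 2" by simp
    then have "w\<^sup>2 < ((\<bar>P T\<bar> + \<bar>P (- T)\<bar>) / 2)\<^sup>2"
      using uB by (intro power_strict_mono) (auto simp: w_def)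
    then show ?thesis using uB by (simp add: w_def)
  qed
  have T1: "T\<^sup>2 \<le> 1" using T16 by simp
  show False
  proof (cases "P T * P (- T) \<ge> 0")
    case True
    then have "\<bar>P T\<bar> + \<bar>P (- T)\<bar> = \<bar>P T + P (- T)\<bar>"
      by (auto simp: zero_le_mult_iff)
    then have "u / 4 * B < ((P T + P (- T)) / 2)\<^sup>2"
      using combine by (simp add: power_divide)
    also have "(P T + P (- T)) / 2 = 1 / 2 * P T + 1 / 2 * P (- T) + - 1 * P r + 0 * P 0"
      using zeros(1) by (simp add: add_divide_distrib)
    also have "(1 / 2 * P T + 1 / 2 * P (- T) + - 1 * P r + 0 * P 0)\<^sup>2
        \<le> 1 / 2 * B + 1 / 2 * (1 - T\<^sup>2) ^ d + (1 + r\<^sup>2) ^ d - ((1 + T * r) ^ d + (1 - T * r) ^ d)"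
      using kernel[of "1 / 2" T "1 / 2" "- T" "- 1" r 0 0] by (simp add: B_def power2_eq_square)
    also have "\<dots> \<le> 1 / 2 * B + 1 / 2 * (1 - T\<^sup>2) ^ d + (1 + r\<^sup>2) ^ d - 2"
    proof -
      have "\<bar>T * r\<bar> \<le> 1 * 1" unfolding abs_mult using T r e0 by (intro mult_mono) auto
      then have "- 1 \<le> T * r" "T * r \<le> 1" by (simp_all add: abs_le_iff)
      then show ?thesis
        using Bernoulli_inequality[of "T * r" d] Bernoulli_inequality[of "- (T * r)" d] by simp
    qed
    finally have "u / 4 * B * G < (1 / 2 * B + 1 / 2 * (1 - T\<^sup>2) ^ d + (1 + r\<^sup>2) ^ d - 2) * G"
      using G by (intro mult_strict_right_mono)
    then have "u / 4 * (B * G) < 1 / 2 * (B * G) + 1 / 2 * ((1 - T\<^sup>2) ^ d * G) - G + ((1 + r\<^sup>2) ^ d - 1) * G"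
      by (simp add: algebra_simps)
    then have 2: "u / 4 < 1 / 2 + 1 / 2 * ((1 - T\<^sup>2) ^ d * G) - G + ((1 + r\<^sup>2) ^ d - 1) * G"
      unfolding G(3) by simp
    have "(1 - T\<^sup>2) ^ d * B \<le> 1"
    proof -
      have "(1 - T\<^sup>2) * (1 + T\<^sup>2) \<le> 1" by (simp add: algebra_simps)
      then have "((1 - T\<^sup>2) * (1 + T\<^sup>2)) ^ d \<le> 1" using T1 by (intro power_le_one) auto
      then show ?thesis by (simp add: B_def power_mult_distrib)
    qed
    then have "(1 - T\<^sup>2) ^ d \<le> G" using B1 by (simp add: G_def field_simps)
    then have 3: "(1 - T\<^sup>2) ^ d * G \<le> G * G" using G by (intro mult_right_mono) auto
    have "(1 - G)\<^sup>2 \<le> (1 - exp (- t))\<^sup>2" using qG G by (intro power_mono) auto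
    also have "\<dots> \<le> 42 / 100 * t" by (rule one_minus_exp_sq_le[OF tu(1)])
    finally have 4: "(1 - G)\<^sup>2 \<le> 42 / 100 * u" using tu by simp
    have 5: "((1 + r\<^sup>2) ^ d - 1) * G \<le> 35 / 1000 * u"
    proof -
      define R where "R = d * r\<^sup>2"
      have "r\<^sup>2 \<le> (175 / 1000 * e)\<^sup>2" using r e0 by (metis abs_le_square_iff abs_of_pos mult_pos_pos zero_less_divide_iff zero_less_numeral)
      then have "R \<le> d * (175 / 1000 * e)\<^sup>2" unfolding R_def by (intro mult_left_mono) auto
      then have R: "0 \<le> R" "R \<le> 31 / 1000 * u"
        using tu by (auto simp: R_def u_def power_mult_distrib power2_eq_square)
      then have R1: "R \<le> 124 / 1000" using u4 by simp
      have "(1 + r\<^sup>2) ^ d \<le> exp (r\<^sup>2) ^ d" by (intro power_mono) auto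
      also have "\<dots> = exp R" by (simp add: R_def exp_of_nat_mult)
      also have "\<dots> \<le> 1 + R + R\<^sup>2" using R R1 by (intro exp_bound) auto
      also have "R\<^sup>2 \<le> 124 / 1000 * R"
        using mult_right_mono[OF R1 R(1)] by (simp add: power2_eq_square)
      finally have "(1 + r\<^sup>2) ^ d - 1 \<le> 1124 / 1000 * R" by simp
      then have "((1 + r\<^sup>2) ^ d - 1) * G \<le> (1124 / 1000 * R) * 1"
        using G R by (intro mult_mono) auto
      then show ?thesis using R by simp
    qed
    have "(1 - G)\<^sup>2 = 1 - 2 * G + G * G" by (simp add: power2_eq_square algebra_simps)
    then have "1 / 2 + 1 / 2 * ((1 - T\<^sup>2) ^ d * G) - G \<le> 1 / 2 * (1 - G)\<^sup>2" using 3 by simp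
    then have "u / 4 < 1 / 2 * (42 / 100 * u) + 35 / 1000 * u" using 2 4 5 by linarith
    then have "u / 4 < 245 / 1000 * u" by simp
    moreover have "u \<ge> 0" using tu by simp
    ultimately show False by simp
  next
    case False
    then have ab: "\<bar>P T\<bar> + \<bar>P (- T)\<bar> = \<bar>P T - P (- T)\<bar>"
      by (auto simp: zero_le_mult_iff not_le abs_if)
    have u2: "u < 2"
    proof -
      have "u / 4 * B < (1 / 2 * P T + - 1 / 2 * P (- T) + 0 * P 0 + 0 * P 0)\<^sup>2"
        using combine by (simp add: ab power_divide flip: diff_divide_distrib)
      also have "\<dots> \<le> 1 / 2 * B - 1 / 2 * (1 - T\<^sup>2) ^ d"
        using kernel[of "1 / 2" T "- 1 / 2" "- T" 0 0 0 0] by (simp add: B_def power2_eq_square)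
      also have "\<dots> \<le> 1 / 2 * B" using T1 by simp
      finally show ?thesis using B1 by simp
    qed
    \<comment> \<open>With \<open>k * (q - r) = T\<close> the vanishing quantity
      \<open>k * (P q - P r)\<close> has the same first-order part as
      \<open>(P T - P (- T)) / 2\<close>, and subtracting it leaves only higher order terms.\<close>
    define k where "k = T / (q - r)"
    define w where "w = (\<bar>q\<bar> + \<bar>r\<bar>)\<^sup>2"
    define W where "W = d * w"
    define S where "S = (\<Sum>j=2..d. (d choose j) * w ^ (j - 1))"
    have kT: "k * (q - r) = T" using zeros(3) by (simp add: k_def)
    have "u / 4 * B < (1 / 2 * P T + - 1 / 2 * P (- T) + - k * P q + k * P r)\<^sup>2"
      using combine zeros by (simp add: ab power_divide flip: diff_divide_distrib)
    also have "\<dots> \<le> 1 / 2 * B - 1 / 2 * (1 - T\<^sup>2) ^ d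
        + k\<^sup>2 * ((1 + q\<^sup>2) ^ d + (1 + r\<^sup>2) ^ d - 2 * (1 + q * r) ^ d)
        - k * (((1 + T * q) ^ d - (1 - T * q) ^ d) - ((1 + T * r) ^ d - (1 - T * r) ^ d))"
      using kernel[of "1 / 2" T "- 1 / 2" "- T" "- k" q k r] by (simp add: B_def power2_eq_square algebra_simps)
    also have "\<dots> \<le> 1 / 2 * B - 1 / 2 * (1 - T\<^sup>2) ^ d + (t + T\<^sup>2 * S) - 2 * t"
    proof (intro add_mono diff_mono order_refl)
      have g: "(1 + q\<^sup>2) ^ d + (1 + r\<^sup>2) ^ d - 2 * (1 + q * r) ^ d \<le> (q - r)\<^sup>2 * (d + S)"
        using gram_kernel_remainder_le[of "\<bar>q\<bar>" "\<bar>r\<bar>" "q * r" d]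
        by (simp add: S_def w_def abs_mult power2_diff algebra_simps)
      have "k\<^sup>2 * ((1 + q\<^sup>2) ^ d + (1 + r\<^sup>2) ^ d - 2 * (1 + q * r) ^ d) \<le> k\<^sup>2 * ((q - r)\<^sup>2 * (d + S))"
        using g by (rule mult_left_mono) simp
      also have "\<dots> = (k * (q - r))\<^sup>2 * (d + S)" by (simp add: power_mult_distrib)
      also have "\<dots> = t + T\<^sup>2 * S" unfolding kT by (simp add: t_def algebra_simps)
      finally show "k\<^sup>2 * ((1 + q\<^sup>2) ^ d + (1 + r\<^sup>2) ^ d - 2 * (1 + q * r) ^ d) \<le> t + T\<^sup>2 * S" .
      let ?o = "\<lambda>x::real. (1 + x) ^ d - (1 - x) ^ d"
      have small: "\<bar>T * x\<bar> \<le> 1" if "\<bar>x\<bar> \<le> 1" for x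
        using mult_mono[of "\<bar>T\<bar>" 1 "\<bar>x\<bar>" 1] T that by (simp add: abs_mult)
      have qr1: "\<bar>q\<bar> \<le> 1" "\<bar>r\<bar> \<le> 1" using rq T e0 by auto
      have tk: "t = d * T * (k * (q - r))" unfolding kT by (simp add: t_def power2_eq_square)
      show "2 * t \<le> k * (?o (T * q) - ?o (T * r))"
      proof (cases "r \<le> q")
        case True
        then have k0: "k \<ge> 0" using T by (simp add: k_def)
        have "2 * real d * (T * q - T * r) \<le> ?o (T * q) - ?o (T * r)"
          using small[OF qr1(1)] small[OF qr1(2)] True T
          by (intro odd_part_increment) (auto simp: mult_left_mono abs_le_iff)
        then have "k * (2 * real d * (T * q - T * r)) \<le> k * (?o (T * q) - ?o (T * r))"
          using k0 by (rule mult_left_mono)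
        moreover have "k * (2 * real d * (T * q - T * r)) = 2 * t"
          unfolding tk by (simp add: algebra_simps)
        ultimately show ?thesis by linarith
      next
        case False
        then have k0: "k \<le> 0" using T by (simp add: k_def divide_nonneg_nonpos)
        have "2 * real d * (T * r - T * q) \<le> ?o (T * r) - ?o (T * q)"
          using small[OF qr1(1)] small[OF qr1(2)] False T
          by (intro odd_part_increment) (auto simp: mult_left_mono abs_le_iff)
        then have "- k * (2 * real d * (T * r - T * q)) \<le> - k * (?o (T * r) - ?o (T * q))"
          using k0 by (intro mult_left_mono) auto
        moreover have "- k * (2 * real d * (T * r - T * q)) = 2 * t"
          unfolding tk by (simp add: algebra_simps)
        moreover have "- k * (?o (T * r) - ?o (T * q)) = k * (?o (T * q) - ?o (T * r))" by (simp add: algebra_simps)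
        ultimately show ?thesis by linarith
      qed
    qed
    finally have "u / 4 * B * G < (1 / 2 * B - 1 / 2 * (1 - T\<^sup>2) ^ d - t + T\<^sup>2 * S) * G"
      using G by (intro mult_strict_right_mono) auto
    then have "u / 4 * (B * G) < 1 / 2 * (B * G) - 1 / 2 * ((1 - T\<^sup>2) ^ d * G) - t * G + T\<^sup>2 * S * G"
      by (simp add: algebra_simps)
    then have 2: "u / 4 < 1 / 2 - 1 / 2 * ((1 - T\<^sup>2) ^ d * G) - t * G + T\<^sup>2 * S * G"
      unfolding G(3) by simp
    have "1 - t / 16 \<le> (1 - T\<^sup>2) ^ d * B"
    proof -
      have "T\<^sup>2 * T\<^sup>2 \<le> T\<^sup>2 * (1 / 16)" by (rule mult_left_mono[OF T16]) simp
      then have "d * (T\<^sup>2 * T\<^sup>2) \<le> d * (T\<^sup>2 * (1 / 16))" by (rule mult_left_mono) simp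
      moreover have "1 + d * (- (T\<^sup>2 * T\<^sup>2)) \<le> (1 + - (T\<^sup>2 * T\<^sup>2)) ^ d"
        using mult_mono[OF T1 T1] by (intro Bernoulli_inequality) simp
      moreover have "(1 - T\<^sup>2) ^ d * B = (1 + - (T\<^sup>2 * T\<^sup>2)) ^ d"
        unfolding B_def power_mult_distrib[symmetric] by (simp add: algebra_simps)
      ultimately have "1 - d * (T\<^sup>2 * (1 / 16)) \<le> (1 - T\<^sup>2) ^ d * B" by simp
      then show ?thesis by (simp only: t_def times_divide_eq_right mult_1_right)
    qed
    then have "(1 - t / 16) * G \<le> (1 - T\<^sup>2) ^ d * B * G" using G by (intro mult_right_mono) auto
    then have "(1 - t / 16) * G \<le> (1 - T\<^sup>2) ^ d" using G by (simp add: mult.assoc)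
    then have "(1 - t / 16) * G * G \<le> (1 - T\<^sup>2) ^ d * G" using G by (intro mult_right_mono) auto
    then have 3: "(1 - t / 16) * G\<^sup>2 \<le> (1 - T\<^sup>2) ^ d * G" by (simp add: power2_eq_square mult.assoc)
    have w0: "w > 0" using zeros(3) by (auto simp: w_def)
    have wW: "w * S = (1 + w) ^ d - 1 - W"
    proof -
      have "(1 + w) ^ d = (\<Sum>j\<le>d. (d choose j) * w ^ j)"
        using binomial_ring[of w 1 d] by (simp add: add.commute)
      also have "{..d} = ({0,1} \<inter> {..d}) \<union> {2..d}" by (auto simp: numeral_2_eq_2 not_le)
      also have "(\<Sum>j\<in>({0,1} \<inter> {..d}) \<union> {2..d}. (d choose j) * w ^ j)
          = (\<Sum>j\<in>{0,1} \<inter> {..d}. (d choose j) * w ^ j) + (\<Sum>j=2..d. (d choose j) * w ^ j)"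
        by (rule sum.union_disjoint) auto
      also have "(\<Sum>j\<in>{0,1} \<inter> {..d}. (d choose j) * w ^ j) = 1 + W"
        by (cases d) (auto simp: Int_insert_left W_def)
      also have "(\<Sum>j=2..d. (d choose j) * w ^ j) = w * S"
        unfolding S_def sum_distrib_left
      proof (intro sum.cong refl)
        fix j assume "j \<in> {2..d}"
        then obtain i where "j = Suc i" by (cases j) auto
        then show "(d choose j) * w ^ j = w * ((d choose j) * w ^ (j - 1))" by simp
      qed
      finally show ?thesis by simp
    qed
    have wu: "w \<le> (675 / 1000 * e)\<^sup>2" unfolding w_def using rq by (intro power_mono) auto
    then have "W \<le> d * (675 / 1000 * e)\<^sup>2" unfolding W_def by (intro mult_left_mono) auto
    then have W: "W \<le> 4557 / 10000 * u" "0 \<le> W"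
      using tu w0 by (auto simp: W_def u_def power_mult_distrib power2_eq_square)
    have "(1 + w) ^ d \<le> exp w ^ d" using w0 by (intro power_mono) auto
    also have "\<dots> = exp W" by (simp add: W_def exp_of_nat_mult)
    finally have "w * S \<le> exp W - 1 - W" unfolding wW by simp
    also have "\<dots> \<le> 8 / 10 * W\<^sup>2" using W u2 by (intro exp_remainder_le) auto
    also have "\<dots> = w * (8 / 10 * d * W)" by (simp add: W_def power2_eq_square)
    finally have "S \<le> 8 / 10 * d * W" using w0 by simp
    also have "\<dots> \<le> 8 / 10 * d * (4557 / 10000 * u)" using W by (intro mult_left_mono) auto
    finally have "T\<^sup>2 * S \<le> T\<^sup>2 * (8 / 10 * d * (4557 / 10000 * u))" by (intro mult_left_mono) auto
    also have "\<dots> = 36456 / 100000 * (t * u)" by (simp add: t_def)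
    also have "\<dots> \<le> 37 / 100 * (t * u)" using tu by (intro mult_right_mono) auto
    finally have "T\<^sup>2 * S * G \<le> 37 / 100 * (t * u) * G" using G by (intro mult_right_mono) auto
    moreover have "u / 4 < 1 / 2 - a' / 2 - b + c'"
      if "u / 4 < 1 / 2 - 1 / 2 * a - b + c" "a' \<le> a" "c \<le> c'" for a a' b c c' using that by simp
    ultimately have 4: "u / 4 < 1 / 2 - (1 - t / 16) * G\<^sup>2 / 2 - t * G + 37 / 100 * (t * u) * G"
      using 2 3 by blast
    have tG: "t * G \<le> 2 / 3"
    proof -
      have "1 + t \<le> B" unfolding B_def t_def
        by (rule Bernoulli_inequality[OF order_trans[OF _ zero_le_power2]]) simp
      then have "t * 3 \<le> 2 * B" using tu u2 by simp
      then show ?thesis using B1 by (simp add: G_def field_simps)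
    qed
    \<comment> \<open>Replaces \<open>u\<close> by the smaller \<open>t\<close>: the left side is
      nonincreasing in \<open>u\<close> as long as
      \<open>37 / 100 * t * G \<le> 1 / 4\<close>.\<close>
    have "37 / 100 * (t * u) * G - u / 4 \<le> 37 / 100 * (t * t) * G - t / 4"
    proof -
      have "37 / 100 * (t * G) \<le> 1 / 4" using tG by linarith
      then have "(u - t) * (37 / 100 * (t * G)) \<le> (u - t) * (1 / 4)"
        by (rule mult_left_mono) (use tu in simp)
      moreover have "u * v - u / 4 \<le> t * v - t / 4" if "(u - t) * v \<le> (u - t) * (1 / 4)" for v
        using that by (simp add: left_diff_distrib)
      ultimately have "u * (37 / 100 * (t * G)) - u / 4 \<le> t * (37 / 100 * (t * G)) - t / 4" by blast
      then show ?thesis by (simp only: mult_ac)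
    qed
    then have "t / 4 < 1 / 2 - (1 - t / 16) * G\<^sup>2 / 2 - t * G * (1 - 37 / 100 * t)"
    proof -
      have "t * G * (1 - 37 / 100 * t) = t * G - 37 / 100 * (t * t) * G" by (simp add: algebra_simps)
      then show ?thesis using 4 \<open>37 / 100 * (t * u) * G - u / 4 \<le> _\<close> by linarith
    qed
    moreover have "1 / 2 - (1 - t / 16) * G\<^sup>2 / 2 - t * G * (1 - 37 / 100 * t) \<le> t / 4"
      using tu u2 by (intro odd_case_inequality qG) auto
    ultimately show False by linarith
  qed
qed

section \<open>Angles of mesh points on a square\<close>

lemma arctan_diff:
  assumes "1 + x * y > 0"
  shows "arctan x - arctan y = arctan ((x - y) / (1 + x * y))"
proof (rule arctan_unique[symmetric])
  let ?t = "arctan x - arctan y"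
  have b: "\<bar>?t\<bar> < pi"
    using arctan_bounded[of x] arctan_bounded[of y] by linarith
  have "cos ?t = cos (arctan x) * cos (arctan y) * (1 + x * y)"
    by (simp add: cos_diff sin_arctan cos_arctan algebra_simps add_divide_distrib)
  also have "\<dots> > 0" using assms by (simp add: cos_arctan add_pos_nonneg)
  finally have c: "cos ?t > 0" .
  have "\<bar>?t\<bar> < pi / 2"
  proof (rule ccontr)
    assume "\<not> ?thesis"
    then have "cos \<bar>?t\<bar> \<le> cos (pi / 2)"
      using b by (intro cos_monotone_0_pi_le) auto
    with c show False by simp
  qed
  then show "- (pi / 2) < ?t" "?t < pi / 2" by linarith+
  have "cos (arctan x) \<noteq> 0" "cos (arctan y) \<noteq> 0" by (simp_all add: cos_arctan add_nonneg_eq_0_iff)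
  with c show "tan ?t = (x - y) / (1 + x * y)" by (subst tan_diff) (auto simp: tan_arctan)
qed

lemma abs_arctan_le: "\<bar>arctan x\<bar> \<le> \<bar>x\<bar>"
  using arctan_le_self[of "\<bar>x\<bar>"] by (cases "x \<ge> 0") (auto simp: arctan_minus)

lemma arctan_diff_le:
  assumes "0 \<le> x" "x \<le> y"
  shows "\<bar>arctan y - arctan x\<bar> \<le> y - x"
proof -
  have p: "1 + y * x > 0" using assms by (simp add: add_pos_nonneg)
  have "\<bar>arctan y - arctan x\<bar> \<le> \<bar>(y - x) / (1 + y * x)\<bar>"
    unfolding arctan_diff[OF p] by (rule abs_arctan_le)
  also have "\<dots> = (y - x) / (1 + y * x)" using assms p by simp
  also have "\<dots> \<le> (y - x) / 1" using assms p by (intro divide_left_mono) auto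
  finally show ?thesis by simp
qed

text \<open>On this range \<open>cos t \<ge> 1 - t^2 / 2 > 0.985\<close>, whose inverse is below
  1.015 here.\<close>

lemma abs_tan_le:
  fixes t :: real
  assumes "\<bar>t\<bar> \<le> 17 / 100"
  shows "\<bar>tan t\<bar> \<le> 1015 / 1000 * \<bar>t\<bar>"
proof -
  have "t\<^sup>2 \<le> (17 / 100)\<^sup>2" using assms by (metis abs_le_square_iff abs_of_pos zero_less_divide_iff zero_less_numeral)
  moreover have "cos t = 1 - 2 * (sin (t / 2))\<^sup>2" using cos_double_sin[of "t / 2"] by simp
  moreover have "(sin (t / 2))\<^sup>2 \<le> (t / 2)\<^sup>2"
    using abs_sin_x_le_abs_x[of "t / 2"] by (simp only: abs_le_square_iff)
  ultimately have c: "1 \<le> 1015 / 1000 * cos t" by (simp add: power_divide power2_eq_square)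
  then have "\<bar>tan t\<bar> = \<bar>sin t\<bar> / cos t" by (simp add: tan_def)
  also have "\<dots> \<le> \<bar>t\<bar> / cos t" using c abs_sin_x_le_abs_x[of t] by (intro divide_right_mono) auto
  also have "\<dots> \<le> 1015 / 1000 * \<bar>t\<bar>"
    using mult_left_mono[OF c, of "\<bar>t\<bar>"] c by (simp add: field_simps)
  finally show ?thesis .
qed

text \<open>Multiplied by the mesh size, the first summand bounds the angle between \<open>x\<close>
  and \<open>z\<close>. The second is twice the bound on the displacement of \<open>x\<close> from
  the angular midpoint of its two mesh neighbours, which is the left side of the other
  claim.\<close>

lemma mesh_angle_bound:
  fixes v :: real
  assumes v: "0 \<le> v" "v \<le> 1"
  shows "1 / 2 / (1 + v\<^sup>2 - v / 8) + v / 2 / ((1 + v\<^sup>2)\<^sup>2 - v\<^sup>2 / 16) \<le> 62 / 100"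
    and "v / 4 / ((1 + v\<^sup>2)\<^sup>2 - v\<^sup>2 / 16) \<le> 127 / 1000"
proof -
  define N where "N = 1 + v\<^sup>2"
  have N1: "N \<ge> 1" by (simp add: N_def)
  have vN: "2 * v \<le> N" using zero_le_power2[of "v - 1"] by (simp add: N_def power2_eq_square algebra_simps)
  have a: "1 / (N - v / 8) \<le> (N + 2 / 15 * v) / N\<^sup>2"
  proof -
    have "0 \<le> v * (N - 2 * v)" using v vN by simp
    then have "N\<^sup>2 \<le> (N + 2 / 15 * v) * (N - v / 8)" by (simp add: power2_eq_square field_simps)
    moreover have "N - v / 8 > 0" using vN N1 v by linarith
    ultimately show ?thesis using N1 by (simp add: divide_simps)
  qed
  have "(2 * v)\<^sup>2 \<le> N\<^sup>2" using v vN by (intro power_mono) auto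
  then have q: "63 / 64 * N\<^sup>2 \<le> N\<^sup>2 - v\<^sup>2 / 16" by (simp add: power_mult_distrib)
  have N2: "N\<^sup>2 > 0" using N1 by simp
  have b: "v / (N\<^sup>2 - v\<^sup>2 / 16) \<le> v / (63 / 64 * N\<^sup>2)"
    by (rule divide_left_mono[OF q v(1) mult_pos_pos]) (use q N2 in linarith)+
  have comm: "v / 4 / y = v / y / 4" "v / 2 / y = v / y / 2" "1 / 2 / y = 1 / y / 2" for y :: real
    by (simp_all only: divide_divide_eq_left mult.commute)
  have "v / 4 / (N\<^sup>2 - v\<^sup>2 / 16) \<le> (v / (63 / 64 * N\<^sup>2)) / 4"
    unfolding comm by (rule divide_right_mono[OF b]) simp
  also have "\<dots> \<le> 127 / 1000"
  proof -
    have "2 * v * 1 \<le> N * N" using vN N1 v by (intro mult_mono) auto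
    then show ?thesis using N2 by (simp add: divide_simps power2_eq_square)
  qed
  finally show "v / 4 / ((1 + v\<^sup>2)\<^sup>2 - v\<^sup>2 / 16) \<le> 127 / 1000" by (simp only: N_def)
  have "1 / 2 / (N - v / 8) + v / 2 / (N\<^sup>2 - v\<^sup>2 / 16) \<le> (N + 2 / 15 * v) / N\<^sup>2 / 2 + v / (63 / 64 * N\<^sup>2) / 2"
    unfolding comm by (intro add_mono divide_right_mono a b) simp_all
  also have "\<dots> = (N / 2 + (1 / 15 + 32 / 63) * v) / N\<^sup>2"
    using N2 by (simp add: field_simps)
  also have "\<dots> \<le> 62 / 100"
  proof -
    have "0 \<le> 12 / 100 - 575 / 1000 * v + 74 / 100 * v\<^sup>2"
      using zero_le_power2[of "v - 575 / 1480"] by (simp add: power2_eq_square field_simps)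
    moreover have "62 / 100 * N\<^sup>2 - (N / 2 + (1 / 15 + 32 / 63) * v)
        = 12 / 100 - (1 / 15 + 32 / 63) * v + 74 / 100 * v\<^sup>2 + 62 / 100 * (v\<^sup>2)\<^sup>2"
      by (simp add: N_def power2_eq_square field_simps)
    moreover have "(1 / 15 + 32 / 63) * v \<le> 575 / 1000 * v" using v by (intro mult_right_mono) simp_all
    moreover have "0 \<le> (v\<^sup>2)\<^sup>2" by simp
    ultimately have "N / 2 + (1 / 15 + 32 / 63) * v \<le> 62 / 100 * N\<^sup>2" by linarith
    then show ?thesis using N2 by (simp add: divide_le_eq)
  qed
  finally show "1 / 2 / (1 + v\<^sup>2 - v / 8) + v / 2 / ((1 + v\<^sup>2)\<^sup>2 - v\<^sup>2 / 16) \<le> 62 / 100"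
    by (simp only: N_def)
qed

lemma arctan_back_step:
  fixes v e :: real
  assumes "1 + v * (v - e) \<ge> 1" "0 < e"
  shows "0 < arctan v - arctan (v - e)" "arctan v - arctan (v - e) \<le> arctan e"
proof -
  have "arctan v - arctan (v - e) = arctan (e / (1 + v * (v - e)))"
    using assms by (subst arctan_diff) auto
  moreover have "e / (1 + v * (v - e)) \<le> e / 1" using assms by (intro divide_left_mono) auto
  moreover have "e / (1 + v * (v - e)) > 0" using assms by (intro divide_pos_pos) linarith+
  ultimately show "0 < arctan v - arctan (v - e)" "arctan v - arctan (v - e) \<le> arctan e"
    by (auto simp: arctan_monotone')
qed

text \<open>Beyond the corner of the square the next mesh point lies on the adjacent edge, at slope
  \<open>1 / (1 - e)\<close>. Reflection in the diagonal makes the steps on both sides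
  equal.\<close>

lemma arctan_corner_step:
  fixes e :: real
  assumes "0 < e" "e \<le> 1 / 4"
  shows "0 < arctan (1 / (1 - e)) - arctan 1" "arctan (1 / (1 - e)) - arctan 1 \<le> arctan e"
    and "arctan (1 / (1 - e)) - arctan 1 = arctan 1 - arctan (1 - e)"
proof -
  have "1 + 1 / (1 - e) * 1 > 0" using assms by (simp add: add_pos_pos)
  moreover have "(1 / (1 - e) - 1) / (1 + 1 / (1 - e) * 1) = e / (2 - e)"
    using assms by (simp add: divide_simps)
  ultimately have 1: "arctan (1 / (1 - e)) - arctan 1 = arctan (e / (2 - e))"
    using arctan_diff[of "1 / (1 - e)" 1] by simp
  have "arctan 1 - arctan (1 - e) = arctan (e / (2 - e))"
    using assms by (subst arctan_diff) auto
  with 1 show "arctan (1 / (1 - e)) - arctan 1 = arctan 1 - arctan (1 - e)" by simp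
  have "e / (2 - e) \<le> e / 1" using assms by (intro divide_left_mono) auto
  moreover have "e / (2 - e) > 0" using assms by (intro divide_pos_pos) auto
  ultimately show "0 < arctan (1 / (1 - e)) - arctan 1" "arctan (1 / (1 - e)) - arctan 1 \<le> arctan e"
    unfolding 1 by (auto simp: arctan_monotone')
qed

text \<open>The two steps are \<open>arctan (e / (N + v * e))\<close> and
  \<open>arctan (e / (N - v * e))\<close> for \<open>N = 1 + v^2\<close>. Their arguments differ by
  \<open>2 * v * e^2\<close> over the product of the denominators; one factor \<open>e\<close> is
  then bounded by 1/4.\<close>

lemma arctan_step:
  fixes v e :: real
  assumes v: "0 \<le> v" "v \<le> 1" and e: "0 < e" "e \<le> 1 / 4"
  shows "0 < arctan (v + e) - arctan v" "arctan (v + e) - arctan v \<le> arctan e"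
    and "\<bar>arctan (v + e) - arctan v - (arctan v - arctan (v - e))\<bar>
      \<le> 2 * (v / 4 / ((1 + v\<^sup>2)\<^sup>2 - v\<^sup>2 / 16)) * e"
proof -
  define N where "N = 1 + v\<^sup>2"
  have N: "N \<ge> 1" "2 * v \<le> N"
    using zero_le_power2[of "v - 1"] by (auto simp: N_def power2_eq_square algebra_simps)
  have ve: "0 \<le> v * e" "v * e \<le> v" using v e by (auto intro: mult_left_le)
  have Np: "N + v * e \<ge> 1" using N(1) ve by linarith
  have Nv: "N - v * e > 0" using N ve by linarith
  have e1: "arctan (v + e) - arctan v = arctan (e / (N + v * e))"
  proof -
    have "1 + (v + e) * v = N + v * e" by (simp add: N_def power2_eq_square algebra_simps)
    then show ?thesis using arctan_diff[of "v + e" v] Np by simp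
  qed
  have e2: "arctan v - arctan (v - e) = arctan (e / (N - v * e))"
  proof -
    have "1 + v * (v - e) = N - v * e" by (simp add: N_def power2_eq_square algebra_simps)
    then show ?thesis using arctan_diff[of v "v - e"] Nv by simp
  qed
  have "e / (N + v * e) \<le> e / 1" using Np e by (intro divide_left_mono) auto
  moreover have pos: "e / (N + v * e) > 0" using Np e by (intro divide_pos_pos) linarith+
  ultimately show "0 < arctan (v + e) - arctan v" "arctan (v + e) - arctan v \<le> arctan e"
    unfolding e1 by (auto simp: arctan_monotone')
  have le: "e / (N + v * e) \<le> e / (N - v * e)"
    by (rule divide_left_mono) (use Nv Np ve e in auto)
  have v2: "v\<^sup>2 \<le> N\<^sup>2" using N v by (intro power_mono) auto
  moreover have "N\<^sup>2 \<ge> 1" using N(1) by (simp add: one_le_power)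
  ultimately have NN: "N\<^sup>2 - v\<^sup>2 / 16 > 0" by linarith
  have "\<bar>arctan (e / (N - v * e)) - arctan (e / (N + v * e))\<bar> \<le> e / (N - v * e) - e / (N + v * e)"
    using pos le by (intro arctan_diff_le) auto
  also have "\<dots> = 2 * v * e * e / (N\<^sup>2 - v\<^sup>2 * e\<^sup>2)"
  proof -
    have "N - v * e \<noteq> 0" "N + v * e \<noteq> 0" using Nv Np by linarith+
    then have "e / (N - v * e) - e / (N + v * e) = (e * (N + v * e) - e * (N - v * e)) / ((N - v * e) * (N + v * e))"
      by (simp add: diff_frac_eq)
    also have "e * (N + v * e) - e * (N - v * e) = 2 * v * e * e" by (simp add: algebra_simps)
    also have "(N - v * e) * (N + v * e) = N\<^sup>2 - v\<^sup>2 * e\<^sup>2"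
      by (simp add: power2_eq_square algebra_simps)
    finally show ?thesis .
  qed
  also have "\<dots> \<le> 2 * v * e * (1 / 4) / (N\<^sup>2 - v\<^sup>2 / 16)"
  proof (rule frac_le)
    show "2 * v * e * e \<le> 2 * v * e * (1 / 4)"
      using v e by (intro mult_left_mono) auto
    have "e\<^sup>2 \<le> (1 / 4)\<^sup>2" using e by (intro power_mono) auto
    then have "v\<^sup>2 * e\<^sup>2 \<le> v\<^sup>2 * (1 / 4)\<^sup>2" by (rule mult_left_mono) simp
    then show "N\<^sup>2 - v\<^sup>2 / 16 \<le> N\<^sup>2 - v\<^sup>2 * e\<^sup>2" by (simp add: power_divide)
  qed (use v e NN in auto)
  also have "\<dots> = 2 * (v / 4 / (N\<^sup>2 - v\<^sup>2 / 16)) * e"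
  proof -
    have "2 * v * e * (1 / 4) / y = 2 * (v / 4 / y) * e" for y by simp
    then show ?thesis .
  qed
  finally show "\<bar>arctan (v + e) - arctan v - (arctan v - arctan (v - e))\<bar>
      \<le> 2 * (v / 4 / ((1 + v\<^sup>2)\<^sup>2 - v\<^sup>2 / 16)) * e"
    unfolding e1 e2 N_def by (simp only: abs_minus_commute)
qed

context stopped_cell
begin

text \<open>If \<open>zeta x\<close> is not \<open>z\<close>, \<open>unit_step\<close> forbids both
  mesh neighbours of \<open>x\<close> to be vertices, so the form exceeds the threshold at both.
  Measured from the angular midpoint of the neighbours, the zeros \<open>zeta x\<close> and
  \<open>z\<close> are close enough for \<open>two_zeros_bound\<close>.\<close>

lemma small_case:
  assumes n: "CARD('n) = 1"
  shows "zeta x = z"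
proof (rule ccontr)
  assume ne: "zeta x \<noteq> z"
  note eta = eta_bounds(1,2)
  obtain j0 :: 'n where j0: "UNIV = {j0}" using n by (rule card_1_singletonE)
  obtain i1 where "UNIV - {i0} = {i1}" using card_J n by (metis card_1_singletonE)
  then have i1: "UNIV = {i0, i1}" "i1 \<noteq> i0" by auto
  have Dj: "d j0 = D" unfolding D_def j0 by simp
  have N1: "N j0 = 1"
  proof -
    have "(N j0)\<^sup>2 = 1" using sum_N by (simp add: j0)
    moreover have "N j0 \<ge> 0" unfolding poly_norm_def
      by (intro real_sqrt_ge_zero sum_nonneg divide_nonneg_nonneg) (auto intro: less_imp_le multinomial_coeff_pos)
    ultimately show ?thesis by (simp add: power2_eq_1_iff)
  qed
  let ?g = "eval_poly (f j0)"
  have norm_eval: "(norm (eval_sys f y))\<^sup>2 = (?g y)\<^sup>2" for y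
    by (simp add: norm_vec_sq j0 eval_sys_def)
  \<comment> \<open>The signs reflect the plane so that \<open>a\<close> has coordinates
    \<open>(1, v)\<close> with \<open>v \<ge> 0\<close>; \<open>w\<close> is the angular
    parametrization in the reflected coordinates.\<close>
  define \<epsilon> where "\<epsilon> = c $ i0"
  define \<sigma> where "\<sigma> = (if a $ i1 \<ge> 0 then 1 else - 1 :: real)"
  define v where "v = \<bar>a $ i1\<bar>"
  define vz where "vz = \<sigma> * c $ i1"
  have sq: "\<epsilon> * \<epsilon> = 1" "\<sigma> * \<sigma> = 1"
    using c_i0 by (auto simp: \<epsilon>_def \<sigma>_def abs_if split: if_splits)
  have sq': "\<epsilon> * (\<epsilon> * u) = u" "\<sigma> * (\<sigma> * u) = u" for u by (simp_all add: sq flip: mult.assoc)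
  have ai: "a $ i0 = \<epsilon>" "a $ i1 = \<sigma> * v" using a_i0 by (auto simp: \<epsilon>_def \<sigma>_def v_def)
  have ci: "c $ i1 = \<sigma> * vz" by (simp add: vz_def sq')
  have v01: "0 \<le> v" "v \<le> 1" using a_grid by (auto simp: v_def grid_def)
  have vvz: "\<bar>v - vz\<bar> \<le> \<eta> / 2"
  proof -
    have "v - vz = \<sigma> * (a $ i1 - c $ i1)" by (simp add: ai ci right_diff_distrib sq')
    then have "\<bar>v - vz\<bar> = \<bar>a $ i1 - c $ i1\<bar>" by (simp add: abs_mult \<sigma>_def)
    then show ?thesis using ac[of i1] by simp
  qed
  define w where "w = (\<lambda>t. (\<chi> l. if l = i0 then \<epsilon> * cos t else \<sigma> * sin t) :: real^'m)"
  have w_i: "w t $ i0 = \<epsilon> * cos t" "w t $ i1 = \<sigma> * sin t" for t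
    using i1 by (simp_all add: w_def)
  have eqI: "u = u'" if "u $ i0 = u' $ i0" "u $ i1 = u' $ i1" for u u' :: "real^'m"
  proof -
    have "u $ l = u' $ l" for l using that i1(1) by (metis UNIV_I insertE singletonD)
    then show ?thesis by (simp add: vec_eq_iff)
  qed
  have inner2: "u \<bullet> u' = u $ i0 * u' $ i0 + u $ i1 * u' $ i1" for u u' :: "real^'m"
    unfolding inner_vec_def i1(1) using i1(2) by simp
  have w_inner: "w s \<bullet> w t = cos (s - t)" for s t
  proof -
    have "w s \<bullet> w t = \<epsilon> * \<epsilon> * (cos s * cos t) + \<sigma> * \<sigma> * (sin s * sin t)"
      by (simp add: inner2 w_i)
    then show ?thesis by (simp add: sq cos_diff)
  qed
  have norm_w: "norm (w t) = 1" for t by (simp add: norm_eq_sqrt_inner w_inner)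
  have dir: "u /\<^sub>R norm u = w (arctan (q / p))"
    if u: "u $ i0 = \<epsilon> * p" "u $ i1 = \<sigma> * q" and p: "p > 0" for u p q
  proof -
    let ?s = "sqrt (1 + (q / p)\<^sup>2)"
    have s0: "?s > 0" by (simp add: add_pos_nonneg)
    have "u \<bullet> u = \<epsilon> * \<epsilon> * p\<^sup>2 + \<sigma> * \<sigma> * q\<^sup>2" by (simp add: inner2 u power2_eq_square)
    also have "\<dots> = p\<^sup>2 * (1 + (q / p)\<^sup>2)" using p by (simp add: sq field_simps)
    finally have nu: "norm u = p * ?s" using p by (simp add: norm_eq_sqrt_inner real_sqrt_mult)
    show ?thesis
      by (rule eqI) (use p s0 in \<open>simp_all add: nu u w_i sin_arctan cos_arctan field_simps\<close>)
  qed
  define \<phi>0 where "\<phi>0 = arctan v"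
  define \<phi>z where "\<phi>z = arctan vz"
  have x: "x = w \<phi>0" using dir[of a 1 v] ai by (simp add: \<phi>0_def)
  have z: "z = w \<phi>z" using dir[of c 1 vz] ci by (simp add: \<phi>z_def \<epsilon>_def)
  have xA: "x \<in> A_set d f" using x_vertex by (simp add: vertices_def)
  note zx = zeta[OF xA]
  obtain \<phi>s where \<phi>s: "zeta x = w \<phi>s" "\<bar>\<phi>s\<bar> < pi / 2"
  proof -
    have cos: "7 / 10 \<le> cos \<phi>0"
    proof -
      have "sqrt (1 + v\<^sup>2) \<le> 10 / 7"
        using v01 power_mono[of v 1 2] by (intro real_le_lsqrt) (auto simp: power2_eq_square)
      then have "1 / (10 / 7) \<le> 1 / sqrt (1 + v\<^sup>2)"
        by (intro divide_left_mono) (auto simp: add_pos_nonneg)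
      then show ?thesis by (simp add: \<phi>0_def cos_arctan)
    qed
    have "\<bar>(x - zeta x) $ i0\<bar> \<le> 145 / 1000"
      using component_le_norm_cart[of "x - zeta x" i0] zx(4) radius_le[OF xA] by linarith
    then have "\<bar>\<epsilon> * cos \<phi>0 - zeta x $ i0\<bar> \<le> 145 / 1000" by (simp only: vector_minus_component x w_i)
    then have "\<bar>\<epsilon> * (\<epsilon> * cos \<phi>0 - zeta x $ i0)\<bar> \<le> 145 / 1000"
      using c_i0 by (simp add: abs_mult \<epsilon>_def)
    then have "\<bar>cos \<phi>0 - \<epsilon> * zeta x $ i0\<bar> \<le> 145 / 1000"
      by (simp add: right_diff_distrib sq')
    then have pos: "\<epsilon> * zeta x $ i0 > 0" using cos by linarith
    have "zeta x /\<^sub>R norm (zeta x) = w (arctan ((\<sigma> * zeta x $ i1) / (\<epsilon> * zeta x $ i0)))"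
      by (rule dir[OF _ _ pos]) (simp_all add: sq')
    then show ?thesis using that zx(3) arctan_bounded by (metis abs_less_iff inverse_1 minus_less_iff scaleR_one)
  qed
  define N where "N = 1 + v\<^sup>2"
  have N: "N \<ge> 1" "2 * v \<le> N"
    using zero_le_power2[of "v - 1"] by (auto simp: N_def power2_eq_square algebra_simps)
  have dz: "\<bar>\<phi>z - \<phi>0\<bar> \<le> \<eta> * (1 / 2 / (N - v / 8))"
  proof -
    have "\<eta> / 2 \<le> 1 / 8" using eta(2) by simp
    from order_trans[OF abs_ge_self order_trans[OF vvz this]]
    have "v * (v - vz) \<le> v * (1 / 8)" using v01(1) by (rule mult_left_mono)
    then have p: "N - v / 8 \<le> 1 + vz * v" by (simp add: N_def power2_eq_square algebra_simps)
    have p0: "N - v / 8 > 0" using N v01 by linarith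
    then have p1: "1 + vz * v > 0" using p by linarith
    have "\<bar>\<phi>z - \<phi>0\<bar> \<le> \<bar>(vz - v) / (1 + vz * v)\<bar>"
      unfolding \<phi>z_def \<phi>0_def arctan_diff[OF p1] by (rule abs_arctan_le)
    also have "\<dots> = \<bar>vz - v\<bar> / (1 + vz * v)" using p1 by (simp add: abs_divide)
    also have "\<dots> \<le> (\<eta> / 2) / (N - v / 8)"
      using vvz p p0 by (intro frac_le) (auto simp: abs_minus_commute)
    finally show ?thesis by (simp only: divide_divide_eq_left times_divide_eq_right mult_1_right mult.assoc)
  qed
  have ds: "\<bar>\<phi>s - \<phi>0\<bar> \<le> 45 / 1000 * \<eta>"
  proof -
    have "ang_dist x (zeta x) \<le> radius d f x" using zx(1) by (simp add: B_set_def)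
    moreover have "ang_dist x (zeta x) = \<bar>\<phi>s - \<phi>0\<bar>"
    proof -
      have le: "\<bar>\<phi>s - \<phi>0\<bar> \<le> pi"
        using \<phi>s(2) arctan_bounded[of v] by (auto simp: \<phi>0_def)
      have "ang_dist x (zeta x) = arccos (x \<bullet> w \<phi>s)" by (simp only: ang_dist_def \<phi>s(1))
      also have "x \<bullet> w \<phi>s = cos (\<phi>0 - \<phi>s)" by (simp only: x w_inner)
      also have "\<dots> = cos \<bar>\<phi>s - \<phi>0\<bar>" by (simp add: cos_diff mult.commute)
      finally show ?thesis using le by (simp add: arccos_cos del: cos_abs_real)
    qed
    moreover have "radius d f x \<le> 8 / 100 * norm (gnomonic x z)"
      and "norm (gnomonic x z) \<le> 9 / 8 * (\<eta> / 2) / norm a"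
    proof -
      have nac: "norm (a - c) \<le> \<eta> / 2" using norm_a_minus_c n by simp
      have "(\<eta> / 2)\<^sup>2 \<le> (1 / 8)\<^sup>2" using eta by (intro power_mono) auto
      then have "(\<eta> / 2)\<^sup>2 \<le> 1 / 5" by (rule order_trans) (simp add: power2_eq_square)
      note g = norm_gnomonic_le[OF norm_a norm_c nac this]
      show "norm (gnomonic x z) \<le> 9 / 8 * (\<eta> / 2) / norm a" by (rule g(2))
      show "radius d f x \<le> 8 / 100 * norm (gnomonic x z)"
        using ne by (intro radius_le_of_other_zero xA norms z_zero g(1)) auto
    qed
    moreover have "9 / 8 * (\<eta> / 2) / norm a \<le> 9 / 8 * (\<eta> / 2) / 1"
      using norm_a by (intro divide_left_mono) auto
    moreover have "p \<le> 45 / 1000 * e"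
      if "q \<le> r" "q = p" "r \<le> 8 / 100 * g" "g \<le> h" "h \<le> 9 / 8 * (e / 2) / 1" for p q r g h e :: real
      using that by simp
    ultimately show ?thesis by blast
  qed
  have large: "(?g (b /\<^sub>R norm b))\<^sup>2 > D * \<eta>\<^sup>2 / 4"
    if b: "b \<in> grid" "b = a + s *\<^sub>R axis i 1" "\<bar>s\<bar> = \<eta>" "2 * (a $ i)\<^sup>2 \<le> (norm a)\<^sup>2" for b s i
  proof (rule ccontr)
    assume "\<not> ?thesis"
    then have "(norm (eval_sys f (b /\<^sub>R norm b)))\<^sup>2 \<le> D * \<eta>\<^sup>2 / 4" unfolding norm_eval by simp
    also have "\<dots> = (\<eta> * sqrt (real CARD('n) * D) / 2)\<^sup>2"
      by (simp add: n power_mult_distrib power_divide)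
    finally have "norm (eval_sys f (b /\<^sub>R norm b)) \<le> \<eta> * sqrt (real CARD('n) * D) / 2"
      by (rule power2_le_imp_le) simp
    then have "b /\<^sub>R norm b \<in> vertices d f \<eta>" by (rule in_vertices[OF b(1)])
    then have "zeta x = z" using b n by (intro unit_step[of s i]) auto
    with ne show False by simp
  qed
  obtain p where p: "v * K = real_of_int p"
  proof -
    have "a $ i1 * K \<in> \<int>" using a_grid by (simp add: grid_def)
    then have "\<sigma> * (a $ i1 * K) \<in> \<int>" by (simp add: \<sigma>_def)
    moreover have "\<sigma> * (a $ i1 * K) = v * K" by (simp add: ai sq' mult.assoc)
    ultimately show ?thesis using that by (auto elim: Ints_cases)
  qed
  have vp: "v = p / K" using p K4 by (simp add: field_simps)
  have pK: "0 \<le> p" "p \<le> int K" using v01 K4 unfolding vp by (auto simp: zero_le_divide_iff)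
  have v_eta: "v = 0 \<or> \<eta> \<le> v"
  proof (cases "p = 0")
    case False
    then have "1 \<le> real_of_int p" using pK by linarith
    then show ?thesis unfolding vp by (intro disjI2 divide_right_mono) auto
  qed (simp add: vp)
  have grid2: "b \<in> grid" if "b $ i0 * K \<in> \<int>" "b $ i1 * K \<in> \<int>" "\<bar>b $ i0\<bar> \<le> 1" "\<bar>b $ i1\<bar> \<le> 1" "\<bar>b $ j\<bar> = 1" for b j
  proof (rule gridI[OF _ _ that(5)])
    fix l
    have "l = i0 \<or> l = i1" using i1(1) by blast
    then show "b $ l * K \<in> \<int>" "\<bar>b $ l\<bar> \<le> 1" using that by auto
  qed
  have \<sigma>p: "\<sigma> * real_of_int k \<in> \<int>" "\<epsilon> * real_of_int k \<in> \<int>" for k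
    using c_i0 by (auto simp: \<sigma>_def \<epsilon>_def abs_if split: if_splits)
  have abs1: "\<bar>\<sigma>\<bar> = 1" "\<bar>\<epsilon>\<bar> = 1" using c_i0 by (auto simp: \<sigma>_def \<epsilon>_def)
  have i1_le: "2 * (a $ i1)\<^sup>2 \<le> (norm a)\<^sup>2" by (rule component_le[OF i1(2)])
  have NK: "\<epsilon> * K \<in> \<int>" using \<sigma>p(2)[of "int K"] by simp
  have step: "(?g (w (arctan (v + s * \<eta>))))\<^sup>2 > D * \<eta>\<^sup>2 / 4" if s: "s = 1 \<or> s = - 1" and vs: "\<bar>v + s * \<eta>\<bar> \<le> 1" for s :: real
  proof -
    define b where "b = a + (\<sigma> * s * \<eta>) *\<^sub>R axis i1 1"
    have bi: "b $ i0 = \<epsilon> * 1" "b $ i1 = \<sigma> * (v + s * \<eta>)"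
      using i1(2) by (simp_all add: b_def ai axis_def algebra_simps)
    have "b $ i1 * K \<in> \<int>"
    proof -
      have "b $ i1 * K = \<sigma> * real_of_int (p + (if s = 1 then 1 else - 1))"
        using s K4 by (auto simp: bi vp field_simps)
      then show ?thesis by (simp only: \<sigma>p(1))
    qed
    then have "b \<in> grid"
      using NK vs by (intro grid2[of b i0]) (auto simp: bi abs_mult abs1)
    moreover have "\<bar>\<sigma> * s * \<eta>\<bar> = \<eta>" using s by (auto simp: abs_mult abs1)
    ultimately have "(?g (b /\<^sub>R norm b))\<^sup>2 > D * \<eta>\<^sup>2 / 4"
      by (rule large[OF _ b_def _ i1_le])
    moreover have "b /\<^sub>R norm b = w (arctan (v + s * \<eta>))" using dir[OF bi] by simp
    ultimately show ?thesis by simp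
  qed
  define m where "m = v / 4 / (N\<^sup>2 - v\<^sup>2 / 16)"
  have NN: "v\<^sup>2 / 16 < N\<^sup>2"
  proof -
    have "v\<^sup>2 \<le> N\<^sup>2" using N v01 by (intro power_mono) auto
    moreover have "N\<^sup>2 > 0" using N by simp
    ultimately show ?thesis by linarith
  qed
  have m0: "m \<ge> 0" using v01 NN by (simp add: m_def)
  \<comment> \<open>The neighbour on the side of growing angle. For \<open>v = 1\<close> it lies
    past the corner, on the adjacent edge.\<close>
  obtain \<alpha> where \<alpha>: "0 < \<alpha>" "\<alpha> \<le> arctan \<eta>" "(?g (w (\<phi>0 + \<alpha>)))\<^sup>2 > D * \<eta>\<^sup>2 / 4"
    "\<bar>\<alpha> - (\<phi>0 - arctan (v - \<eta>))\<bar> \<le> 2 * m * \<eta>"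
  proof (cases "v = 1")
    case False
    then have "p \<noteq> int K" using K4 by (auto simp: vp)
    then have "real_of_int p + 1 \<le> K" using pK by linarith
    then have v1: "v + \<eta> \<le> 1" using K4 unfolding vp by (simp add: field_simps)
    note st = arctan_step[OF v01 eta]
    show ?thesis
    proof (rule that[of "arctan (v + \<eta>) - \<phi>0"])
      show "0 < arctan (v + \<eta>) - \<phi>0" "arctan (v + \<eta>) - \<phi>0 \<le> arctan \<eta>"
        unfolding \<phi>0_def by (rule st)+
      have "\<bar>v + 1 * e\<bar> \<le> 1" if "v + e \<le> 1" "0 < e" for e using that v01 by simp
      from step[OF disjI1[OF refl] this[OF v1 eta(1)]]
      show "(?g (w (\<phi>0 + (arctan (v + \<eta>) - \<phi>0))))\<^sup>2 > D * \<eta>\<^sup>2 / 4" by simp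
      show "\<bar>arctan (v + \<eta>) - \<phi>0 - (\<phi>0 - arctan (v - \<eta>))\<bar> \<le> 2 * m * \<eta>"
        unfolding \<phi>0_def m_def N_def by (rule st)
    qed
  next
    case True
    define b where "b = a + (- \<epsilon> * \<eta>) *\<^sub>R axis i0 1"
    have bi: "b $ i0 = \<epsilon> * (1 - \<eta>)" "b $ i1 = \<sigma> * 1"
      using i1(2) True by (simp_all add: b_def ai axis_def algebra_simps)
    note st = arctan_corner_step[OF eta]
    show ?thesis
    proof (rule that[of "arctan (1 / (1 - \<eta>)) - \<phi>0"])
      show "0 < arctan (1 / (1 - \<eta>)) - \<phi>0" "arctan (1 / (1 - \<eta>)) - \<phi>0 \<le> arctan \<eta>"
        unfolding \<phi>0_def True by (rule st)+
      have "b $ i0 * K \<in> \<int>"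
      proof -
        have "b $ i0 * K = \<epsilon> * real_of_int (int K - 1)"
          using K4 by (simp add: bi field_simps)
        then show ?thesis by (simp only: \<sigma>p(2))
      qed
      moreover have "b $ i1 * K \<in> \<int>" using \<sigma>p(1)[of "int K"] by (simp add: bi)
      moreover have "\<bar>1 - \<eta>\<bar> \<le> 1" using eta by (simp add: abs_le_iff)
      ultimately have bg: "b \<in> grid" by (intro grid2[of b i1]) (simp_all add: bi abs_mult abs1)
      have "2 * (a $ i0)\<^sup>2 \<le> (norm a)\<^sup>2"
        unfolding power2_norm_eq_inner inner2 ai True using sq by (simp add: power2_eq_square)
      then have "(?g (b /\<^sub>R norm b))\<^sup>2 > D * \<eta>\<^sup>2 / 4"
        by (intro large[OF bg b_def]) (simp_all add: abs_mult abs1)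
      moreover have "b /\<^sub>R norm b = w (arctan (1 / (1 - \<eta>)))" by (rule dir[OF bi]) (use eta in linarith)
      ultimately show "(?g (w (\<phi>0 + (arctan (1 / (1 - \<eta>)) - \<phi>0))))\<^sup>2 > D * \<eta>\<^sup>2 / 4" by simp
      show "\<bar>arctan (1 / (1 - \<eta>)) - \<phi>0 - (\<phi>0 - arctan (v - \<eta>))\<bar> \<le> 2 * m * \<eta>"
        unfolding \<phi>0_def True using st(3) m0 by simp
    qed
  qed
  define \<beta> where "\<beta> = \<phi>0 - arctan (v - \<eta>)"
  have \<beta>: "0 < \<beta>" "\<beta> \<le> arctan \<eta>" "(?g (w (\<phi>0 - \<beta>)))\<^sup>2 > D * \<eta>\<^sup>2 / 4"
  proof -
    have one: "1 + v * (v - \<eta>) \<ge> 1" using v_eta v01 by auto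
    from arctan_back_step[OF one eta(1)]
    show "0 < \<beta>" "\<beta> \<le> arctan \<eta>" unfolding \<beta>_def \<phi>0_def by simp_all
    have "\<bar>v + - 1 * e\<bar> \<le> 1" if "0 < e" "e \<le> 1 / 4" for e using that v01 by simp
    from step[OF disjI2[OF refl] this[OF eta]]
    show "(?g (w (\<phi>0 - \<beta>)))\<^sup>2 > D * \<eta>\<^sup>2 / 4" by (simp add: \<beta>_def)
  qed
  \<comment> \<open>The angular steps \<open>\<alpha>\<close> and \<open>\<beta>\<close> differ in
    general. Recentring at \<open>M\<close> puts the two neighbours at the symmetric angles
    \<open>h\<close> and \<open>- h\<close>, as \<open>two_zeros_bound\<close> demands;
    \<open>dm\<close> bounds the shift.\<close>
  define h where "h = (\<alpha> + \<beta>) / 2"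
  define M where "M = \<phi>0 + (\<alpha> - \<beta>) / 2"
  have Mh: "M + h = \<phi>0 + \<alpha>" "M + - h = \<phi>0 - \<beta>" by (simp_all add: M_def h_def field_simps)
  have dm: "\<bar>M - \<phi>0\<bar> \<le> m * \<eta>"
  proof -
    have "\<bar>M - \<phi>0\<bar> \<le> m * e" if "\<bar>\<alpha> - \<beta>\<bar> \<le> 2 * m * e" for e using that by (simp add: M_def)
    then show ?thesis using \<alpha>(4) by (simp only: \<beta>_def)
  qed
  have h: "0 < h" "h \<le> arctan \<eta>" using \<alpha> \<beta> by (auto simp: h_def)
  have h2: "h < pi / 2" using h(2) arctan_ubound[of \<eta>] by linarith
  have num: "1 / 2 / (N - v / 8) + 2 * m \<le> 62 / 100" "m \<le> 127 / 1000"
  proof -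
    have "2 * (v / 4 / y) = v / 2 / y" for y by simp
    then show "1 / 2 / (N - v / 8) + 2 * m \<le> 62 / 100" "m \<le> 127 / 1000"
      using mesh_angle_bound[OF v01] by (simp_all only: m_def N_def)
  qed
  have sM: "\<bar>\<phi>s - M\<bar> \<le> 172 / 1000 * \<eta>"
    using ds dm mult_right_mono[OF num(2), of \<eta>] eta by linarith
  have szM: "\<bar>\<phi>s - M\<bar> + \<bar>\<phi>z - M\<bar> \<le> 665 / 1000 * \<eta>"
  proof -
    have "(1 / 2 / (N - v / 8) + 2 * m) * \<eta> \<le> 62 / 100 * \<eta>" using num(1) eta by (intro mult_right_mono) auto
    moreover have "(1 / 2 / (N - v / 8) + 2 * m) * \<eta> = \<eta> * (1 / 2 / (N - v / 8)) + 2 * (m * \<eta>)"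
      by (simp only: ring_distribs mult_ac)
    ultimately show ?thesis using ds dz dm by linarith
  qed
  have small: "\<bar>\<phi>s - M\<bar> \<le> 17 / 100" "\<bar>\<phi>z - M\<bar> \<le> 17 / 100" using szM eta by linarith+
  have pi3: "pi / 2 > 17 / 100" using pi_gt3 by linarith
  \<comment> \<open>The binary form dehomogenized in the orthonormal basis at angle
    \<open>M\<close>, so that the parameter is the tangent of the angle measured from
    \<open>M\<close>.\<close>
  define P where "P = (\<lambda>t. ?g (w M + t *\<^sub>R w (M + pi / 2)))"
  have w_orth: "w (M + pi / 2) $ i0 = - (\<epsilon> * sin M)" "w (M + pi / 2) $ i1 = \<sigma> * cos M"
    by (simp_all add: w_i cos_add sin_add)
  have P_tan: "P (tan t) = (1 / cos t) ^ D * ?g (w (M + t))" if "cos t \<noteq> 0" for t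
  proof -
    have "w M + tan t *\<^sub>R w (M + pi / 2) = (1 / cos t) *\<^sub>R w (M + t)"
    proof (rule eqI)
      have "\<epsilon> * cos M + tan t * - (\<epsilon> * sin M) = 1 / cos t * (\<epsilon> * cos (M + t))"
        using that by (simp add: cos_add tan_def field_simps)
      then show "(w M + tan t *\<^sub>R w (M + pi / 2)) $ i0 = ((1 / cos t) *\<^sub>R w (M + t)) $ i0"
        by (simp only: vector_add_component vector_scaleR_component w_orth w_i(1)[of M] w_i(1)[of "M + t"] real_scaleR_def)
      have "\<sigma> * sin M + tan t * (\<sigma> * cos M) = 1 / cos t * (\<sigma> * sin (M + t))"
        using that by (simp add: sin_add tan_def field_simps)
      then show "(w M + tan t *\<^sub>R w (M + pi / 2)) $ i1 = ((1 / cos t) *\<^sub>R w (M + t)) $ i1"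
        by (simp only: vector_add_component vector_scaleR_component w_orth w_i(2)[of M] w_i(2)[of "M + t"] real_scaleR_def)
    qed
    then show ?thesis by (simp add: P_def eval_poly_scaleR[OF homogeneous] Dj)
  qed
  have cos0: "cos t \<noteq> 0" if "\<bar>t\<bar> < pi / 2" for t :: real
    using that by (auto intro!: less_imp_neq[symmetric] cos_gt_zero_pi)
  have P_sq: "(P (tan t))\<^sup>2 = (1 + (tan t)\<^sup>2) ^ D * (?g (w (M + t)))\<^sup>2" if "\<bar>t\<bar> < pi / 2" for t
  proof -
    have "(1 / cos t)\<^sup>2 = 1 + (tan t)\<^sup>2" using cos0[OF that] tan_sec[of t] by (simp add: inverse_eq_divide power_divide)
    then show ?thesis
      unfolding P_tan[OF cos0[OF that]] power_mult_distrib by (simp add: power_mult[symmetric] mult.commute[of D] power_mult)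
  qed
  have gz: "?g y = 0" if "eval_sys f y = 0" for y using that by (simp add: eval_sys_def vec_eq_iff)
  show False
  proof (rule two_zeros_bound[where ?o1.0 = "w M" and ?o2.0 = "w (M + pi / 2)" and p = "f j0" and d = D and P = P
        and r = "tan (\<phi>s - M)" and q = "tan (\<phi>z - M)" and T = "tan h" and e = \<eta>])
    show "P t = ?g (w M + t *\<^sub>R w (M + pi / 2))" for t by (simp add: P_def)
    show "homogeneous_of_degree D (f j0)" using homogeneous[of j0] Dj by simp
    show "poly_norm D (f j0) = 1" using N1 Dj by simp
    show "norm (w M) = 1" "norm (w (M + pi / 2)) = 1" by (rule norm_w)+
    show "w M \<bullet> w (M + pi / 2) = 0" by (simp add: w_inner)
    show "P (tan (\<phi>s - M)) = 0"
      using P_tan[of "\<phi>s - M"] gz[OF zx(2)] cos0[of "\<phi>s - M"] small pi3 by (simp add: \<phi>s)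
    show "P (tan (\<phi>z - M)) = 0"
      using P_tan[of "\<phi>z - M"] gz[OF z_zero] cos0[of "\<phi>z - M"] small pi3 by (simp add: z)
    show "tan (\<phi>s - M) \<noteq> tan (\<phi>z - M)"
    proof
      have "arctan (tan t) = t" if "\<bar>t\<bar> \<le> 17 / 100" for t
        by (rule arctan_tan) (use that pi3 in linarith)+
      note inv = this[OF small(1)] this[OF small(2)]
      assume "tan (\<phi>s - M) = tan (\<phi>z - M)"
      then have "\<phi>s - M = \<phi>z - M" using inv by metis
      then show False using ne \<phi>s(1) z by simp
    qed
    show "0 < tan h" using h h2 by (intro tan_gt_zero) auto
    have "tan h \<le> tan (arctan \<eta>)" using h arctan_bounded[of \<eta>] by (intro tan_mono_le) auto
    then show "tan h \<le> \<eta>" by (simp add: tan_arctan)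
    show "\<eta> \<le> 1 / 4" by (rule eta(2))
    note ts = abs_tan_le[OF small(1)] abs_tan_le[OF small(2)]
    \<comment> \<open>Passing from angles to tangents costs 1.015, and
      \<open>0.172 * 1.015 < 0.175\<close>, \<open>0.665 * 1.015 < 0.675\<close>.\<close>
    have "t \<le> 175 / 1000 * e" if "t \<le> 1015 / 1000 * s" "s \<le> 172 / 1000 * e" "0 < e" for s t e :: real
      using that by linarith
    from this[OF ts(1) sM eta(1)] show "\<bar>tan (\<phi>s - M)\<bar> \<le> 175 / 1000 * \<eta>" .
    have "t + t' \<le> 675 / 1000 * e"
      if "t \<le> 1015 / 1000 * s" "t' \<le> 1015 / 1000 * s'" "s + s' \<le> 665 / 1000 * e" "0 < e" for s t s' t' e :: real
      using that by linarith
    from this[OF ts szM eta(1)]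
    show "\<bar>tan (\<phi>s - M)\<bar> + \<bar>tan (\<phi>z - M)\<bar> \<le> 675 / 1000 * \<eta>" .
    have pos: "(1 + (tan h)\<^sup>2) ^ D > 0" by (simp add: add_pos_nonneg)
    have "\<bar>h\<bar> < pi / 2" "\<bar>- h\<bar> < pi / 2" using h h2 by simp_all
    note sq_h = P_sq[OF this(1)] P_sq[OF this(2), unfolded tan_minus power2_minus]
    show "D * \<eta>\<^sup>2 / 4 * (1 + (tan h)\<^sup>2) ^ D < (P (tan h))\<^sup>2"
      unfolding sq_h Mh mult.commute[of "D * \<eta>\<^sup>2 / 4"] by (rule mult_strict_left_mono[OF \<alpha>(3) pos])
    show "D * \<eta>\<^sup>2 / 4 * (1 + (tan h)\<^sup>2) ^ D < (P (- tan h))\<^sup>2"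
      unfolding sq_h Mh mult.commute[of "D * \<eta>\<^sup>2 / 4"] by (rule mult_strict_left_mono[OF \<beta>(3) pos])
  qed
qed

lemma zero_in_image_zeta: "z \<in> zeta ` vertices d f \<eta>"
proof -
  consider "CARD('n) = 1" | "2 \<le> CARD('n)" "CARD('n) \<le> 25" | "25 \<le> CARD('n)"
    using zero_less_card_finite[where 'a='n] by linarith
  then have "zeta x = z" by cases (auto intro: small_case medium_case large_case)
  then show ?thesis using x_vertex by (metis imageI)
qed

end

section \<open>Counting the zeros\<close>

context stopped_system
begin

lemma zeros_eq: "{\<zeta> \<in> sphere 0 1. eval_sys f \<zeta> = 0} = zeta ` vertices d f \<eta>"
proof (intro equalityI subsetI)
  fix z :: "real^'m"
  assume "z \<in> zeta ` vertices d f \<eta>"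
  then obtain x where "x \<in> vertices d f \<eta>" "z = zeta x" by blast
  moreover from this have "x \<in> A_set d f" by (simp add: vertices_def)
  ultimately show "z \<in> {\<zeta> \<in> sphere 0 1. eval_sys f \<zeta> = 0}" using zeta by simp
next
  fix z :: "real^'m"
  assume "z \<in> {\<zeta> \<in> sphere 0 1. eval_sys f \<zeta> = 0}"
  then have z: "norm z = 1" "eval_sys f z = 0" by auto
  have "Max (range (\<lambda>i. \<bar>z $ i\<bar>)) \<in> range (\<lambda>i. \<bar>z $ i\<bar>)" by (rule Max_in) simp_all
  then obtain i0 where "Max (range (\<lambda>i. \<bar>z $ i\<bar>)) = \<bar>z $ i0\<bar>" by blast
  then have max: "\<bar>z $ i\<bar> \<le> \<bar>z $ i0\<bar>" for i by (metis Max_ge finite finite_imageI rangeI)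
  have i0: "\<bar>z $ i0\<bar> > 0"
  proof (rule ccontr)
    assume "\<not> ?thesis"
    then have "z $ i = 0" for i using max[of i] by simp
    then have "z = 0" by (simp add: vec_eq_iff)
    with z show False by simp
  qed
  \<comment> \<open>The zero scaled to the cube surface. Its coordinate \<open>i0\<close> is 1 or
    -1, hence unchanged by rounding to multiples of \<open>1 / K\<close>, so the rounded point
    \<open>a\<close> stays on the same face.\<close>
  define c where "c = (1 / \<bar>z $ i0\<bar>) *\<^sub>R z"
  define a where "a = ((\<chi> i. of_int (round (c $ i * K)) / real K) :: real^'m)"
  have c_le: "\<bar>c $ i\<bar> \<le> 1" for i using max[of i] i0 by (simp add: c_def abs_mult)
  have c_i0: "\<bar>c $ i0\<bar> = 1" using i0 by (simp add: c_def abs_mult)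
  have K0: "real K > 0" using K4 by simp
  have aK: "a $ i * K = of_int (round (c $ i * K))" for i using K0 by (simp add: a_def)
  have round_le: "\<bar>a $ i\<bar> \<le> 1" for i
  proof -
    have "- real K \<le> c $ i * K" "c $ i * K \<le> real K"
      using c_le[of i] mult_right_mono[of "- 1" "c $ i" "real K"] mult_right_mono[of "c $ i" 1 "real K"]
      by (simp_all add: abs_le_iff)
    then have "round (- real K) \<le> round (c $ i * K)" "round (c $ i * K) \<le> round (real K)"
      by (simp_all only: round_mono)
    moreover have "round (- real K) = - int K" using round_of_int[of "- int K"] by simp
    ultimately have "- int K \<le> round (c $ i * K)" "round (c $ i * K) \<le> int K" by simp_all
    then have "\<bar>of_int (round (c $ i * K))\<bar> \<le> real K" by linarith
    then show ?thesis using K0 by (simp add: a_def abs_divide)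
  qed
  have a_i0: "a $ i0 = c $ i0"
  proof -
    have "c $ i0 * K = of_int (int K) \<or> c $ i0 * K = of_int (- int K)"
      using c_i0 by (auto simp: abs_if split: if_splits)
    then have "of_int (round (c $ i0 * K)) = c $ i0 * K" by (metis round_of_int)
    then show ?thesis using K0 by (simp add: a_def)
  qed
  interpret cell: stopped_cell d f K a c i0
  proof unfold_locales
    show "a \<in> grid" using aK round_le a_i0 c_i0 by (intro gridI[of _ i0]) simp_all
    show "\<bar>c $ i\<bar> \<le> 1" for i by (rule c_le)
    show "\<bar>c $ i0\<bar> = 1" by (rule c_i0)
    show "a $ i0 = c $ i0" by (rule a_i0)
    show "\<bar>a $ i - c $ i\<bar> \<le> \<eta> / 2" for i
    proof -
      have "(a $ i - c $ i) * K = of_int (round (c $ i * K)) - c $ i * K"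
        by (simp only: left_diff_distrib aK)
      then have "\<bar>a $ i - c $ i\<bar> * K = \<bar>of_int (round (c $ i * K)) - c $ i * K\<bar>"
        by (metis abs_mult abs_of_nat)
      also have "\<dots> \<le> 1 / 2" by (rule of_int_round_abs_le)
      finally show ?thesis using K0 by (simp add: field_simps)
    qed
    show "eval_sys f c = 0" unfolding c_def by (rule eval_sys_scaleR_eq_0[OF z(2)])
  qed
  have "c /\<^sub>R norm c = z" using i0 z(1) by (simp add: c_def)
  then show "z \<in> zeta ` vertices d f \<eta>" using cell.zero_in_image_zeta by simp
qed

end

theorem theorem12p2:
  fixes d :: "'n::finite \<Rightarrow> nat"
    and f :: "'n \<Rightarrow> 'm::finite rpoly"
    and r :: nat
  assumes "CARD('m) = CARD('n) + 1"
    and "\<And>i. d i \<ge> 1"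
    and "f \<in> sphere_Hd d"
    and "RootCount d f = Some r"
  shows "finite {\<zeta> \<in> sphere 0 1. eval_sys f \<zeta> = 0}
    \<and> r = card {\<zeta> \<in> sphere 0 1. eval_sys f \<zeta> = 0}"
proof -
  let ?n = "CARD('n)"
  let ?P = "\<lambda>\<eta>. \<exists>t. \<eta> = 1 / 2 ^ t \<and> (2::nat) ^ t \<ge> 4 \<and> 8 * ?n \<le> (2 ^ t)\<^sup>2"
  obtain \<eta> where \<eta>: "while_option (\<lambda>\<eta>. \<not> stop_cond d f \<eta>) (\<lambda>\<eta>. \<eta> / 2) (eta_init TYPE('n) / 2) = Some \<eta>"
    and r: "r = card (components_G d f \<eta>)"
    using assms(4) by (auto simp: RootCount_def)
  have "?P \<eta>"
  proof (rule while_option_rule[OF _ \<eta>, where P = ?P])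
    fix s :: real
    assume "?P s"
    then obtain t where t: "s = 1 / 2 ^ t" "(2::nat) ^ t \<ge> 4" "8 * ?n \<le> (2 ^ t)\<^sup>2" by blast
    have "(2 ^ t)\<^sup>2 \<le> ((2::nat) ^ Suc t)\<^sup>2" by (intro power_mono) auto
    with t have "s / 2 = 1 / 2 ^ Suc t \<and> (2::nat) ^ Suc t \<ge> 4 \<and> 8 * ?n \<le> (2 ^ Suc t)\<^sup>2"
      by simp
    then show "?P (s / 2)" by blast
  next
    \<comment> \<open>From \<open>l > 0\<close> the rounded exponent is at least 1, so the halved
      starting size is at most 1/4. The estimate \<open>sqrt (2 * n) \<le> 2 ^ k\<close> becomes
      \<open>8 * n \<le> (2 ^ Suc k)^2\<close> after squaring and the halving.\<close>
    define l where "l = log 2 (sqrt (2 * real ?n))"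
    have n: "2 * real ?n > 1" using zero_less_card_finite[where 'a='n] by linarith
    then have "l > 0" unfolding l_def by (simp add: zero_less_log_cancel_iff)
    then obtain k where k: "\<lceil>l\<rceil> = int k" "k \<ge> 1"
      by (metis int_one_le_iff_zero_less less_imp_le of_nat_1 of_nat_le_iff zero_le_imp_eq_int zero_less_ceiling)
    have "eta_init TYPE('n) / 2 = 1 / 2 ^ Suc k"
      unfolding eta_init_def l_def[symmetric] k(1) by (simp add: power_int_minus field_simps)
    moreover have "(2::nat) ^ 2 \<le> 2 ^ Suc k" using k(2) by (intro power_increasing) auto
    moreover have "8 * ?n \<le> (2 ^ Suc k)\<^sup>2"
    proof -
      have "l \<le> k" using k(1) by linarith
      then have "2 powr l \<le> 2 powr k" by simp
      then have "sqrt (2 * real ?n) \<le> 2 ^ k" using n by (simp add: l_def powr_realpow)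
      then have "(sqrt (2 * real ?n))\<^sup>2 \<le> (2 ^ k)\<^sup>2" by (intro power_mono) auto
      then have "real (8 * ?n) \<le> real ((2 ^ Suc k)\<^sup>2)" by simp
      then show ?thesis by (simp only: of_nat_le_iff)
    qed
    ultimately show "?P (eta_init TYPE('n) / 2)" by (intro exI[of _ "Suc k"]) simp
  qed
  then obtain t where t: "\<eta> = 1 / real (2 ^ t)" "(2::nat) ^ t \<ge> 4" "8 * ?n \<le> (2 ^ t)\<^sup>2" by auto
  interpret stopped_system d f "2 ^ t"
  proof
    show "stop_cond d f (1 / real (2 ^ t))" using while_option_stop[OF \<eta>] t(1) by simp
  qed (use assms t in auto)
  show ?thesis
    unfolding zeros_eq r t(1) card_components using finite_vertices by simp
qed

end
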